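(* Let $X=\mathbb{P}^n$. Let $d=3$ or $d\geq n+2$, and let $F\in T_d$ be a concise form of minimal border rank, i.e. $\underline{\mathbf{rk}}(F)=n+1$. Then $\mathrm{Hess}(F)\neq 0$ if and only if $\underline{\mathrm{VSP}}(F,n+1)$ consists of a unique saturated ideal. When this holds, the unique saturated ideal is $(\mathrm{Ann}(F)_2)$.
   Context: $S=\mathbb{C}[y_0,\dots,y_n]$ and $T=\mathbb{C}[x_0,\dots,x_n]$ are standard graded, $S$ acting on $T$ by differentiation ($y_i\circ x_j=\delta_{ij}$). $\mathrm{Ann}(F)=\{\psi\in S:\psi\circ F=0\}$; $(\mathrm{Ann}(F)_2)$ is the ideal generated by its degree $2$ part. $F$ is concise if $\mathrm{Ann}(F)_1=0$. The border rank $\underline{\mathbf{rk}}(F)$ is the least $r$ with $[F]\in\sigma_r(\nu_d(\mathbb{P}^n))$, the $r$-th secant variety of the $d$-th Veronese variety in $\mathbb{P}(T_d)$. $\mathrm{Hess}(F)$ is the determinant of the Hessian matrix of second partial derivatives of $F$. Saturated means saturated with respect to $(y_0,\dots,y_n)$. $h_{r,\mathbb{P}^n}(k)=\min\{r,\dim_{\mathbb C}S_k\}$; $\mathrm{Hilb}_S^{h_{r,\mathbb{P}^n}}$ is the multigraded (Haiman–Sturmfels) Hilbert scheme of homogeneous ideals $I\subset S$ such that $S/I$ has Hilbert function $h_{r,\mathbb{P}^n}$; $\mathrm{Slip}_{r,\mathbb{P}^n}$ is its irreducible component that is the closure of the locus of saturated ideals of $r$ distinct points with Hilbert function $h_{r,\mathbb{P}^n}$.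 $\underline{\mathrm{VSP}}(F,r)=\{J\in\mathrm{Slip}_{r,\mathbb{P}^n}:J\subset\mathrm{Ann}(F)\}$. *)

theory Defs
  imports "HOL-Analysis.Analysis" "HOL-Library.Poly_Mapping"
begin

text \<open>
  A monomial is an exponent vector and a polynomial a finitely supported family of complex
  coefficients. For a finite index type \<open>'n\<close> of size \<open>n + 1\<close> the type \<open>'n mpoly\<close> serves both
  as \<open>S\<close> (operators) and as \<open>T\<close> (forms). Infinite index types occur only for the polynomial
  equations defining Zariski closed sets.
\<close>

type_synonym 'i monomial = "'i \<Rightarrow>\<^sub>0 nat"
type_synonym 'i mpoly = "'i monomial \<Rightarrow>\<^sub>0 complex"

definition Var :: "'i \<Rightarrow> 'i mpoly" where
  "Var i = Poly_Mapping.single (Poly_Mapping.single i 1) 1"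

definition Const :: "complex \<Rightarrow> 'i mpoly" where
  "Const c = Poly_Mapping.single 0 c"

definition mon_degree :: "'i monomial \<Rightarrow> nat" where
  "mon_degree m = (\<Sum>i\<in>Poly_Mapping.keys m. Poly_Mapping.lookup m i)"

definition forms :: "nat \<Rightarrow> 'i mpoly set" where
  "forms k = {p. \<forall>m\<in>Poly_Mapping.keys p. mon_degree m = k}"

definition eval :: "'i mpoly \<Rightarrow> ('i \<Rightarrow> complex) \<Rightarrow> complex" where
  "eval p x = (\<Sum>m\<in>Poly_Mapping.keys p. Poly_Mapping.lookup p m *
     (\<Prod>i\<in>Poly_Mapping.keys m. x i ^ Poly_Mapping.lookup m i))"

text \<open>
  \<open>poly_ideal.subspace\<close> and \<open>poly_ideal.span\<close> are "ideal" and "ideal generated by";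
  \<open>poly_space\<close> is linear algebra over the complex numbers.
\<close>

global_interpretation poly_ideal: module "(*) :: 'i mpoly \<Rightarrow> 'i mpoly \<Rightarrow> 'i mpoly"
  by standard (simp_all add: algebra_simps)

global_interpretation poly_space: vector_space "\<lambda>c p. Const c * p :: 'i mpoly"
proof
  show "Const a * (Const b * p) = Const (a * b) * p" for a b and p :: "'i mpoly"
    by (simp add: Const_def mult_single flip: mult.assoc)
qed (simp_all add: Const_def single_add distrib_left distrib_right)


subsection \<open>Apolarity\<close>

text \<open>
  The operator \<open>y\<^sup>a\<close> sends \<open>x\<^sup>m\<close> to \<open>(\<Prod>i. m\<^sub>i (m\<^sub>i - 1) \<cdots> (m\<^sub>i - a\<^sub>i + 1)) x\<^sup>m\<^sup>-\<^sup>a\<close>. The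
  subtractions below are truncated, but if \<open>a\<^sub>i > m\<^sub>i\<close> for some \<open>i\<close>, then the product has a
  factor \<open>0\<close>.
\<close>

definition act :: "'n::finite mpoly \<Rightarrow> 'n mpoly \<Rightarrow> 'n mpoly" where
  "act \<psi> F = (\<Sum>a\<in>Poly_Mapping.keys \<psi>. \<Sum>m\<in>Poly_Mapping.keys F.
     Poly_Mapping.single (m - a)
       (Poly_Mapping.lookup \<psi> a * Poly_Mapping.lookup F m *
        of_nat (\<Prod>i\<in>UNIV. \<Prod>t<Poly_Mapping.lookup a i. Poly_Mapping.lookup m i - t)))"

lemma act_single:
  "act (Poly_Mapping.single a c) (Poly_Mapping.single m e) =
     Poly_Mapping.single (m - a) (c * e *
       of_nat (\<Prod>i\<in>UNIV. \<Prod>t<Poly_Mapping.lookup a i. Poly_Mapping.lookup m i - t))"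
  by (cases "c = 0"; cases "e = 0") (simp_all add: act_def)

lemma act_zero [simp]: "act 0 F = 0" "act \<psi> 0 = 0"
  by (simp_all add: act_def)

lemma act_eq_sum:
  assumes "finite A" "Poly_Mapping.keys \<psi> \<subseteq> A" "finite M" "Poly_Mapping.keys F \<subseteq> M"
  shows "act \<psi> F = (\<Sum>a\<in>A. \<Sum>m\<in>M.
    act (Poly_Mapping.single a (Poly_Mapping.lookup \<psi> a))
      (Poly_Mapping.single m (Poly_Mapping.lookup F m)))"
proof -
  have "act \<psi> F = (\<Sum>a\<in>Poly_Mapping.keys \<psi>. \<Sum>m\<in>Poly_Mapping.keys F.
    act (Poly_Mapping.single a (Poly_Mapping.lookup \<psi> a))
      (Poly_Mapping.single m (Poly_Mapping.lookup F m)))"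
    unfolding act_single by (simp add: act_def)
  also have "\<dots> = (\<Sum>a\<in>A. \<Sum>m\<in>Poly_Mapping.keys F.
    act (Poly_Mapping.single a (Poly_Mapping.lookup \<psi> a))
      (Poly_Mapping.single m (Poly_Mapping.lookup F m)))"
    using assms by (intro sum.mono_neutral_left) (auto simp: act_single in_keys_iff)
  also have "\<dots> = (\<Sum>a\<in>A. \<Sum>m\<in>M.
    act (Poly_Mapping.single a (Poly_Mapping.lookup \<psi> a))
      (Poly_Mapping.single m (Poly_Mapping.lookup F m)))"
    using assms by (intro sum.cong refl sum.mono_neutral_left) (auto simp: act_single in_keys_iff)
  finally show ?thesis .
qed

lemma act_add_left: "act (\<psi> + \<phi>) F = act \<psi> F + act \<phi> F"
proof -
  have "Poly_Mapping.keys (\<psi> + \<phi>) \<subseteq> Poly_Mapping.keys \<psi> \<union> Poly_Mapping.keys \<phi>"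
    by (rule keys_add)
  then show ?thesis
    using act_eq_sum[of "Poly_Mapping.keys \<psi> \<union> Poly_Mapping.keys \<phi>" _ "Poly_Mapping.keys F" F]
    by (simp add: act_single lookup_add distrib_left distrib_right single_add sum.distrib)
qed

lemma act_add_right: "act \<psi> (F + G) = act \<psi> F + act \<psi> G"
proof -
  have "Poly_Mapping.keys (F + G) \<subseteq> Poly_Mapping.keys F \<union> Poly_Mapping.keys G"
    by (rule keys_add)
  then show ?thesis
    using act_eq_sum[of "Poly_Mapping.keys \<psi>" \<psi> "Poly_Mapping.keys F \<union> Poly_Mapping.keys G"]
    by (simp add: act_single lookup_add distrib_left distrib_right single_add sum.distrib)
qed

lemma mpoly_induct [case_names single add]:
  fixes p :: "'i mpoly"
  assumes "\<And>m c. P (Poly_Mapping.single m c)" and "\<And>p q. P p \<Longrightarrow> P q \<Longrightarrow> P (p + q)"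
  shows "P p"
proof (induction p rule: update_induct)
  case const
  show ?case using assms(1)[of 0 0] by simp
next
  case (update f a b)
  have "Poly_Mapping.update a b f = f + Poly_Mapping.single a b"
    using update by (intro poly_mapping_eqI)
      (auto simp: lookup_update lookup_add lookup_single in_keys_iff when_def)
  then show ?case using assms update by simp
qed

lemma act_mult: "act (\<psi> * \<phi>) F = act \<psi> (act \<phi> F)"
proof (induction \<psi> rule: mpoly_induct)
  case (single a c)
  show ?case
  proof (induction \<phi> rule: mpoly_induct)
    case (single b e)
    show ?case
    proof (induction F rule: mpoly_induct)
      case (single m f)
      have "(\<Prod>t<u + v. k - t) = (\<Prod>t<v. k - t) * (\<Prod>t<u. k - v - t)" for u v k :: nat
        by (induction u) (simp_all add: mult.assoc add.commute)
      then show ?case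
        by (simp add: act_single mult_single lookup_add lookup_minus prod.distrib
            diff_diff_eq add.commute mult_ac)
    qed (simp add: act_add_right)
  qed (simp add: distrib_left act_add_left act_add_right)
qed (simp add: distrib_right act_add_left)

lemma act_Var_Var: "act (Var i) (Var j) = (if i = j then 1 else 0)"
proof -
  have "(\<Prod>k\<in>UNIV. \<Prod>t<Poly_Mapping.lookup (Poly_Mapping.single i (1 :: nat)) k.
      Poly_Mapping.lookup (Poly_Mapping.single j (1 :: nat)) k - t) = (if i = j then 1 else 0)"
    by (subst prod.remove[of _ i]) (auto simp: lookup_single when_def intro!: prod.neutral)
  then show ?thesis by (simp add: Var_def act_single)
qed

definition Ann :: "'n::finite mpoly \<Rightarrow> 'n mpoly set" where
  "Ann F = {\<psi>. act \<psi> F = 0}"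

definition concise :: "'n::finite mpoly \<Rightarrow> bool" where
  "concise F \<longleftrightarrow> Ann F \<inter> forms 1 = {0}"

definition Hess :: "'n::finite mpoly \<Rightarrow> 'n mpoly" where
  "Hess F = det (\<chi> i j. act (Var i) (act (Var j) F))"


subsection \<open>Secant varieties of the Veronese variety and border rank\<close>

text \<open>
  Subsets of \<open>\<bbbP>(T\<^sub>d)\<close> are represented by the sets of all nonzero representatives of their
  points. The coordinates on \<open>T\<^sub>d\<close> are the coefficients of a form.
\<close>

definition proj_closed :: "nat \<Rightarrow> 'n::finite mpoly set \<Rightarrow> bool" where
  "proj_closed d Z \<longleftrightarrow> (\<exists>E :: 'n monomial mpoly set. E \<subseteq> (\<Union>k. forms k) \<and>
     Z = {F \<in> forms d - {0}. \<forall>p\<in>E. eval p (Poly_Mapping.lookup F) = 0})"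

definition secant_variety :: "nat \<Rightarrow> nat \<Rightarrow> 'n::finite mpoly set" where
  "secant_variety d r = proj_closed d hull
     {G \<in> forms d - {0}. \<exists>L. (\<forall>i<r. L i \<in> forms 1 - {0}) \<and>
        G \<in> poly_space.span ((\<lambda>i. L i ^ d) ` {..<r})}"

definition border_rank :: "nat \<Rightarrow> 'n::finite mpoly \<Rightarrow> nat" where
  "border_rank d F = (LEAST r. F \<in> secant_variety d r)"


subsection \<open>Homogeneous ideals and the multigraded Hilbert scheme\<close>

definition homogeneous_ideal :: "'i mpoly set \<Rightarrow> bool" where
  "homogeneous_ideal I \<longleftrightarrow> I = poly_ideal.span (\<Union>k. I \<inter> forms k)"

text \<open>Saturation with respect to \<open>\<mm> = (y\<^sub>0, \<dots>, y\<^sub>n)\<close>; the ideal \<open>\<mm>\<^sup>k\<close> is generated by \<open>S\<^sub>k\<close>.\<close>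

definition saturated :: "'i mpoly set \<Rightarrow> bool" where
  "saturated I \<longleftrightarrow> (\<forall>f. (\<exists>k. \<forall>g\<in>poly_ideal.span (forms k). g * f \<in> I) \<longrightarrow> f \<in> I)"

text \<open>The Hilbert function of \<open>S/I\<close>; note that \<open>(S/I)\<^sub>k = S\<^sub>k / (I \<inter> S\<^sub>k)\<close>.\<close>

definition hilbert_fun :: "'n::finite mpoly set \<Rightarrow> nat \<Rightarrow> nat" where
  "hilbert_fun I k =
     poly_space.dim (forms k :: 'n mpoly set) - poly_space.dim (I \<inter> forms k)"

definition Hilb :: "nat \<Rightarrow> 'n::finite mpoly set set" where
  "Hilb r = {I. homogeneous_ideal I \<and>
     (\<forall>k. hilbert_fun I k = min r (poly_space.dim (forms k :: 'n mpoly set)))}"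

text \<open>
  The Zariski topology on the closed points of the Hilbert scheme is the subspace topology for
  \<open>I \<mapsto> (I\<^sub>k)\<^sub>k\<close>, a closed embedding into the product of the Grassmannians of \<open>S\<^sub>k\<close> with \<open>k\<close> in any
  sufficiently large finite set of degrees. A Grassmannian carries the quotient topology of the
  space of frames (ordered bases), so closed sets are given by polynomial conditions on the
  coefficients of all frames. One such polynomial involves only finitely many degrees.
\<close>

definition frame :: "(nat \<Rightarrow> nat \<Rightarrow> 'n::finite mpoly) \<Rightarrow> 'n mpoly set \<Rightarrow> bool" where
  "frame b I \<longleftrightarrow> (\<forall>k. let s = poly_space.dim (I \<inter> forms k) in
     inj_on (b k) {..<s} \<and> poly_space.independent (b k ` {..<s}) \<and>
     poly_space.span (b k ` {..<s}) = I \<inter> forms k \<and> (\<forall>j\<ge>s. b k j = 0))"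

definition Hilb_closed :: "nat \<Rightarrow> 'n::finite mpoly set set \<Rightarrow> bool" where
  "Hilb_closed r Z \<longleftrightarrow> (\<exists>E :: (nat \<times> nat \<times> 'n monomial) mpoly set.
     Z = {I \<in> Hilb r. \<forall>b. frame b I \<longrightarrow>
            (\<forall>p\<in>E. eval p (\<lambda>(k, j, m). Poly_Mapping.lookup (b k j) m) = 0)})"

text \<open>
  Points of \<open>\<bbbP>\<^sup>n\<close> are given by nonzero vectors; the last condition makes different elements of
  \<open>A\<close> represent different points.
\<close>

definition distinct_points :: "nat \<Rightarrow> (complex ^ 'n) set \<Rightarrow> bool" where
  "distinct_points r A \<longleftrightarrow> finite A \<and> card A = r \<and> 0 \<notin> A \<and>
     (\<forall>a\<in>A. \<forall>b\<in>A. \<forall>c. b = c *s a \<longrightarrow> b = a)"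

definition points_ideal :: "(complex ^ 'n) set \<Rightarrow> 'n::finite mpoly set" where
  "points_ideal A =
     poly_ideal.span {f. (\<exists>k. f \<in> forms k) \<and> (\<forall>a\<in>A. eval f (($) a) = 0)}"

definition Slip :: "nat \<Rightarrow> 'n::finite mpoly set set" where
  "Slip r = Hilb_closed r hull
     {I \<in> Hilb r. saturated I \<and> (\<exists>A. distinct_points r A \<and> I = points_ideal A)}"

definition VSP :: "'n::finite mpoly \<Rightarrow> nat \<Rightarrow> 'n mpoly set set" where
  "VSP F r = {J \<in> Slip r. J \<subseteq> Ann F}"

end

theory Submission
  imports Defs
begin

text \<open>
  Write \<open>S\<^sub>1 = V\<close> and let \<open>p \<in> V\<close>. The value of \<open>Hess F\<close> at the point dual to \<open>p\<close> is, up to a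
  factor, the determinant of the bilinear form \<open>(u, v) \<mapsto> (p\<^sup>d\<^sup>-\<^sup>2 u v) \<circ> F\<close> on \<open>V\<close>.

  If it is nonzero, then for the sums \<open>G\<close> of \<open>n + 1\<close> powers with nonzero determinant the linear
  forms are independent, and the ideal \<open>I\<close> of the corresponding points satisfies
  \<open>S\<^sub>k = p\<^sup>k\<^sup>-\<^sup>1 V \<oplus> I\<^sub>k\<close> for \<open>k \<ge> 1\<close>. The projection to \<open>V\<close> is a regular function of the
  coefficients of \<open>G\<close>, so its formal properties persist in the limit \<open>F\<close>: its kernel is an ideal
  \<open>J \<subseteq> Ann F\<close> with the same splitting, and projecting a frame of \<open>J\<close> to the ideals \<open>I\<close> shows
  that \<open>J\<close> lies in the closure. The splitting makes \<open>J\<close> saturated and generated by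
  \<open>J\<^sub>2 = Ann(F)\<^sub>2\<close>; an ideal in \<open>VSP\<close> has the same degree \<open>2\<close> part for dimension reasons, hence
  equals \<open>J\<close>.

  Conversely, modulo a saturated \<open>J \<in> VSP\<close> some \<open>p \<in> V\<close> is a nonzerodivisor, which gives
  \<open>S\<^sub>d\<^sub>-\<^sub>1 = p\<^sup>d\<^sup>-\<^sup>2 V \<oplus> J\<^sub>d\<^sub>-\<^sub>1\<close>; a vector \<open>w\<close> in the kernel of the bilinear form then satisfies
  \<open>S\<^sub>d\<^sub>-\<^sub>1 w \<circ> F = 0\<close>, so \<open>w = 0\<close> because \<open>F\<close> is concise.
\<close>

text \<open>The secant variety and \<open>Slip\<close> are only Zariski hulls, so no curve or
  sequence of sums \<open>G\<close> tending to \<open>F\<close> is available. Each fact about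
  \<open>F\<close> is stated as the vanishing of a function f of the coefficients such that f D^k is
  a polynomial P where D is nonzero, D being the determinant. Then P D vanishes at every sum of n+1
  powers, degenerate or not, hence at \<open>F\<close>, where D is nonzero. This forces the
  projection to S_1 to be an explicit formula instead of a chosen complement: y_k/p is a matrix by
  Cramer's rule, and a monomial acts by composing such matrices. That they commute, and that the
  kernel is an ideal annihilating the form, cannot be read off from the formula at \<open>F\<close>;
  for \<open>G\<close> it is checked by values at the n+1 points, and the identities are then
  transported. Membership in \<open>Slip\<close> concerns equations in all frames, so each frame of
  the limit ideal is deformed by the same formula. The factor p^(d-3) in the definition of y_k/p is
  where d at least 3 enters; d = 2 leaves only one variable.\<close>

abbreviation lookup :: "('a \<Rightarrow>\<^sub>0 'b::zero) \<Rightarrow> 'a \<Rightarrow> 'b" where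
  "lookup \<equiv> Poly_Mapping.lookup"

abbreviation keys :: "('a \<Rightarrow>\<^sub>0 'b::zero) \<Rightarrow> 'a set" where
  "keys \<equiv> Poly_Mapping.keys"

abbreviation single :: "'a \<Rightarrow> 'b \<Rightarrow> 'a \<Rightarrow>\<^sub>0 'b::zero" where
  "single \<equiv> Poly_Mapping.single"

section \<open>Polynomials, evaluation and homogeneous components\<close>

lemma mpoly_eq_sum_single: "p = (\<Sum>m\<in>keys p. single m (lookup p m))"
  by (rule poly_mapping_eqI) (auto simp: lookup_sum lookup_single when_def in_keys_iff)

lemma lookup_Const_mult [simp]: "lookup (Const c * p) m = c * lookup p m"
  by (induction p rule: mpoly_induct)
    (auto simp: Const_def mult_single lookup_single lookup_add when_def distrib_left)

lemma Const_mult_single: "Const c * single m e = single m (c * e)"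
  by (simp add: Const_def mult_single)

lemma Const_0 [simp]: "Const 0 = 0"
  by (simp add: Const_def)

lemma Const_1 [simp]: "Const 1 = 1"
  by (simp add: Const_def)

lemma Const_add: "Const (a + b) = Const a + Const b"
  by (simp add: Const_def single_add)

lemma Const_mult: "Const (a * b) = Const a * Const b"
  by (simp add: Const_def mult_single)

definition mon_eval :: "'i monomial \<Rightarrow> ('i \<Rightarrow> complex) \<Rightarrow> complex" where
  "mon_eval m x = (\<Prod>i\<in>keys m. x i ^ lookup m i)"

lemma mon_eval_superset:
  "finite A \<Longrightarrow> keys m \<subseteq> A \<Longrightarrow> mon_eval m x = (\<Prod>i\<in>A. x i ^ lookup m i)"
  unfolding mon_eval_def by (rule prod.mono_neutral_left) (auto simp: in_keys_iff)

lemma mon_eval_add: "mon_eval (a + b) x = mon_eval a x * mon_eval b x"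
proof -
  have "keys (a + b) \<subseteq> keys a \<union> keys b" by (rule keys_add)
  then show ?thesis
    using mon_eval_superset[of "keys a \<union> keys b"]
    by (simp add: lookup_add power_add prod.distrib)
qed

lemma mon_eval_0 [simp]: "mon_eval 0 x = 1"
  by (simp add: mon_eval_def)

lemma eval_superset:
  assumes "finite A" "keys p \<subseteq> A"
  shows "eval p x = (\<Sum>m\<in>A. lookup p m * mon_eval m x)"
  using assms unfolding eval_def mon_eval_def
  by (intro sum.mono_neutral_left) (auto simp: in_keys_iff)

lemma eval_single [simp]: "eval (single m c) x = c * mon_eval m x"
  using eval_superset[of "{m}" "single m c" x] by (auto split: if_splits)

lemma eval_add [simp]: "eval (p + q) x = eval p x + eval q x"
proof -
  have "keys (p + q) \<subseteq> keys p \<union> keys q" by (rule keys_add)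
  then show ?thesis
    using eval_superset[of "keys p \<union> keys q" _ x]
    by (simp add: lookup_add distrib_right sum.distrib)
qed

lemma eval_mult [simp]: "eval (p * q) x = eval p x * eval q x"
proof (induction p rule: mpoly_induct)
  case (single m c)
  show ?case
    by (induction q rule: mpoly_induct)
      (simp_all add: mult_single mon_eval_add distrib_left)
qed (simp add: distrib_right)

lemma eval_0 [simp]: "eval 0 x = 0"
  by (simp add: eval_def)

lemma eval_Const [simp]: "eval (Const c) x = c"
  by (simp add: Const_def)

lemma eval_1 [simp]: "eval 1 x = 1"
  using eval_Const[of 1 x] by simp

lemma eval_Var [simp]: "eval (Var i) x = x i"
  by (simp add: Var_def mon_eval_def)

lemma eval_diff [simp]: "eval (p - q) x = eval p x - eval q x"
  using eval_add[of "p - q" q x] by simp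

lemma eval_power [simp]: "eval (p ^ k) x = eval p x ^ k"
  by (induction k) auto

lemma eval_sum [simp]: "eval (sum f A) x = (\<Sum>a\<in>A. eval (f a) x)"
  by (induction A rule: infinite_finite_induct) auto

lemma mon_degree_superset:
  "finite A \<Longrightarrow> keys m \<subseteq> A \<Longrightarrow> mon_degree m = (\<Sum>i\<in>A. lookup m i)"
  unfolding mon_degree_def by (rule sum.mono_neutral_left) (auto simp: in_keys_iff)

lemma mon_degree_add: "mon_degree (a + b) = mon_degree a + mon_degree b"
proof -
  have "keys (a + b) \<subseteq> keys a \<union> keys b" by (rule keys_add)
  then show ?thesis
    using mon_degree_superset[of "keys a \<union> keys b"] by (simp add: lookup_add sum.distrib)
qed

lemma mon_degree_0 [simp]: "mon_degree 0 = 0"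
  by (simp add: mon_degree_def)

lemma mon_degree_single [simp]: "mon_degree (single i k) = k"
  by (simp add: mon_degree_def)

lemma mon_degree_eq_0_iff: "mon_degree m = 0 \<longleftrightarrow> m = 0"
  by (auto simp: mon_degree_def in_keys_iff intro!: poly_mapping_eqI)

lemma forms_iff: "p \<in> forms k \<longleftrightarrow> (\<forall>m. lookup p m \<noteq> 0 \<longrightarrow> mon_degree m = k)"
  by (auto simp: forms_def in_keys_iff)

lemma single_in_forms: "mon_degree m = k \<Longrightarrow> single m c \<in> forms k"
  by (auto simp: forms_iff lookup_single when_def)

lemma forms_0 [simp]: "0 \<in> forms k"
  by (simp add: forms_iff)

lemma forms_add: "p \<in> forms k \<Longrightarrow> q \<in> forms k \<Longrightarrow> p + q \<in> forms k"
  by (simp add: forms_iff lookup_add) (metis add.right_neutral)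

lemma forms_scale: "p \<in> forms k \<Longrightarrow> Const c * p \<in> forms k"
  by (simp add: forms_iff)

lemma subspace_forms: "poly_space.subspace (forms k)"
  by (rule poly_space.subspaceI) (auto intro: forms_add forms_scale)

lemma forms_sum: "(\<And>a. a \<in> A \<Longrightarrow> f a \<in> forms k) \<Longrightarrow> sum f A \<in> forms k"
  by (rule poly_space.subspace_sum[OF subspace_forms])

lemma forms_diff: "p \<in> forms k \<Longrightarrow> q \<in> forms k \<Longrightarrow> p - q \<in> forms k"
  by (rule poly_space.subspace_diff[OF subspace_forms])

text \<open>The summands in \<open>mpoly_induct\<close> need not be forms of degree
  \<open>k\<close>. Partial sums of the monomial expansion of \<open>p\<close> are, so homogeneity
  is carried along with \<open>P\<close>.\<close>

lemma forms_induct [consumes 1, case_names single add zero]: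
  assumes "p \<in> forms k"
    and single: "\<And>m c. mon_degree m = k \<Longrightarrow> P (single m c)"
    and add: "\<And>p q. p \<in> forms k \<Longrightarrow> q \<in> forms k \<Longrightarrow> P p \<Longrightarrow> P q \<Longrightarrow> P (p + q)"
    and "P 0"
  shows "P p"
proof -
  have "P (\<Sum>m\<in>A. single m (lookup p m)) \<and> (\<Sum>m\<in>A. single m (lookup p m)) \<in> forms k"
    if "finite A" "A \<subseteq> keys p" for A
    using that
  proof (induction A rule: finite_induct)
    case (insert a A)
    then have "mon_degree a = k" using assms(1) by (auto simp: forms_def)
    with insert show ?case by (auto intro!: add single single_in_forms forms_add)
  qed (use \<open>P 0\<close> in auto)
  from this[of "keys p"] show ?thesis using mpoly_eq_sum_single[of p] by simp
qed

lemma forms_mult: "p \<in> forms j \<Longrightarrow> q \<in> forms k \<Longrightarrow> p * q \<in> forms (j + k)"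
proof (induction p rule: forms_induct)
  case (single m c)
  from single(2) show ?case
    by (induction q rule: forms_induct)
      (auto simp: mult_single distrib_left mon_degree_add single intro!: single_in_forms forms_add)
qed (auto simp: distrib_right intro: forms_add)

lemma Const_in_forms: "Const c \<in> forms 0"
  by (simp add: Const_def single_in_forms)

lemma one_in_forms: "1 \<in> forms 0"
  using Const_in_forms[of 1] by simp

lemma forms_0_eq_Const: "p \<in> forms 0 \<Longrightarrow> p = Const (lookup p 0)"
  by (rule poly_mapping_eqI)
    (auto simp: forms_iff Const_def lookup_single when_def mon_degree_eq_0_iff)

lemma Var_in_forms: "Var i \<in> forms 1"
  by (simp add: Var_def single_in_forms)

lemma forms_power: "p \<in> forms 1 \<Longrightarrow> p ^ k \<in> forms k"
  by (induction k) (use one_in_forms forms_mult[of p 1] in auto)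

lemma Var_mult_forms: "p \<in> forms k \<Longrightarrow> Var i * p \<in> forms (Suc k)"
  using forms_mult[OF Var_in_forms] by simp

lemma eval_0_eq_lookup: "p \<in> forms 0 \<Longrightarrow> eval p x = lookup p 0"
  using forms_0_eq_Const by (metis eval_Const)

lemma eval_scale_forms: "p \<in> forms k \<Longrightarrow> eval p (\<lambda>i. t * x i) = t ^ k * eval p x"
proof (induction p rule: forms_induct)
  case (single m c)
  have "mon_eval m (\<lambda>i. t * x i) = t ^ mon_degree m * mon_eval m x"
    by (simp add: mon_eval_def mon_degree_def power_mult_distrib prod.distrib power_sum)
  with single show ?case by simp
qed (auto simp: distrib_left)

section \<open>Homogeneous components\<close>

definition hcomp :: "nat \<Rightarrow> 'i mpoly \<Rightarrow> 'i mpoly" where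
  "hcomp k p = (\<Sum>m\<in>{m\<in>keys p. mon_degree m = k}. single m (lookup p m))"

lemma lookup_hcomp: "lookup (hcomp k p) m = (if mon_degree m = k then lookup p m else 0)"
  by (auto simp: hcomp_def lookup_sum lookup_single when_def in_keys_iff)

lemma hcomp_in_forms: "hcomp k p \<in> forms k"
  by (auto simp: forms_iff lookup_hcomp)

lemma hcomp_add: "hcomp k (p + q) = hcomp k p + hcomp k q"
  by (rule poly_mapping_eqI) (simp add: lookup_hcomp lookup_add)

lemma hcomp_0 [simp]: "hcomp k 0 = 0"
  by (rule poly_mapping_eqI) (simp add: lookup_hcomp)

lemma hcomp_forms: "p \<in> forms j \<Longrightarrow> hcomp k p = (if j = k then p else 0)"
  by (rule poly_mapping_eqI) (auto simp: lookup_hcomp forms_iff)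

lemma hcomp_mult_forms:
  assumes "g \<in> forms j"
  shows "hcomp (j + k) (g * p) = g * hcomp k p"
proof (induction p rule: mpoly_induct)
  case (single m c)
  have "g * single m c \<in> forms (j + mon_degree m)"
    using assms by (intro forms_mult single_in_forms) auto
  moreover have "single m c \<in> forms (mon_degree m)"
    by (simp add: single_in_forms)
  ultimately show ?case by (simp add: hcomp_forms)
qed (simp add: distrib_left hcomp_add)

text \<open>The inserted 0 gives \<open>Max\<close> a nonempty set when
  \<open>p = 0\<close>.\<close>

definition top_degree :: "'i mpoly \<Rightarrow> nat" where
  "top_degree p = Max (insert 0 (mon_degree ` keys p))"

lemma hcomp_eq_0: "top_degree p < k \<Longrightarrow> hcomp k p = 0"
proof (rule poly_mapping_eqI)
  fix m assume "top_degree p < k"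
  moreover have "mon_degree m \<le> top_degree p" if "lookup p m \<noteq> 0"
    unfolding top_degree_def using that by (intro Max_ge) (auto simp: in_keys_iff)
  ultimately show "lookup (hcomp k p) m = lookup 0 m"
    by (cases "lookup p m = 0") (auto simp: lookup_hcomp)
qed

lemma sum_hcomp: "top_degree p \<le> K \<Longrightarrow> p = (\<Sum>k\<le>K. hcomp k p)"
proof (rule poly_mapping_eqI)
  fix m assume "top_degree p \<le> K"
  moreover have "mon_degree m \<le> top_degree p" if "lookup p m \<noteq> 0"
    unfolding top_degree_def using that by (intro Max_ge) (auto simp: in_keys_iff)
  ultimately show "lookup p m = lookup (\<Sum>k\<le>K. hcomp k p) m"
    by (cases "lookup p m = 0") (auto simp: lookup_sum lookup_hcomp)
qed

lemma finite_monomials: "finite {m :: 'n::finite monomial. mon_degree m = k}"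
proof -
  have "lookup ` {m :: 'n monomial. mon_degree m = k} \<subseteq> PiE UNIV (\<lambda>_. {..k})"
  proof (clarsimp simp: PiE_def)
    fix m :: "'n monomial" and i
    have "lookup m i \<le> (\<Sum>i\<in>UNIV. lookup m i)" by (rule member_le_sum) auto
    then show "lookup m i \<le> mon_degree m" by (simp add: mon_degree_superset[of UNIV])
  qed
  moreover have "finite (PiE (UNIV :: 'n set) (\<lambda>_. {..k}))"
    by (intro finite_PiE) auto
  ultimately have "finite (lookup ` {m :: 'n monomial. mon_degree m = k})"
    by (rule finite_subset)
  moreover have "inj_on lookup {m :: 'n monomial. mon_degree m = k}"
    by (intro inj_onI) (simp only: poly_mapping_eq_iff)
  ultimately show ?thesis by (rule finite_imageD)
qed

lemma forms_finite_span:
  obtains A where "finite A" "forms k = poly_space.span (A :: 'n::finite mpoly set)"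
proof
  let ?A = "(\<lambda>m. single m 1) ` {m :: 'n monomial. mon_degree m = k}"
  show "finite ?A" using finite_monomials by blast
  have "forms k \<subseteq> poly_space.span ?A"
  proof
    fix p :: "'n mpoly" assume "p \<in> forms k"
    then show "p \<in> poly_space.span ?A"
    proof (induction p rule: forms_induct)
      case (single m c)
      then have "Const c * single m 1 \<in> poly_space.span ?A"
        by (intro poly_space.span_scale poly_space.span_base) auto
      then show ?case by (simp add: Const_mult_single)
    qed (auto intro: poly_space.span_add poly_space.span_zero)
  qed
  moreover have "poly_space.span ?A \<subseteq> forms k"
    by (rule poly_space.span_minimal) (auto intro: single_in_forms subspace_forms)
  ultimately show "forms k = poly_space.span ?A" by blast
qed

section \<open>Linear forms and apolarity\<close>

text \<open>Used on both sides of the duality: \<open>lf q\<close> and \<open>lf v\<close> are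
  operators in S_1, while \<open>lf a\<close> is the linear form attached to a point
  \<open>a\<close>.\<close>

definition lf :: "complex ^ 'n::finite \<Rightarrow> 'n mpoly" where
  "lf v = (\<Sum>i\<in>UNIV. Const (v $ i) * Var i)"

lemma lf_in_forms [simp]: "lf v \<in> forms 1"
  unfolding lf_def by (intro forms_sum forms_scale Var_in_forms)

text \<open>The simplifier rewrites \<open>1 :: nat\<close> to \<open>Suc 0\<close>, so the rule is
  supplied in that shape as well.\<close>

declare lf_in_forms [unfolded One_nat_def, simp]

lemma lf_add: "lf (v + w) = lf v + lf w"
  by (simp add: lf_def Const_add distrib_right sum.distrib)

lemma lf_scale: "lf (c *s v) = Const c * lf v"
  by (simp only: lf_def vector_smult_component Const_mult sum_distrib_left mult.assoc)

lemma lf_0 [simp]: "lf 0 = 0"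
  by (simp add: lf_def)

lemma lf_diff: "lf (v - w) = lf v - lf w"
  using lf_add[of "v - w" w] by simp

lemma lf_sum: "lf (sum f A) = (\<Sum>a\<in>A. lf (f a))"
  by (induction A rule: infinite_finite_induct) (auto simp: lf_add)

lemma lookup_Var: "lookup (Var j) (single i 1) = (if j = i then 1 else 0)"
proof -
  have "single j (1::nat) = single i 1 \<longleftrightarrow> j = i"
    by (metis keys_single one_neq_zero singleton_inject)
  then show ?thesis by (simp add: Var_def lookup_single when_def)
qed

lemma lookup_lf: "lookup (lf v) (single i 1) = v $ i"
proof -
  have "lookup (lf v) (single i 1) = (\<Sum>j\<in>UNIV. v $ j * (if j = i then 1 else 0))"
    unfolding lf_def lookup_sum lookup_Const_mult
    by (simp only: lookup_Var)
  then show ?thesis by (simp add: if_distrib cong: if_cong)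
qed

lemma lf_eq_iff [simp]: "lf v = lf w \<longleftrightarrow> v = w"
  by (metis lookup_lf vec_eq_iff)

lemma lf_eq_0_iff [simp]: "lf v = 0 \<longleftrightarrow> v = 0"
  using lf_eq_iff[of v 0] by simp

lemma eval_lf: "eval (lf v) (($) a) = (\<Sum>i\<in>UNIV. v $ i * a $ i)"
  by (simp add: lf_def)

lemma lf_axis: "lf (axis i 1) = Var i"
proof -
  have "lf (axis i 1) = (\<Sum>j\<in>UNIV. if j = i then Var i else 0)"
    unfolding lf_def by (rule sum.cong) (auto simp: axis_def)
  then show ?thesis by simp
qed

lemma mon_degree_1_cases:
  fixes m :: "'i monomial"
  assumes "mon_degree m = Suc k"
  obtains i m' where "m = single i 1 + m'" "mon_degree m' = k"
proof -
  have "m \<noteq> 0" using assms by auto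
  then obtain i where i: "lookup m i \<noteq> 0" by (metis poly_mapping_eqI lookup_zero)
  have "m = single i 1 + (m - single i 1)"
    using i by (intro poly_mapping_eqI) (auto simp: lookup_add lookup_minus lookup_single when_def)
  moreover from this have "mon_degree m = 1 + mon_degree (m - single i 1)"
    by (metis mon_degree_add mon_degree_single)
  ultimately show thesis using that assms by auto
qed

text \<open>Inductions on the degree peel off one variable at a time through this rule.\<close>

lemma single_Suc_cases:
  fixes m :: "'i monomial"
  assumes "mon_degree m = Suc k"
  obtains i m' where "single m c = Var i * single m' c" "mon_degree m' = k" "m = single i 1 + m'"
  by (rule mon_degree_1_cases[OF assms]) (use that in \<open>simp add: Var_def mult_single\<close>)

lemma forms_1_eq_lf: "p \<in> forms 1 \<Longrightarrow> \<exists>v. p = lf v"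
proof (induction p rule: forms_induct)
  case (single m c)
  then obtain i m' where *: "single m c = Var i * single m' c" "mon_degree m' = 0"
    by (metis One_nat_def single_Suc_cases)
  then have "single m c = lf (c *s axis i 1)"
    by (simp add: lf_scale lf_axis mon_degree_eq_0_iff Const_def mult.commute)
  then show ?case by blast
next
  case (add p q)
  then show ?case by (metis lf_add)
next
  case zero
  show ?case by (metis lf_0)
qed

lemma act_scale_left: "act (Const c * \<psi>) F = Const c * act \<psi> F"
proof (induction \<psi> rule: mpoly_induct)
  case (single m e)
  show ?case
    by (induction F rule: mpoly_induct)
      (simp_all only: Const_mult_single act_single act_add_right distrib_left mult_ac)
qed (simp only: distrib_left act_add_left)

lemma act_scale_right: "act \<psi> (Const c * F) = Const c * act \<psi> F"
proof (induction \<psi> rule: mpoly_induct)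
  case (single m e)
  show ?case
    by (induction F rule: mpoly_induct)
      (simp_all only: Const_mult_single act_single act_add_right distrib_left mult_ac)
qed (simp only: distrib_left act_add_left)

lemma act_one: "act 1 F = F"
proof (induction F rule: mpoly_induct)
  case (single m c)
  show ?case by (simp add: act_single flip: single_one)
qed (simp add: act_add_right)

lemma act_sum_right: "act \<psi> (sum f A) = (\<Sum>a\<in>A. act \<psi> (f a))"
  by (induction A rule: infinite_finite_induct) (auto simp: act_add_right)

lemma act_sum_left: "act (sum f A) F = (\<Sum>a\<in>A. act (f a) F)"
  by (induction A rule: infinite_finite_induct) (auto simp: act_add_left)

lemma act_diff_left: "act (\<psi> - \<phi>) F = act \<psi> F - act \<phi> F"
  using act_add_left[of "\<psi> - \<phi>" \<phi> F] by simp

lemma falling_prod_eq_0: "a > m \<Longrightarrow> (\<Prod>t<a. m - t) = (0::nat)"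
  by (intro prod_zero) auto

lemma falling_prod_self: "(\<Prod>t<k. k - t) = (fact k :: nat)"
proof -
  have "(\<Prod>t<k. k - t) = (\<Prod>t\<in>{0..<k}. Suc t)"
    by (rule prod.reindex_bij_witness[of _ "\<lambda>t. k - Suc t" "\<lambda>t. k - Suc t"]) auto
  then show ?thesis by (simp add: fact_prod_Suc)
qed

lemma act_single_eq_0:
  assumes "lookup a i > lookup m i"
  shows "act (single a c) (single m e) = 0"
proof -
  have "(\<Prod>i\<in>UNIV. \<Prod>t<lookup a i. lookup m i - t) = 0"
    using assms by (intro prod_zero bexI[of _ i] falling_prod_eq_0) auto
  then show ?thesis by (simp only: act_single) simp
qed

definition mon_fact :: "'n::finite monomial \<Rightarrow> nat" where
  "mon_fact m = (\<Prod>i\<in>UNIV. fact (lookup m i))"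

lemma mon_fact_nonzero [simp]: "mon_fact m \<noteq> 0"
  by (simp add: mon_fact_def)

lemma act_single_self: "act (single m c) (single m e) = Const (c * e * of_nat (mon_fact m))"
  by (simp add: act_single mon_fact_def falling_prod_self Const_def)

lemma exists_lookup_less:
  fixes a m :: "'n::finite monomial"
  assumes "mon_degree m \<le> mon_degree a" "a \<noteq> m"
  shows "\<exists>i. lookup a i > lookup m i"
proof (rule ccontr)
  assume "\<not> ?thesis"
  then have le: "lookup a i \<le> lookup m i" for i by (simp add: not_less)
  obtain i where "lookup a i \<noteq> lookup m i" using assms(2) by (metis poly_mapping_eqI)
  with le have "lookup a i < lookup m i" by (simp add: le_neq_implies_less)
  then have "(\<Sum>i\<in>UNIV. lookup a i) < (\<Sum>i\<in>UNIV. lookup m i)"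
    using le by (intro sum_strict_mono_ex1) auto
  with assms(1) show False by (simp add: mon_degree_superset[of UNIV])
qed

lemma act_in_forms:
  assumes "\<psi> \<in> forms j" "F \<in> forms (j + k)"
  shows "act \<psi> F \<in> forms k"
  using assms
proof (induction \<psi> rule: forms_induct)
  case (single a c)
  show ?case using single(2)
  proof (induction F rule: forms_induct)
    case (single m e)
    show ?case
    proof (cases "\<exists>i. lookup a i > lookup m i")
      case False
      then have "m = a + (m - a)"
        by (intro poly_mapping_eqI) (auto simp: lookup_add lookup_minus not_less)
      then have "mon_degree m = mon_degree a + mon_degree (m - a)"
        by (metis mon_degree_add)
      with single \<open>mon_degree a = j\<close> show ?thesis by (simp add: act_single single_in_forms)
    qed (auto simp: act_single_eq_0)
  qed (auto simp: act_add_right intro: forms_add)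
qed (auto simp: act_add_left intro: forms_add)

lemma act_eq_0:
  assumes "\<psi> \<in> forms j" "F \<in> forms d" "d < j"
  shows "act \<psi> F = 0"
  using assms(1)
proof (induction \<psi> rule: forms_induct)
  case (single a c)
  show ?case using assms(2)
  proof (induction F rule: forms_induct)
    case (single m e)
    then show ?case
      using exists_lookup_less[of m a] \<open>d < j\<close> \<open>mon_degree a = j\<close>
      by (metis act_single_eq_0 less_imp_le nat_neq_iff)
  qed (auto simp: act_add_right)
qed (auto simp: act_add_left)

text \<open>In equal degrees only pairs of equal monomials survive, and there the value c e m! is
  symmetric in the two coefficients.\<close>

lemma act_commute:
  assumes "\<psi> \<in> forms k" "F \<in> forms k"
  shows "act \<psi> F = act F \<psi>"
  using assms(1)
proof (induction \<psi> rule: forms_induct)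
  case (single a c)
  show ?case using assms(2)
  proof (induction F rule: forms_induct)
    case (single m e)
    show ?case
    proof (cases "a = m")
      case False
      then obtain i j where "lookup a i > lookup m i" "lookup m j > lookup a j"
        using single \<open>mon_degree a = k\<close> exists_lookup_less by (metis order_refl)
      then show ?thesis by (metis act_single_eq_0)
    qed (simp add: act_single_self mult.commute mult.left_commute)
  qed (auto simp: act_add_right act_add_left)
qed (auto simp: act_add_right act_add_left)

text \<open>In equal degrees \<open>act\<close> returns a constant polynomial; its constant term is
  the scalar pairing.\<close>

definition apolar :: "'n::finite mpoly \<Rightarrow> 'n mpoly \<Rightarrow> complex" where
  "apolar \<psi> F = lookup (act \<psi> F) 0"

lemma apolar_add_left: "apolar (\<psi> + \<phi>) F = apolar \<psi> F + apolar \<phi> F"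
  by (simp add: apolar_def act_add_left lookup_add)

lemma apolar_add_right: "apolar \<psi> (F + G) = apolar \<psi> F + apolar \<psi> G"
  by (simp add: apolar_def act_add_right lookup_add)

lemma apolar_scale_left: "apolar (Const c * \<psi>) F = c * apolar \<psi> F"
  by (simp add: apolar_def act_scale_left)

lemma apolar_scale_right: "apolar \<psi> (Const c * F) = c * apolar \<psi> F"
  by (simp add: apolar_def act_scale_right)

lemma apolar_zero [simp]: "apolar 0 F = 0" "apolar \<psi> 0 = 0"
  by (simp_all add: apolar_def)

lemma apolar_sum_left: "apolar (sum f A) F = (\<Sum>a\<in>A. apolar (f a) F)"
  by (simp add: apolar_def act_sum_left lookup_sum)

lemma apolar_sum_right: "apolar \<psi> (sum f A) = (\<Sum>a\<in>A. apolar \<psi> (f a))"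
  by (simp add: apolar_def act_sum_right lookup_sum)

text \<open>For m different from a, either some exponent of a is too large and the derivative is 0,
  or a nonconstant monomial x^(m-a) remains. The formula shows that the pairing is linear in the
  coefficients of \<open>F\<close>, which \<open>regular_apolar\<close> relies on.\<close>

lemma apolar_single: "apolar (single a c) F = c * of_nat (mon_fact a) * lookup F a"
proof (induction F rule: mpoly_induct)
  case (single m e)
  show ?case
  proof (cases "a = m")
    case False
    show ?thesis
    proof (cases "\<exists>i. lookup a i > lookup m i")
      case no: False
      have "m - a \<noteq> 0"
      proof
        assume "m - a = 0"
        then have "lookup m i - lookup a i = 0" for i by (metis lookup_minus lookup_zero)
        with no have "lookup a i = lookup m i" for i by (simp add: not_less order_antisym)
        with False show False by (metis poly_mapping_eqI)
      qed
      with False show ?thesis by (simp add: apolar_def act_single lookup_single)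
    qed (use False in \<open>auto simp: apolar_def act_single_eq_0 lookup_single\<close>)
  qed (simp add: apolar_def act_single_self Const_def)
qed (simp add: apolar_add_right lookup_add distrib_left)

lemma apolar_nondegenerate:
  assumes "G \<in> forms k" "\<And>\<psi>. \<psi> \<in> forms k \<Longrightarrow> apolar \<psi> G = 0"
  shows "G = 0"
proof (rule poly_mapping_eqI)
  fix m
  show "lookup G m = lookup 0 m"
  proof (cases "mon_degree m = k")
    case True
    then have "apolar (single m 1) G = 0" by (intro assms(2) single_in_forms)
    then show ?thesis by (simp add: apolar_single)
  qed (use assms(1) in \<open>auto simp: forms_iff\<close>)
qed

lemma act_Var_mult: "act (Var i) (F * G) = act (Var i) F * G + F * act (Var i) G"
proof (induction F rule: mpoly_induct)
  case (single a c)
  show ?case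
  proof (induction G rule: mpoly_induct)
    case (single m e)
    have *: "act (Var i) (single a c) = single (a - single i 1) (c * of_nat (lookup a i))"
      for a and c :: complex
    proof -
      have "(\<Prod>k\<in>UNIV. \<Prod>t<lookup (single i (1::nat)) k. lookup a k - t) = lookup a i"
        by (subst prod.remove[of _ i]) (auto simp: lookup_single when_def intro!: prod.neutral)
      then show ?thesis by (simp add: Var_def act_single)
    qed
    have shift: "x - single i 1 + y = x + y - single i 1" if "lookup x i > 0" for x y :: "'a monomial"
      using that by (intro poly_mapping_eqI)
        (auto simp: lookup_add lookup_minus lookup_single when_def)
    \<comment> \<open>If x_i does not occur in the monomial, the truncated exponents on the two
      sides may differ, but the coefficient is then 0.\<close>
    have A: "single (a - single i 1 + m) (c * of_nat (lookup a i) * e)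
       = single (a + m - single i 1) (c * of_nat (lookup a i) * e)"
      by (cases "lookup a i = 0") (auto simp: shift simp del: One_nat_def)
    have B: "single (a + (m - single i 1)) (c * (e * of_nat (lookup m i)))
       = single (a + m - single i 1) (c * (e * of_nat (lookup m i)))"
      by (cases "lookup m i = 0") (auto simp: shift add.commute[of a] simp del: One_nat_def)
    show ?case
      unfolding mult_single * A B
      by (simp only: lookup_add of_nat_add flip: single_add)
        (rule arg_cong[where f = "single _"], simp add: algebra_simps)
  qed (simp_all add: act_add_right algebra_simps)
qed (simp_all add: act_add_right algebra_simps)

lemma act_Var_power:
  assumes "act (Var i) F = Const c"
  shows "act (Var i) (F ^ Suc k) = Const (of_nat (Suc k) * c) * F ^ k"
proof (induction k)
  case (Suc k)
  have *: "Const (of_nat (Suc (Suc k)) * c) = Const c + Const (of_nat (Suc k) * c)"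
    by (simp add: distrib_right flip: Const_add)
  have "act (Var i) (F ^ Suc (Suc k)) = Const c * F ^ Suc k + F * act (Var i) (F ^ Suc k)"
    by (simp only: power_Suc[of F "Suc k"] act_Var_mult assms)
  also have "\<dots> = Const c * F ^ Suc k + Const (of_nat (Suc k) * c) * F ^ Suc k"
    unfolding Suc.IH by (simp only: power_Suc mult_ac)
  finally show ?case by (simp only: * distrib_right)
qed (use assms in simp)

lemma act_Var_lf: "act (Var i) (lf a) = Const (a $ i)"
proof -
  have "act (Var i) (lf a) = (\<Sum>j\<in>UNIV. if i = j then Const (a $ i) else 0)"
    unfolding lf_def act_sum_right act_scale_right by (rule sum.cong) (auto simp: act_Var_Var)
  then show ?thesis by simp
qed

text \<open>Each variable y_i split off \<psi> differentiates the power once: the exponent k+1 drops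
  to k, and the factor (k+1) a_i appears.\<close>

lemma act_lf_power: "\<psi> \<in> forms k \<Longrightarrow> act \<psi> (lf a ^ k) = Const (fact k * eval \<psi> (($) a))"
proof (induction k arbitrary: \<psi>)
  case 0
  then show ?case by (metis act_one act_scale_left eval_0_eq_lookup fact_0 forms_0_eq_Const
        mult.left_neutral mult.right_neutral power_0)
next
  case (Suc k)
  from Suc.prems show ?case
  proof (induction \<psi> rule: forms_induct)
    case (single m c)
    obtain i m' where *: "single m c = single m' c * Var i" "mon_degree m' = k"
      by (metis single_Suc_cases single mult.commute)
    show ?case
      unfolding *(1) act_mult act_Var_power[OF act_Var_lf] act_scale_right
        Suc.IH[OF single_in_forms[OF *(2)]] Const_mult[symmetric] eval_mult eval_Var
      by (rule arg_cong[where f = Const]) (simp add: algebra_simps)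
  qed (simp_all add: act_add_left distrib_left Const_add)
qed

lemma apolar_lf_power: "\<psi> \<in> forms k \<Longrightarrow> apolar \<psi> (lf a ^ k) = fact k * eval \<psi> (($) a)"
  by (simp add: apolar_def act_lf_power) (simp add: Const_def)

text \<open>By symmetry of the pairing, a power of \<open>lf a\<close> used as an operator evaluates
  \<open>F\<close> at \<open>a\<close>. This turns values of second derivatives into the entries of
  \<open>gram\<close>.\<close>

lemma apolar_power_lf: "F \<in> forms k \<Longrightarrow> apolar (lf a ^ k) F = fact k * eval F (($) a)"
  by (metis act_commute apolar_def apolar_lf_power forms_power lf_in_forms)

lemma diff_add_diff_cancel: "(a - b) + (b - c) = a - (c :: 'a :: ab_group_add)"
  by simp

section \<open>Dimension counts and graded ideals\<close>

text \<open>A basis of \<open>A\<close> is extended by the \<open>w i\<close> one at a time. The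
  ambient space of polynomials has infinite dimension, so a finite spanning set \<open>T\<close> is
  carried along to keep bases finite and \<open>poly_space.dim\<close> meaningful.\<close>

lemma basis_mod_subspace:
  fixes w :: "'b \<Rightarrow> 'i mpoly"
  assumes "finite I" "poly_space.subspace A" "finite T" "A \<subseteq> poly_space.span T"
    and "\<And>c. (\<Sum>i\<in>I. Const (c i) * w i) \<in> A \<Longrightarrow> \<forall>i\<in>I. c i = 0"
  shows "\<exists>B. finite B \<and> poly_space.independent B \<and> card B = poly_space.dim A + card I \<and>
    (\<forall>x. x \<in> poly_space.span B \<longleftrightarrow> (\<exists>c. x - (\<Sum>i\<in>I. Const (c i) * w i) \<in> A))"
  using assms(1,5)
proof (induction I rule: finite_induct)
  case empty
  obtain B where B: "B \<subseteq> A" "poly_space.independent B" "A \<subseteq> poly_space.span B"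
    "card B = poly_space.dim A"
    using poly_space.basis_exists by blast
  have "finite B"
    using poly_space.independent_span_bound[OF \<open>finite T\<close> B(2)] B(1) assms(4) by blast
  moreover have "poly_space.span B = A"
    using B(1,3) assms(2) by (intro poly_space.span_subspace)
  ultimately show ?case using B by auto
next
  case (insert j I)
  have "\<forall>i\<in>I. c i = 0" if "(\<Sum>i\<in>I. Const (c i) * w i) \<in> A" for c
  proof -
    have "(\<Sum>i\<in>I. Const ((c(j := 0)) i) * w i) = (\<Sum>i\<in>I. Const (c i) * w i)"
      using insert.hyps by (intro sum.cong) auto
    then have "(\<Sum>i\<in>insert j I. Const ((c(j := 0)) i) * w i) \<in> A"
      using insert.hyps that by simp
    from insert.prems[OF this] insert.hyps show ?thesis by (metis fun_upd_other insertI2)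
  qed
  then obtain B where B: "finite B" "poly_space.independent B"
    "card B = poly_space.dim A + card I"
    and span: "\<And>x. x \<in> poly_space.span B \<longleftrightarrow> (\<exists>c. x - (\<Sum>i\<in>I. Const (c i) * w i) \<in> A)"
    using insert.IH by auto
  have upd: "(\<Sum>i\<in>insert j I. Const ((c(j := k)) i) * w i)
      = Const k * w j + (\<Sum>i\<in>I. Const (c i) * w i)" for c k
  proof -
    have "(\<Sum>i\<in>I. Const ((c(j := k)) i) * w i) = (\<Sum>i\<in>I. Const (c i) * w i)"
      using insert.hyps by (intro sum.cong) auto
    then show ?thesis using insert.hyps by simp
  qed
  have reindex: "(\<exists>k c. P (c(j := k))) \<longleftrightarrow> (\<exists>c. P c)" for P :: "('b \<Rightarrow> complex) \<Rightarrow> bool"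
  proof
    assume "\<exists>c. P c"
    then obtain c where "P (c(j := c j))" by auto
    then show "\<exists>k c. P (c(j := k))" by blast
  qed blast
  have notin: "w j \<notin> poly_space.span B"
  proof
    assume "w j \<in> poly_space.span B"
    then obtain c where c: "w j - (\<Sum>i\<in>I. Const (c i) * w i) \<in> A" using span by blast
    have "(\<Sum>i\<in>I. Const (- c i) * w i) = - (\<Sum>i\<in>I. Const (c i) * w i)"
      by (simp add: Const_def single_uminus sum_negf)
    with c have "(\<Sum>i\<in>insert j I. Const (((\<lambda>i. - c i)(j := 1)) i) * w i) \<in> A"
      unfolding upd by simp
    from insert.prems[OF this] show False by auto
  qed
  have "x \<in> poly_space.span (insert (w j) B) \<longleftrightarrow>
      (\<exists>c. x - (\<Sum>i\<in>insert j I. Const (c i) * w i) \<in> A)" for x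
  proof -
    have "x \<in> poly_space.span (insert (w j) B) \<longleftrightarrow>
        (\<exists>k c. x - Const k * w j - (\<Sum>i\<in>I. Const (c i) * w i) \<in> A)"
      by (simp add: poly_space.span_insert span)
    also have "\<dots> \<longleftrightarrow> (\<exists>k c. x - (\<Sum>i\<in>insert j I. Const ((c(j := k)) i) * w i) \<in> A)"
      unfolding upd by (simp only: diff_diff_eq)
    also have "\<dots> \<longleftrightarrow> (\<exists>c. x - (\<Sum>i\<in>insert j I. Const (c i) * w i) \<in> A)"
      by (rule reindex)
    finally show ?thesis .
  qed
  moreover have "poly_space.independent (insert (w j) B)"
    using B(2) notin by (rule poly_space.independent_insertI[rotated])
  moreover have "w j \<notin> B" using notin poly_space.span_base by blast
  ultimately show ?case using B insert.hyps by (intro exI[of _ "insert (w j) B"]) auto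
qed

lemma card_independent_le_dim:
  assumes "poly_space.independent B" "B \<subseteq> W" "finite T" "W \<subseteq> poly_space.span T"
  shows "card B \<le> poly_space.dim W"
proof -
  obtain C where C: "C \<subseteq> W" "poly_space.independent C" "W \<subseteq> poly_space.span C"
    "card C = poly_space.dim W"
    using poly_space.basis_exists by blast
  have "finite C"
    using poly_space.independent_span_bound[OF \<open>finite T\<close> C(2)] C(1) assms(4) by blast
  then show ?thesis
    using poly_space.independent_span_bound[OF _ assms(1)] assms(2) C(3,4) by fastforce
qed

text \<open>The equality case exchanges dimension counts and spanning statements. With w_i = p^k y_i
  it passes between Hilbert functions and splittings, in both directions.\<close>

lemma dim_mod_subspace:
  fixes w :: "'b \<Rightarrow> 'i mpoly"
  assumes "finite I" "poly_space.subspace A" "poly_space.subspace W" "A \<subseteq> W"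
    and T: "finite T" "W \<subseteq> poly_space.span T"
    and w: "\<And>i. i \<in> I \<Longrightarrow> w i \<in> W"
    and ind: "\<And>c. (\<Sum>i\<in>I. Const (c i) * w i) \<in> A \<Longrightarrow> \<forall>i\<in>I. c i = 0"
  shows "poly_space.dim A + card I \<le> poly_space.dim W" (is ?le)
    and "poly_space.dim A + card I = poly_space.dim W \<longleftrightarrow>
      (\<forall>x\<in>W. \<exists>c. x - (\<Sum>i\<in>I. Const (c i) * w i) \<in> A)" (is ?eq)
proof -
  have "A \<subseteq> poly_space.span T" using T assms(4) by blast
  from basis_mod_subspace[OF assms(1,2) T(1) this ind] obtain B where
    B: "finite B" "poly_space.independent B" "card B = poly_space.dim A + card I"
    and span: "\<And>x. x \<in> poly_space.span B \<longleftrightarrow> (\<exists>c. x - (\<Sum>i\<in>I. Const (c i) * w i) \<in> A)"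
    by blast
  have "x \<in> W" if "x \<in> poly_space.span B" for x
  proof -
    from that obtain c where "x - (\<Sum>i\<in>I. Const (c i) * w i) \<in> W" using span assms(4) by blast
    moreover have "(\<Sum>i\<in>I. Const (c i) * w i) \<in> W"
      using w by (intro poly_space.subspace_sum[OF assms(3)] poly_space.subspace_scale[OF assms(3)])
    ultimately show ?thesis using poly_space.subspace_add[OF assms(3)] by fastforce
  qed
  then have BW: "B \<subseteq> W" using poly_space.span_base by blast
  from card_independent_le_dim[OF B(2) this T] show ?le using B(3) by simp
  have "card B = poly_space.dim W \<longleftrightarrow> W \<subseteq> poly_space.span B"
  proof
    assume eq: "card B = poly_space.dim W"
    show "W \<subseteq> poly_space.span B"
    proof (rule ccontr)
      assume "\<not> W \<subseteq> poly_space.span B"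
      then obtain x where x: "x \<in> W" "x \<notin> poly_space.span B" by blast
      then have "poly_space.independent (insert x B)" "x \<notin> B"
        using poly_space.independent_insertI[OF x(2) B(2)] poly_space.span_base by blast+
      then show False
        using card_independent_le_dim[of "insert x B" W T] x(1) BW T eq B(1) by simp
    qed
  next
    assume "W \<subseteq> poly_space.span B"
    then show "card B = poly_space.dim W"
      using B(2) BW by (intro poly_space.basis_card_eq_dim)
  qed
  then show ?eq unfolding B(3) subset_eq span .
qed

lemma subspace_dim_equal:
  assumes "poly_space.subspace A" "poly_space.subspace W" "A \<subseteq> W" "W \<subseteq> forms k"
    and "poly_space.dim A = poly_space.dim (W :: 'n::finite mpoly set)"
  shows "A = W"
proof -
  obtain T where T: "finite T" "forms k = poly_space.span (T :: 'n mpoly set)"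
    by (rule forms_finite_span)
  \<comment> \<open>For the empty family the spanning statement says that every element of
    \<open>W\<close> lies in \<open>A\<close>.\<close>
  have "\<forall>x\<in>W. \<exists>c. x - (\<Sum>i\<in>({}::nat set). Const (c i) * (\<lambda>_. 0) i) \<in> A"
    using dim_mod_subspace(2)[OF _ assms(1-3) T(1), of "{}"] assms(4,5) T(2) by simp
  then show ?thesis using assms(3) by auto
qed

lemma dim_forms_mono:
  assumes "A \<subseteq> (forms k :: 'n::finite mpoly set)"
  shows "poly_space.dim A \<le> poly_space.dim (forms k :: 'n::finite mpoly set)"
proof -
  obtain T where T: "finite T" "forms k = poly_space.span (T :: 'n mpoly set)"
    by (rule forms_finite_span)
  obtain B where B: "B \<subseteq> A" "poly_space.independent B" "card B = poly_space.dim A"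
    using poly_space.basis_exists[of A] by metis
  then show ?thesis using card_independent_le_dim[of B "forms k" T] assms T by auto
qed

section \<open>Homogeneous ideals as families of their graded pieces\<close>

definition graded_family :: "(nat \<Rightarrow> 'i mpoly set) \<Rightarrow> bool" where
  "graded_family H \<longleftrightarrow> (\<forall>k. poly_space.subspace (H k) \<and> H k \<subseteq> forms k \<and>
     (\<forall>p\<in>H k. \<forall>i. Var i * p \<in> H (Suc k)))"

text \<open>Testing components, rather than generating an ideal, recovers \<open>H k\<close> as the
  degree \<open>k\<close> part at once; agreement with the generated ideal is
  \<open>graded_ideal_eq_span\<close>.\<close>

definition graded_ideal :: "(nat \<Rightarrow> 'i mpoly set) \<Rightarrow> 'i mpoly set" where
  "graded_ideal H = {f. \<forall>k. hcomp k f \<in> H k}"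

lemma graded_familyD:
  assumes "graded_family H"
  shows "poly_space.subspace (H k)" "H k \<subseteq> forms k" "p \<in> H k \<Longrightarrow> Var i * p \<in> H (Suc k)"
  using assms by (auto simp: graded_family_def)

text \<open>Closure under the variables extends to all forms by peeling variables off
  \<open>g\<close>. For the limit ideal, closure under a variable is what the reduction provides
  directly.\<close>

lemma graded_family_mult:
  assumes H: "graded_family H" and "p \<in> H k" "g \<in> forms j"
  shows "g * p \<in> H (j + k)"
  using assms(3)
proof (induction j arbitrary: g)
  case 0
  then have "g * p = Const (lookup g 0) * p" using forms_0_eq_Const by metis
  then show ?case using poly_space.subspace_scale[OF graded_familyD(1)[OF H] assms(2)] by simp
next
  case (Suc j)
  from Suc.prems show ?case
  proof (induction g rule: forms_induct)
    case (single m c)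
    then obtain i m' where *: "single m c = Var i * single m' c" "mon_degree m' = j"
      by (metis single_Suc_cases)
    have "Var i * (single m' c * p) \<in> H (Suc (j + k))"
      using Suc.IH[OF single_in_forms[OF *(2)]] graded_familyD(3)[OF H] by blast
    then show ?case by (simp only: *(1) mult.assoc add_Suc)
  next
    case (add p q)
    then show ?case
      using poly_space.subspace_add[OF graded_familyD(1)[OF H]] by (metis distrib_right)
  next
    case zero
    show ?case using poly_space.subspace_0[OF graded_familyD(1)[OF H]] by simp
  qed
qed

lemma hcomp_mult_forms_less:
  assumes "g \<in> forms j" "k < j"
  shows "hcomp k (g * p) = 0"
proof (induction p rule: mpoly_induct)
  case (single m c)
  have "g * single m c \<in> forms (j + mon_degree m)"
    using assms by (intro forms_mult single_in_forms) auto
  then show ?case using assms by (simp add: hcomp_forms)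
qed (simp add: distrib_left hcomp_add)

lemma subspace_graded_ideal:
  assumes H: "graded_family H"
  shows "poly_ideal.subspace (graded_ideal H)"
proof (rule poly_ideal.subspaceI)
  note sub = graded_familyD(1)[OF H]
  show "0 \<in> graded_ideal H" using poly_space.subspace_0[OF sub] by (simp add: graded_ideal_def)
  show add: "f + g \<in> graded_ideal H" if "f \<in> graded_ideal H" "g \<in> graded_ideal H" for f g
    using that poly_space.subspace_add[OF sub] by (simp add: graded_ideal_def hcomp_add)
  show "g * f \<in> graded_ideal H" if f: "f \<in> graded_ideal H" for g f
  proof (induction g rule: mpoly_induct)
    case (single m c)
    have g: "single m c \<in> forms (mon_degree m)" by (simp add: single_in_forms)
    have "hcomp k (single m c * f) \<in> H k" for k
    proof (cases "k < mon_degree m")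
      case True
      then show ?thesis
        using hcomp_mult_forms_less[OF g] poly_space.subspace_0[OF sub] by simp
    next
      case False
      then obtain l where k: "k = mon_degree m + l" by (metis le_Suc_ex not_less)
      show ?thesis
        unfolding k hcomp_mult_forms[OF g] using f g
        by (intro graded_family_mult[OF H]) (auto simp: graded_ideal_def)
    qed
    then show ?case by (simp add: graded_ideal_def)
  next
    case (add p q)
    then show ?case using \<open>\<And>g f. f \<in> graded_ideal H \<Longrightarrow> g \<in> graded_ideal H \<Longrightarrow> f + g \<in> graded_ideal H\<close>
      by (metis distrib_right)
  qed
qed

lemma graded_ideal_Int_forms:
  assumes H: "graded_family H"
  shows "graded_ideal H \<inter> forms k = H k"
proof -
  have "f \<in> graded_ideal H \<longleftrightarrow> f \<in> H k" if "f \<in> forms k" for f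
    using that poly_space.subspace_0[OF graded_familyD(1)[OF H]]
    by (auto simp: graded_ideal_def hcomp_forms)
  then show ?thesis using graded_familyD(2)[OF H] by blast
qed

lemma graded_ideal_eq_span:
  assumes H: "graded_family H"
  shows "graded_ideal H = poly_ideal.span (\<Union>k. H k)"
proof
  have "\<And>k. H k \<subseteq> graded_ideal H" using graded_ideal_Int_forms[OF H] by blast
  then show "poly_ideal.span (\<Union>k. H k) \<subseteq> graded_ideal H"
    by (intro poly_ideal.span_minimal subspace_graded_ideal[OF H]) blast
  show "graded_ideal H \<subseteq> poly_ideal.span (\<Union>k. H k)"
  proof
    fix f assume "f \<in> graded_ideal H"
    then have "hcomp k f \<in> poly_ideal.span (\<Union>k. H k)" for k
      by (intro poly_ideal.span_base) (auto simp: graded_ideal_def)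
    then have "(\<Sum>k\<le>top_degree f. hcomp k f) \<in> poly_ideal.span (\<Union>k. H k)"
      by (intro poly_ideal.span_sum)
    then show "f \<in> poly_ideal.span (\<Union>k. H k)" using sum_hcomp[of f] by simp
  qed
qed

lemma homogeneous_graded_ideal: "graded_family H \<Longrightarrow> homogeneous_ideal (graded_ideal H)"
  by (simp add: homogeneous_ideal_def graded_ideal_Int_forms flip: graded_ideal_eq_span)

lemma homogeneous_ideal_subspace: "homogeneous_ideal I \<Longrightarrow> poly_ideal.subspace I"
  unfolding homogeneous_ideal_def by (metis poly_ideal.subspace_span)

lemma ideal_mult: "poly_ideal.subspace I \<Longrightarrow> f \<in> I \<Longrightarrow> g * f \<in> I"
  by (rule poly_ideal.subspace_scale)

lemma subspace_ideal: "poly_ideal.subspace I \<Longrightarrow> poly_space.subspace I"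
  by (auto simp: poly_ideal.subspace_def poly_space.subspace_def)

lemma graded_family_ideal: "poly_ideal.subspace I \<Longrightarrow> graded_family (\<lambda>k. I \<inter> forms k)"
  unfolding graded_family_def
  by (auto intro: poly_space.subspace_inter subspace_ideal subspace_forms Var_mult_forms ideal_mult)

lemma homogeneous_ideal_eq:
  assumes "homogeneous_ideal I"
  shows "I = graded_ideal (\<lambda>k. I \<inter> forms k)"
  using assms graded_ideal_eq_span[OF graded_family_ideal[OF homogeneous_ideal_subspace[OF assms]]]
  by (simp add: homogeneous_ideal_def)

text \<open>\<open>hilbert_fun\<close> is a truncated difference of naturals; since I_k lies in S_k,
  nothing is cut off and it may be rewritten as a sum.\<close>

lemma dim_Hilb:
  fixes I :: "'n::finite mpoly set"
  assumes "I \<in> Hilb r"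
  shows "poly_space.dim (I \<inter> forms k) + min r (poly_space.dim (forms k :: 'n mpoly set))
    = poly_space.dim (forms k :: 'n mpoly set)"
proof -
  have "poly_space.dim (forms k :: 'n mpoly set) - poly_space.dim (I \<inter> forms k)
      = min r (poly_space.dim (forms k :: 'n mpoly set))"
    using assms by (simp add: Hilb_def hilbert_fun_def)
  with dim_forms_mono[of "I \<inter> forms k" k] show ?thesis by auto
qed

text \<open>Both ideals have the same dimension in each degree, so inclusions of graded pieces are
  equalities.\<close>

lemma Hilb_eqI:
  fixes I J :: "'n::finite mpoly set"
  assumes "I \<in> Hilb r" "J \<in> Hilb r" "\<And>k. I \<inter> forms k \<subseteq> J"
  shows "I = J"
proof -
  have I: "homogeneous_ideal I" and J: "homogeneous_ideal J" using assms by (auto simp: Hilb_def)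
  have "I \<inter> forms k = J \<inter> forms k" for k
  proof (rule subspace_dim_equal)
    show "poly_space.dim (I \<inter> forms k) = poly_space.dim (J \<inter> forms k)"
      using dim_Hilb[OF assms(1), of k] dim_Hilb[OF assms(2), of k] by simp
  qed (use assms(3) I J in \<open>auto intro: poly_space.subspace_inter subspace_ideal subspace_forms
      homogeneous_ideal_subspace\<close>)
  then show ?thesis using homogeneous_ideal_eq[OF I] homogeneous_ideal_eq[OF J] by simp
qed

lemma dim_forms_0: "poly_space.dim (forms 0 :: 'n::finite mpoly set) = 1"
proof -
  have "forms 0 = poly_space.span {1 :: 'n mpoly}"
  proof
    show "forms 0 \<subseteq> poly_space.span {1 :: 'n mpoly}"
    proof
      fix p :: "'n mpoly" assume "p \<in> forms 0"
      then have "p = Const (lookup p 0) * 1" using forms_0_eq_Const by simp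
      then show "p \<in> poly_space.span {1}"
        by (metis poly_space.span_base poly_space.span_scale singletonI)
    qed
    show "poly_space.span {1 :: 'n mpoly} \<subseteq> forms 0"
      by (rule poly_space.span_minimal) (auto intro: one_in_forms subspace_forms)
  qed
  then show ?thesis
    using poly_space.dim_span_eq_card_independent[of "{1 :: 'n mpoly}"] by simp
qed

lemma dim_zero_space: "poly_space.dim {0} = 0"
  by (metis card.empty poly_space.dim_eq_card_independent poly_space.dim_span
      poly_space.independent_empty poly_space.span_empty)

text \<open>
  A graded family splits along a linear form \<open>p\<close> if \<open>S\<^sub>k = p\<^sup>k\<^sup>-\<^sup>1 S\<^sub>1 \<oplus> H\<^sub>k\<close> for all
  \<open>k \<ge> 1\<close>. Ideals of \<open>n + 1\<close> linearly independent points off the hyperplane \<open>p = 0\<close> have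
  this property, and so do their limits as long as \<open>p\<close> stays a nonzerodivisor.
\<close>

definition split_family :: "complex ^ 'n::finite \<Rightarrow> (nat \<Rightarrow> 'n mpoly set) \<Rightarrow> bool" where
  "split_family q H \<longleftrightarrow> graded_family H \<and> q \<noteq> 0 \<and> H 0 = {0} \<and>
     (\<forall>k. (\<forall>\<psi>\<in>forms (Suc k). \<exists>v. \<psi> - lf q ^ k * lf v \<in> H (Suc k)) \<and>
          (\<forall>v. lf q ^ k * lf v \<in> H (Suc k) \<longrightarrow> v = 0))"

lemma power_lf_in_forms: "lf q ^ k * lf v \<in> forms (Suc k)"
  using forms_mult[OF forms_power[OF lf_in_forms] lf_in_forms] by simp

lemma sum_Const_power_lf:
  "(\<Sum>i\<in>UNIV. Const (c i) * (lf q ^ k * Var i)) = lf q ^ k * lf (\<chi> i. c i)"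
  by (simp only: lf_def[of "vec_lambda c"] sum_distrib_left vec_lambda_beta mult_ac)

text \<open>The coefficients in \<open>dim_mod_subspace\<close> become the coordinates of
  \<open>v\<close>, so the equality case says that p^k S_1 is a complement of
  \<open>A\<close>.\<close>

lemma dim_power_lf:
  fixes q :: "complex ^ 'n::finite" and A :: "'n mpoly set"
  assumes A: "poly_space.subspace A" "A \<subseteq> forms (Suc k)"
    and inj: "\<And>v. lf q ^ k * lf v \<in> A \<Longrightarrow> v = 0"
  shows "poly_space.dim A + CARD('n) \<le> poly_space.dim (forms (Suc k) :: 'n mpoly set)"
    and "poly_space.dim A + CARD('n) = poly_space.dim (forms (Suc k) :: 'n mpoly set) \<longleftrightarrow>
      (\<forall>\<psi>\<in>forms (Suc k). \<exists>v. \<psi> - lf q ^ k * lf v \<in> A)"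
proof -
  obtain T where T: "finite T" "forms (Suc k) = poly_space.span (T :: 'n mpoly set)"
    by (rule forms_finite_span)
  have ind: "\<forall>i\<in>UNIV. c i = 0" if "(\<Sum>i\<in>UNIV. Const (c i) * (lf q ^ k * Var i)) \<in> A" for c
  proof -
    have "(\<chi> i. c i) = 0" using that inj unfolding sum_Const_power_lf by blast
    then show ?thesis by (simp add: vec_eq_iff)
  qed
  have w: "lf q ^ k * Var i \<in> forms (Suc k)" for i
    using power_lf_in_forms[of q k "axis i 1"] by (simp add: lf_axis)
  note d = dim_mod_subspace[where I = "UNIV :: 'n set" and w = "\<lambda>i. lf q ^ k * Var i",
      OF _ A(1) subspace_forms A(2) T(1) equalityD1[OF T(2)]]
  show "poly_space.dim A + CARD('n) \<le> poly_space.dim (forms (Suc k) :: 'n mpoly set)"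
    by (rule d(1)[OF _ w ind]) auto
  have "(\<exists>c. \<psi> - lf q ^ k * lf (\<chi> i. c i) \<in> A) \<longleftrightarrow> (\<exists>v. \<psi> - lf q ^ k * lf v \<in> A)" for \<psi>
    by (metis vec_lambda_eta)
  then show "poly_space.dim A + CARD('n) = poly_space.dim (forms (Suc k) :: 'n mpoly set) \<longleftrightarrow>
      (\<forall>\<psi>\<in>forms (Suc k). \<exists>v. \<psi> - lf q ^ k * lf v \<in> A)"
    using d(2)[OF _ w ind] unfolding sum_Const_power_lf by simp
qed

context
  fixes q :: "complex ^ 'n::finite" and H :: "nat \<Rightarrow> 'n mpoly set"
  assumes split: "split_family q H"
begin

lemma split_graded: "graded_family H" and split_nonzero: "q \<noteq> 0" and split_0: "H 0 = {0}"
  and split_spans: "\<psi> \<in> forms (Suc k) \<Longrightarrow> \<exists>v. \<psi> - lf q ^ k * lf v \<in> H (Suc k)"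
  and split_inj: "lf q ^ k * lf v \<in> H (Suc k) \<Longrightarrow> v = 0"
  using split by (auto simp: split_family_def)

lemma dim_split: "poly_space.dim (H (Suc k)) + CARD('n) = poly_space.dim (forms (Suc k) :: 'n mpoly set)"
  using dim_power_lf(2)[OF graded_familyD(1,2)[OF split_graded], of q k] split_inj split_spans
  by blast

text \<open>The complement p^k S_1 has dimension n+1 in each positive degree, which gives the value
  \<open>min\<close> there; \<open>H 0 = {0}\<close> settles degree 0.\<close>

lemma split_Hilb: "graded_ideal H \<in> Hilb CARD('n)"
proof -
  have "hilbert_fun (graded_ideal H) k = min CARD('n) (poly_space.dim (forms k :: 'n mpoly set))" for k
  proof (cases k)
    case 0
    have "Suc 0 \<le> CARD('n)" by (simp add: Suc_le_eq)
    with 0 show ?thesis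
      by (simp add: hilbert_fun_def graded_ideal_Int_forms[OF split_graded] split_0 dim_forms_0 dim_zero_space)
  next
    case (Suc l)
    then show ?thesis
      using dim_split[of l]
      by (simp add: hilbert_fun_def graded_ideal_Int_forms[OF split_graded])
  qed
  then show ?thesis by (simp add: Hilb_def homogeneous_graded_ideal[OF split_graded])
qed

text \<open>Modulo \<open>H\<close> the form \<psi> is p^l v, so p^k \<psi> is p^(k+l) v, and
  injectivity forces v = 0. A constant c has no such shape; for it p^k c is read as p^(k-1) (c
  p).\<close>

lemma split_cancel:
  assumes "lf q ^ k * \<psi> \<in> H (k + j)" "\<psi> \<in> forms j"
  shows "\<psi> \<in> H j"
proof (cases j)
  case 0
  then have \<psi>: "\<psi> = Const (lookup \<psi> 0)" using assms forms_0_eq_Const by simp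
  have "\<psi> = 0"
  proof (cases k)
    case 0
    with assms \<open>j = 0\<close> split_0 show ?thesis by simp
  next
    case (Suc l)
    have "lf q ^ k * \<psi> = lf q ^ l * lf (lookup \<psi> 0 *s q)"
      by (subst \<psi>) (simp only: Suc lf_scale power_Suc mult_ac)
    with assms Suc \<open>j = 0\<close> have "lf q ^ l * lf (lookup \<psi> 0 *s q) \<in> H (Suc l)" by simp
    then have "lookup \<psi> 0 *s q = 0" by (rule split_inj)
    then have "lookup \<psi> 0 = 0 \<or> q = 0" by (simp add: vector_mul_eq_0)
    with split_nonzero have "lookup \<psi> 0 = 0" by (simp add: vector_mul_eq_0)
    with \<psi> show ?thesis by simp
  qed
  with \<open>j = 0\<close> split_0 show ?thesis by simp
next
  case (Suc l)
  with assms obtain v where v: "\<psi> - lf q ^ l * lf v \<in> H j" using split_spans by blast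
  have "lf q ^ k * (\<psi> - lf q ^ l * lf v) \<in> H (k + j)"
    using v by (rule graded_family_mult[OF split_graded _ forms_power[OF lf_in_forms]])
  with assms have "lf q ^ k * \<psi> - lf q ^ k * (\<psi> - lf q ^ l * lf v) \<in> H (k + j)"
    using poly_space.subspace_diff[OF graded_familyD(1)[OF split_graded]] by blast
  moreover have "lf q ^ k * \<psi> - lf q ^ k * (\<psi> - lf q ^ l * lf v) = lf q ^ (k + l) * lf v"
    by (simp only: right_diff_distrib power_add mult.assoc) simp
  ultimately have "v = 0" using split_inj[of "k + l"] Suc by simp
  with v show ?thesis by simp
qed

text \<open>Among the multipliers of degree \<open>k\<close> the single one p^k suffices, since p
  can be cancelled modulo \<open>H\<close>.\<close>

lemma split_saturated: "saturated (graded_ideal H)"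
  unfolding saturated_def
proof safe
  fix f k assume f: "\<forall>g\<in>poly_ideal.span (forms k). g * f \<in> graded_ideal H"
  have q: "lf q ^ k \<in> forms k" by (rule forms_power[OF lf_in_forms])
  then have "lf q ^ k * f \<in> graded_ideal H" using f poly_ideal.span_base by blast
  then have "hcomp (k + j) (lf q ^ k * f) \<in> H (k + j)" for j
    by (simp only: graded_ideal_def mem_Collect_eq)
  then have "lf q ^ k * hcomp j f \<in> H (k + j)" for j
    by (simp only: hcomp_mult_forms[OF q])
  then have "hcomp j f \<in> H j" for j using split_cancel[OF _ hcomp_in_forms] by blast
  then show "f \<in> graded_ideal H" by (simp add: graded_ideal_def)
qed

text \<open>A quadric in \<open>H 2\<close> replaces y_i v by p u. Doing this once per degree
  normalizes every form without elements of \<open>H\<close> of higher degree.\<close>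

lemma split_mod_quadrics:
  assumes "\<psi> \<in> forms (Suc k)"
  shows "\<exists>v. \<psi> - lf q ^ k * lf v \<in> poly_ideal.span (H 2)"
  using assms
proof (induction k arbitrary: \<psi>)
  case 0
  then obtain v where "\<psi> = lf v" using forms_1_eq_lf by auto
  then have "\<psi> - lf q ^ 0 * lf v = 0" by simp
  then show ?case using poly_ideal.span_zero by metis
next
  case (Suc k)
  let ?Q = "poly_ideal.span (H 2)"
  from Suc.prems show ?case
  proof (induction \<psi> rule: forms_induct)
    case (single m c)
    then obtain i m' where *: "single m c = Var i * single m' c" "mon_degree m' = Suc k"
      by (metis single_Suc_cases)
    obtain v where v: "single m' c - lf q ^ k * lf v \<in> ?Q"
      using Suc.IH[OF single_in_forms[OF *(2)]] by blast
    have "Var i * lf v \<in> forms (Suc 1)" by (intro Var_mult_forms) simp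
    then obtain u where u: "Var i * lf v - lf q * lf u \<in> H 2"
      using split_spans[of "Var i * lf v" 1] by (auto simp: numeral_2_eq_2)
    have "Var i * (single m' c - lf q ^ k * lf v) + lf q ^ k * (Var i * lf v - lf q * lf u) \<in> ?Q"
      using v poly_ideal.span_base[OF u]
      by (intro poly_ideal.span_add poly_ideal.span_scale)
    also have "Var i * (single m' c - lf q ^ k * lf v) + lf q ^ k * (Var i * lf v - lf q * lf u)
       = single m c - lf q ^ Suc k * lf u"
      by (simp only: *(1) right_diff_distrib power_Suc mult_ac diff_add_diff_cancel)
    finally show ?case by blast
  next
    case (add \<phi> \<psi>)
    then obtain u v where "\<phi> - lf q ^ Suc k * lf u \<in> ?Q" "\<psi> - lf q ^ Suc k * lf v \<in> ?Q" by blast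
    from poly_ideal.span_add[OF this]
    have "\<phi> + \<psi> - lf q ^ Suc k * lf (u + v) \<in> ?Q"
      by (simp only: lf_add distrib_left add_diff_add)
    then show ?case by blast
  next
    case zero
    have "0 - lf q ^ Suc k * lf 0 \<in> ?Q" using poly_ideal.span_zero by simp
    then show ?case by blast
  qed
qed

lemma split_generated_by_quadrics: "graded_ideal H = poly_ideal.span (H 2)"
proof
  have sub: "poly_ideal.span (H 2) \<subseteq> graded_ideal H"
    using graded_ideal_Int_forms[OF split_graded]
    by (intro poly_ideal.span_minimal subspace_graded_ideal[OF split_graded]) blast
  then show "poly_ideal.span (H 2) \<subseteq> graded_ideal H" .
  have "\<psi> \<in> poly_ideal.span (H 2)" if "\<psi> \<in> H k" for k \<psi>
  proof (cases k)
    case 0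
    with that split_0 show ?thesis using poly_ideal.span_zero by auto
  next
    case (Suc l)
    with that have \<psi>: "\<psi> \<in> forms (Suc l)" using graded_familyD(2)[OF split_graded] by blast
    then obtain v where v: "\<psi> - lf q ^ l * lf v \<in> poly_ideal.span (H 2)"
      using split_mod_quadrics by blast
    moreover have "\<psi> - lf q ^ l * lf v \<in> forms (Suc l)"
      by (intro forms_diff \<psi> power_lf_in_forms)
    ultimately have "\<psi> - lf q ^ l * lf v \<in> H k"
      using sub graded_ideal_Int_forms[OF split_graded, of k] Suc by blast
    \<comment> \<open>The normal form p^l v of an element of \<open>H k\<close> is itself in
      \<open>H k\<close>, so it is 0 and only the part generated by quadrics remains.\<close>
    then have "\<psi> - (\<psi> - lf q ^ l * lf v) \<in> H k"
      using poly_space.subspace_diff[OF graded_familyD(1)[OF split_graded] that] by blast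
    then have "v = 0" using split_inj Suc by simp
    with v show ?thesis by simp
  qed
  then show "graded_ideal H \<subseteq> poly_ideal.span (H 2)"
    unfolding graded_ideal_eq_span[OF split_graded] by (intro poly_ideal.span_minimal) blast+
qed

lemma split_unique:
  assumes J: "J \<in> Hilb CARD('n)" and "J \<inter> forms 2 \<subseteq> H 2"
  shows "J = graded_ideal H"
proof -
  have idJ: "poly_ideal.subspace J"
    using J by (auto simp: Hilb_def intro: homogeneous_ideal_subspace)
  note H2 = graded_ideal_Int_forms[OF split_graded, of 2]
  have "poly_space.dim (J \<inter> forms 2) = poly_space.dim (H 2)"
    using dim_Hilb[OF J, of 2] dim_Hilb[OF split_Hilb, of 2] H2 by simp
  then have "J \<inter> forms 2 = H 2"
    using assms(2) graded_familyD(1,2)[OF split_graded, of 2] idJ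
    by (intro subspace_dim_equal[of _ _ 2])
      (auto intro: poly_space.subspace_inter subspace_ideal subspace_forms)
  then have "H 2 \<subseteq> J" by blast
  then have "graded_ideal H \<subseteq> J"
    unfolding split_generated_by_quadrics by (intro poly_ideal.span_minimal idJ)
  then have "graded_ideal H = J" by (intro Hilb_eqI[OF split_Hilb J]) blast
  then show ?thesis ..
qed

end

section \<open>Powers of linear forms\<close>

lemma Const_inj [simp]: "Const a = Const b \<longleftrightarrow> a = b"
  by (metis lookup_single_eq Const_def)

lemma of_nat_eq_Const: "of_nat n = Const (of_nat n)"
  by (simp add: Const_def)

lemma Const_uminus: "Const (- a) = - Const a"
  by (simp add: Const_def single_uminus)

lemma Const_power: "Const (a ^ k) = Const a ^ k"
  by (induction k) (simp_all add: Const_mult)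

text \<open>Vandermonde by elimination: subtracting 2^(m+1) times the value at t from the value at
  2t removes the top coefficient and multiplies c_i by 2^i - 2^(m+1), which is nonzero for i at most
  m. The value t = 0 is avoided because projective points are only closed under nonzero
  scaling.\<close>

lemma poly_coeffs_in_subspace:
  assumes W: "poly_space.subspace W"
    and "\<And>t. t \<noteq> 0 \<Longrightarrow> (\<Sum>i\<le>m. Const (t ^ i) * c i) \<in> W" "i \<le> m"
  shows "c i \<in> W"
  using assms(2,3)
proof (induction m arbitrary: c i)
  case 0
  from "0.prems"(1)[of 1] "0.prems"(2) show ?case by simp
next
  case (Suc m)
  define c' where "c' i = Const (2 ^ i - 2 ^ Suc m) * c i" for i
  have "(\<Sum>i\<le>m. Const (t ^ i) * c' i) \<in> W" if "t \<noteq> 0" for t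
  proof -
    have "Const (t ^ i) * c' i = Const ((2 * t) ^ i) * c i - Const (2 ^ Suc m) * (Const (t ^ i) * c i)" for i
    proof -
      have "Const (t ^ i) * c' i = Const (t ^ i * (2 ^ i - 2 ^ Suc m)) * c i"
        by (simp only: c'_def Const_mult mult.assoc)
      also have "t ^ i * (2 ^ i - 2 ^ Suc m) = (2 * t) ^ i + (- (2 ^ Suc m * t ^ i))"
        by (simp add: power_mult_distrib algebra_simps)
      also have "Const \<dots> * c i = Const ((2 * t) ^ i) * c i + Const (- (2 ^ Suc m * t ^ i)) * c i"
        by (simp only: Const_add distrib_right)
      also have "Const (- (2 ^ Suc m * t ^ i)) * c i = - (Const (2 ^ Suc m) * (Const (t ^ i) * c i))"
        by (simp only: Const_uminus Const_mult mult.assoc minus_mult_left[symmetric])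
      finally show ?thesis by (simp only: add_uminus_conv_diff)
    qed
    then have "(\<Sum>i\<le>Suc m. Const (t ^ i) * c' i)
       = (\<Sum>i\<le>Suc m. Const ((2 * t) ^ i) * c i) - Const (2 ^ Suc m) * (\<Sum>i\<le>Suc m. Const (t ^ i) * c i)"
      by (simp only: sum_subtractf sum_distrib_left)
    moreover have "c' (Suc m) = 0" by (simp add: c'_def)
    ultimately have "(\<Sum>i\<le>m. Const (t ^ i) * c' i)
       = (\<Sum>i\<le>Suc m. Const ((2 * t) ^ i) * c i) - Const (2 ^ Suc m) * (\<Sum>i\<le>Suc m. Const (t ^ i) * c i)"
      by (simp only: sum.atMost_Suc) simp
    then show ?thesis
      using Suc.prems(1)[of "2 * t"] Suc.prems(1)[of t] that
      by (simp only:) (intro poly_space.subspace_diff[OF W] poly_space.subspace_scale[OF W]; simp)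
  qed
  from Suc.IH[of c', OF this] have c': "c' j \<in> W" if "j \<le> m" for j using that by blast
  have low: "c j \<in> W" if "j \<le> m" for j
  proof -
    have ne: "(2::complex) ^ j - 2 ^ Suc m \<noteq> 0"
    proof
      assume "(2::complex) ^ j - 2 ^ Suc m = 0"
      then have "(2::complex) ^ j = 2 ^ Suc m" by simp
      then have "norm ((2::complex) ^ j) = norm ((2::complex) ^ Suc m)" by (rule arg_cong)
      then have "(2::real) ^ j = 2 ^ Suc m" by (simp only: norm_power norm_numeral)
      then have "j = Suc m" by (subst (asm) power_inject_exp) auto
      with that show False by simp
    qed
    have "Const (inverse (2 ^ j - 2 ^ Suc m)) * c' j = Const (inverse (2 ^ j - 2 ^ Suc m) * (2 ^ j - 2 ^ Suc m)) * c j"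
      by (simp only: c'_def Const_mult mult.assoc)
    also have "\<dots> = c j" by (simp only: left_inverse[OF ne] Const_1 mult_1)
    finally show ?thesis using poly_space.subspace_scale[OF W c'[OF that]] by metis
  qed
  \<comment> \<open>The top coefficient is what remains of the value at t = 1 once the others are
    known to lie in \<open>W\<close>.\<close>
  have "(\<Sum>i\<le>m. c i) \<in> W" by (intro poly_space.subspace_sum[OF W]) (simp add: low)
  moreover have "(\<Sum>i\<le>m. c i) + c (Suc m) \<in> W" using Suc.prems(1)[of 1] by simp
  ultimately have "(\<Sum>i\<le>m. c i) + c (Suc m) - (\<Sum>i\<le>m. c i) \<in> W"
    using poly_space.subspace_diff[OF W] by blast
  then have "c (Suc m) \<in> W" by simp
  with low Suc.prems(2) show ?case by (metis le_Suc_eq)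
qed

lemma poly_coeffs_eq_0:
  assumes "\<And>t. t \<noteq> 0 \<Longrightarrow> (\<Sum>i\<le>m. t ^ i * a i) = (0 :: complex)" "i \<le> m"
  shows "a i = 0"
proof -
  have Const_sum: "Const (sum f A) = (\<Sum>a\<in>A. Const (f a))" for f and A :: "nat set"
    by (induction A rule: infinite_finite_induct) (simp_all add: Const_add)
  \<comment> \<open>Scalars are embedded as constants of an auxiliary polynomial ring, where the
    subspace \<open>{0}\<close> is used.\<close>
  have "Const (a i) \<in> {0 :: nat mpoly}"
  proof (rule poly_coeffs_in_subspace[where m = m and c = "\<lambda>i. Const (a i)"])
    show "(\<Sum>i\<le>m. Const (t ^ i) * Const (a i)) \<in> {0 :: nat mpoly}" if "t \<noteq> 0" for t
      using assms(1)[OF that] by (simp only: Const_mult[symmetric] Const_sum[symmetric]) simp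
  qed (use assms(2) in simp_all)
  then have "Const (a i) = (Const 0 :: nat mpoly)" by simp
  then show ?thesis by (simp only: Const_inj)
qed

text \<open>Polarization: in (t y_i + a)^(k+1) the coefficient of t is (k+1) y_i a^k. It lies in
  \<open>W\<close> because all values in t do.\<close>

lemma powers_span_step:
  fixes g :: "'n::finite mpoly"
  assumes "\<And>g a. g \<in> forms j \<Longrightarrow> g * lf a ^ Suc k \<in> W" and W: "poly_space.subspace W"
    and "g \<in> forms (Suc j)"
  shows "g * lf a ^ k \<in> W"
  using assms(3)
proof (induction g rule: forms_induct)
  case (single m c)
  then obtain i m' where *: "single m c = Var i * single m' c" "mon_degree m' = j"
    by (metis single_Suc_cases)
  define C where "C l = Const (of_nat (Suc k choose l)) * (single m' c * (Var i ^ l * lf a ^ (Suc k - l)))" for l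
  have "C 1 \<in> W"
  proof (rule poly_coeffs_in_subspace[OF W, where m = "Suc k" and c = C])
    fix t :: complex
    have "lf (t *s axis i 1 + a) ^ Suc k
        = (\<Sum>l\<le>Suc k. of_nat (Suc k choose l) * (Const t * Var i) ^ l * lf a ^ (Suc k - l))"
      by (simp only: lf_add lf_scale lf_axis binomial_ring)
    also have "single m' c * \<dots> = (\<Sum>l\<le>Suc k. Const (t ^ l) * C l)"
      by (simp only: sum_distrib_left C_def of_nat_eq_Const power_mult_distrib Const_power mult_ac)
    finally show "(\<Sum>l\<le>Suc k. Const (t ^ l) * C l) \<in> W"
      using assms(1)[OF single_in_forms[OF *(2)]] by metis
  qed simp
  then have "Const (inverse (of_nat (Suc k))) * C 1 \<in> W"
    by (rule poly_space.subspace_scale[OF W])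
  also have "Const (inverse (of_nat (Suc k))) * C 1
      = Const (inverse (of_nat (Suc k)) * of_nat (Suc k)) * (single m' c * (Var i * lf a ^ k))"
    by (simp only: C_def Const_mult mult.assoc choose_one power_one_right diff_Suc_1)
  also have "\<dots> = single m c * lf a ^ k"
  proof -
    have "inverse (of_nat (Suc k)) * of_nat (Suc k) = (1 :: complex)"
      by (rule left_inverse) (simp del: of_nat_Suc)
    then show ?thesis by (simp only: *(1) Const_1 mult_1 mult_ac)
  qed
  finally show ?case .
next
  case (add p q)
  then show ?case using poly_space.subspace_add[OF W] by (simp only: distrib_right)
next
  case zero
  show ?case using poly_space.subspace_0[OF W] by simp
qed

text \<open>Starting from constants times d-th powers, each step trades one factor of the power for
  an arbitrary variable; at j = d the power is used up.\<close>

lemma forms_subset_span_powers: "forms d \<subseteq> poly_space.span (range (\<lambda>a. lf a ^ d :: 'n::finite mpoly))"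
proof -
  let ?W = "poly_space.span (range (\<lambda>a. lf a ^ d :: 'n mpoly))"
  have "\<forall>g\<in>forms j. \<forall>a. g * lf a ^ (d - j) \<in> ?W" if "j \<le> d" for j
    using that
  proof (induction j)
    case 0
    show ?case
    proof (intro ballI allI)
      fix g a assume "g \<in> (forms 0 :: 'n mpoly set)"
      then have "g * lf a ^ (d - 0) = Const (lookup g 0) * lf a ^ d"
        using forms_0_eq_Const[of g] by simp
      then show "g * lf a ^ (d - 0) \<in> ?W"
        by (metis poly_space.span_base poly_space.span_scale rangeI)
    qed
  next
    case (Suc j)
    then have "d - j = Suc (d - Suc j)" by simp
    with Suc show ?case
      using powers_span_step[of j "d - Suc j" ?W] poly_space.subspace_span by simp
  qed
  from this[of d] have "g \<in> ?W" if "g \<in> forms d" for g using that by simp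
  then show ?thesis by blast
qed

lemma eval_hcomp_expand:
  "eval p (\<lambda>i. t * x i) = (\<Sum>k\<le>top_degree p. t ^ k * eval (hcomp k p) x)"
proof -
  have "eval p (\<lambda>i. t * x i) = (\<Sum>k\<le>top_degree p. eval (hcomp k p) (\<lambda>i. t * x i))"
    using sum_hcomp[of p "top_degree p"] by (metis eval_sum order_refl)
  then show ?thesis by (simp only: eval_scale_forms[OF hcomp_in_forms])
qed

text \<open>Along the line through \<open>x\<close>, the value is a polynomial in t whose
  coefficients are the values of the homogeneous components.\<close>

lemma eval_hcomp_eq_0:
  assumes "\<And>t. t \<noteq> 0 \<Longrightarrow> eval p (\<lambda>i. t * x i) = 0"
  shows "eval (hcomp k p) x = 0"
proof (cases "k \<le> top_degree p")
  case True
  show ?thesis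
    by (rule poly_coeffs_eq_0[where m = "top_degree p" and a = "\<lambda>k. eval (hcomp k p) x"])
      (use assms True in \<open>simp_all only: eval_hcomp_expand[symmetric]\<close>)
qed (simp add: hcomp_eq_0)

text \<open>Vanishing at \<open>a\<close> makes each component apolar to \<open>lf a ^ k\<close>.
  These powers span the forms of degree k, so nondegeneracy of the pairing applies.\<close>

lemma eval_eq_0_imp:
  fixes p :: "'n::finite mpoly"
  assumes "\<And>a :: complex ^ 'n. eval p (($) a) = 0"
  shows "p = 0"
proof -
  have "hcomp k p = 0" for k
  proof (rule apolar_nondegenerate[OF hcomp_in_forms])
    fix \<psi> :: "'n mpoly" assume \<psi>: "\<psi> \<in> forms k"
    have "apolar (lf a ^ k) (hcomp k p) = 0" for a
    proof -
      have "eval p (\<lambda>i. t * a $ i) = 0" for t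
        using assms[of "t *s a"] by (simp add: vector_smult_component[abs_def] cong: if_cong)
      then have "eval (hcomp k p) (($) a) = 0" by (intro eval_hcomp_eq_0)
      then show ?thesis by (simp add: apolar_power_lf[OF hcomp_in_forms])
    qed
    moreover have "poly_space.subspace {\<psi>. apolar \<psi> (hcomp k p) = 0}"
      by (rule poly_space.subspaceI) (auto simp: apolar_add_left apolar_scale_left)
    ultimately have "poly_space.span (range (\<lambda>a. lf a ^ k)) \<subseteq> {\<psi>. apolar \<psi> (hcomp k p) = 0}"
      by (intro poly_space.span_minimal) auto
    with \<psi> show "apolar \<psi> (hcomp k p) = 0" using forms_subset_span_powers by blast
  qed
  then show ?thesis using sum_hcomp[of p "top_degree p"] by simp
qed

section \<open>The Hessian\<close>

lemma eval_of_int [simp]: "eval (of_int k) x = of_int k"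
proof -
  have "(of_int k :: 'a mpoly) = Const (of_int k)" by (simp add: Const_def)
  then show ?thesis by simp
qed

lemma eval_prod [simp]: "eval (prod f A) x = (\<Prod>a\<in>A. eval (f a) x)"
  by (induction A rule: infinite_finite_induct) auto

lemma eval_det: "eval (det A) x = det (\<chi> i j. eval (A $ i $ j) x)"
  by (simp add: det_def)

definition gram :: "'n::finite mpoly \<Rightarrow> nat \<Rightarrow> complex ^ 'n \<Rightarrow> complex ^ 'n ^ 'n" where
  "gram F d q = (\<chi> i j. apolar (lf q ^ (d - 2) * (Var i * Var j)) F)"

text \<open>Each entry is (d-2)! times the value of a second derivative at \<open>q\<close>; the
  determinant collects this factor once per row.\<close>

lemma det_gram:
  fixes F :: "'n::finite mpoly"
  assumes "F \<in> forms d" "d \<ge> 2"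
  shows "det (gram F d q) = fact (d - 2) ^ CARD('n) * eval (Hess F) (($) q)"
proof -
  have 1: "act (Var i) (act (Var j) F) \<in> forms (d - 2)" for i j
  proof -
    have "1 + (1 + (d - 2)) = d" using assms(2) by simp
    then have "act (Var j) F \<in> forms (1 + (d - 2))"
      by (intro act_in_forms[OF Var_in_forms]) (simp only: assms(1))
    then show ?thesis by (rule act_in_forms[OF Var_in_forms])
  qed
  have "apolar (lf q ^ (d - 2) * (Var i * Var j)) F
      = fact (d - 2) * eval (act (Var i) (act (Var j) F)) (($) q)" for i j
    using apolar_power_lf[OF 1] by (simp only: apolar_def act_mult)
  then have "gram F d q = (\<chi> i. fact (d - 2) *s (\<chi> j. eval (act (Var i) (act (Var j) F)) (($) q)))"
    by (simp add: gram_def vec_eq_iff)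
  then show ?thesis
    by (simp add: det_rows_mul Hess_def eval_det)
qed

lemma Hess_nonzero_iff:
  assumes "F \<in> forms d" "d \<ge> 2"
  shows "Hess F \<noteq> 0 \<longleftrightarrow> (\<exists>q. det (gram F d q) \<noteq> 0)"
  using det_gram[OF assms] eval_eq_0_imp[of "Hess F"] by auto

lemma gram_mult_vec:
  "(gram F d q *v w) $ i = apolar (lf q ^ (d - 2) * (Var i * lf w)) F"
proof -
  have *: "lf q ^ (d - 2) * (Var i * lf w)
      = (\<Sum>j\<in>UNIV. Const (w $ j) * (lf q ^ (d - 2) * (Var i * Var j)))"
    by (simp only: lf_def[of w] sum_distrib_left mult_ac)
  have "(gram F d q *v w) $ i = (\<Sum>j\<in>UNIV. w $ j * apolar (lf q ^ (d - 2) * (Var i * Var j)) F)"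
    unfolding gram_def matrix_vector_mult_def vec_lambda_beta by (simp only: mult.commute)
  then show ?thesis by (simp only: * apolar_sum_left apolar_scale_left)
qed

lemma concise_gram:
  fixes F :: "'n::finite mpoly"
  assumes F: "F \<in> forms d" "concise F" "d \<ge> 2"
    and split: "split_family q H" and H: "\<And>k. H k \<subseteq> Ann F"
  shows "det (gram F d q) \<noteq> 0"
proof
  assume "det (gram F d q) = 0"
  then have "\<not> (\<exists>B. B ** gram F d q = mat 1)"
    using invertible_det_nz invertible_left_inverse by blast
  then obtain w where w: "w \<noteq> 0" "gram F d q *v w = 0"
    unfolding matrix_left_invertible_ker by blast
  have w0: "apolar (lf q ^ (d - 2) * (lf v * lf w)) F = 0" for v
  proof -
    have "lf q ^ (d - 2) * (lf v * lf w)
        = (\<Sum>i\<in>UNIV. Const (v $ i) * (lf q ^ (d - 2) * (Var i * lf w)))"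
      by (simp only: lf_def[of v] sum_distrib_left sum_distrib_right mult_ac)
    then show ?thesis
      by (simp only: apolar_sum_left apolar_scale_left gram_mult_vec[symmetric] w(2) zero_index
          mult_zero_right sum.neutral_const)
  qed
  have d: "d - 1 = Suc (d - 2)" "d = 1 + (d - 1)" using F(3) by auto
  have "act (lf w) F = 0"
  proof (rule apolar_nondegenerate)
    show "act (lf w) F \<in> forms (d - 1)" using F(1) d(2) by (metis act_in_forms lf_in_forms)
    fix \<psi> :: "'n mpoly" assume "\<psi> \<in> forms (d - 1)"
    then obtain v where v: "\<psi> - lf q ^ (d - 2) * lf v \<in> H (d - 1)"
      using split_spans[OF split] d(1) by metis
    have "act (\<psi> - lf q ^ (d - 2) * lf v) F = 0" using v H by (auto simp: Ann_def)
    then have "act (lf w * (\<psi> - lf q ^ (d - 2) * lf v)) F = 0" by (simp add: act_mult)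
    moreover have "lf w * (\<psi> - lf q ^ (d - 2) * lf v) = \<psi> * lf w - lf q ^ (d - 2) * (lf v * lf w)"
      by (simp only: right_diff_distrib mult_ac)
    ultimately have "apolar (\<psi> * lf w) F = apolar (lf q ^ (d - 2) * (lf v * lf w)) F"
      by (simp add: apolar_def act_diff_left)
    then show "apolar \<psi> (act (lf w) F) = 0" using w0 by (simp add: apolar_def act_mult)
  qed
  then have "lf w \<in> Ann F \<inter> forms 1" by (simp add: Ann_def)
  then have "lf w = 0" using F(2) unfolding concise_def by blast
  with w(1) show False by simp
qed

section \<open>Linear nonzerodivisors modulo a saturated ideal\<close>

text \<open>
  The maximal spaces among the \<open>nil_forms I w\<close> with \<open>w \<notin> I\<close> play the role of the degree one
  parts of the associated primes of \<open>I\<close>. Generators with different maximal spaces are linearly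
  independent modulo \<open>I\<close> in each degree, so the Hilbert function bounds the number of these
  spaces, and they cannot cover the space of linear forms.
\<close>

definition nil_forms :: "'n::finite mpoly set \<Rightarrow> 'n mpoly \<Rightarrow> (complex ^ 'n) set" where
  "nil_forms I w = {v. \<forall>\<^sub>F m in sequentially. lf v ^ m * w \<in> I}"

context
  fixes I :: "'n::finite mpoly set" and r :: nat
  assumes ideal: "poly_ideal.subspace I"
    and sat: "saturated I"
    and bound: "\<And>k. poly_space.dim (forms k :: 'n mpoly set) \<le> poly_space.dim (I \<inter> forms k) + r"
begin

text \<open>One exponent suffices because an ideal absorbs the remaining powers. The definition asks
  for all large exponents so that finitely many conditions can share one.\<close>

lemma nil_formsI: "lf v ^ m * w \<in> I \<Longrightarrow> v \<in> nil_forms I w"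
  unfolding nil_forms_def mem_Collect_eq eventually_sequentially
proof (intro exI[of _ m] allI impI)
  fix m' assume "lf v ^ m * w \<in> I" "m \<le> m'"
  then have "lf v ^ (m' - m) * (lf v ^ m * w) \<in> I" by (intro ideal_mult[OF ideal, of "lf v ^ m * w"])
  moreover have "lf v ^ (m' - m) * (lf v ^ m * w) = lf v ^ (m' - m + m) * w"
    by (simp only: power_add mult.assoc)
  ultimately show "lf v ^ m' * w \<in> I" using \<open>m \<le> m'\<close> by (simp only: le_add_diff_inverse2)
qed

lemma nil_formsD: "v \<in> nil_forms I w \<Longrightarrow> \<exists>m. lf v ^ m * w \<in> I"
  unfolding nil_forms_def eventually_sequentially by blast

lemma nil_forms_mono: "nil_forms I w \<subseteq> nil_forms I (g * w)"
proof
  fix v assume "v \<in> nil_forms I w"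
  then obtain m where "lf v ^ m * w \<in> I" using nil_formsD by blast
  then have "g * (lf v ^ m * w) \<in> I" by (rule ideal_mult[OF ideal])
  then have "lf v ^ m * (g * w) \<in> I" by (simp only: mult.left_commute)
  then show "v \<in> nil_forms I (g * w)" by (rule nil_formsI)
qed

lemma subspace_nil_forms: "vec.subspace (nil_forms I w)"
proof (rule vec.subspaceI)
  show "0 \<in> nil_forms I w"
    by (rule nil_formsI[of _ 1]) (simp add: poly_ideal.subspace_0[OF ideal])
next
  fix a b assume "a \<in> nil_forms I w" "b \<in> nil_forms I w"
  then obtain m k where mk: "lf a ^ m * w \<in> I" "lf b ^ k * w \<in> I" using nil_formsD by metis
  \<comment> \<open>In every term of the binomial expansion of (a + b)^(m+k), either the exponent of
    a is at least m or that of b is at least k.\<close>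
  have "lf a ^ j * lf b ^ (m + k - j) * w \<in> I" if "j \<le> m + k" for j
  proof (cases "m \<le> j")
    case True
    have "lf a ^ j = lf a ^ m * lf a ^ (j - m)"
      by (simp only: power_add[symmetric] le_add_diff_inverse[OF True])
    then have "lf a ^ j * lf b ^ (m + k - j) * w = lf a ^ (j - m) * lf b ^ (m + k - j) * (lf a ^ m * w)"
      by (simp only: mult_ac)
    then show ?thesis using ideal_mult[OF ideal mk(1)] by simp
  next
    case False
    then have "m + k - j = k + (m - j)" by simp
    then have "lf a ^ j * lf b ^ (m + k - j) * w = lf a ^ j * lf b ^ (m - j) * (lf b ^ k * w)"
      by (simp only: power_add mult_ac)
    then show ?thesis using ideal_mult[OF ideal mk(2)] by simp
  qed
  then have "of_nat (m + k choose j) * (lf a ^ j * lf b ^ (m + k - j) * w) \<in> I" if "j \<le> m + k" for j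
    using that by (intro ideal_mult[OF ideal, of "lf a ^ j * lf b ^ (m + k - j) * w"])
  then have "(\<Sum>j\<le>m + k. of_nat (m + k choose j) * (lf a ^ j * lf b ^ (m + k - j) * w)) \<in> I"
    by (intro poly_ideal.subspace_sum[OF ideal]) simp
  then have "lf (a + b) ^ (m + k) * w \<in> I"
    by (simp only: lf_add binomial_ring sum_distrib_right mult.assoc)
  then show "a + b \<in> nil_forms I w" by (rule nil_formsI)
next
  fix c a assume "a \<in> nil_forms I w"
  then obtain m where "lf a ^ m * w \<in> I" using nil_formsD by blast
  then have "Const c ^ m * (lf a ^ m * w) \<in> I" by (rule ideal_mult[OF ideal])
  then have "lf (c *s a) ^ m * w \<in> I" by (simp only: lf_scale power_mult_distrib mult.assoc)
  then show "c *s a \<in> nil_forms I w" by (rule nil_formsI)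
qed

text \<open>If every variable had a power y_i^(M i) sending w into I, then each monomial whose
  degree is the sum of the \<open>M i\<close> would contain one of these powers. A power of the
  irrelevant ideal would send w into I, and saturation would give w in I.\<close>

lemma nil_forms_proper:
  assumes "w \<notin> I"
  shows "nil_forms I w \<noteq> UNIV"
proof
  assume "nil_forms I w = UNIV"
  then have "\<forall>i. \<exists>m. lf (axis i 1) ^ m * w \<in> I" using nil_formsD by blast
  then obtain M where M: "Var i ^ M i * w \<in> I" for i unfolding lf_axis by metis
  let ?M = "\<Sum>i\<in>UNIV. M i"
  have Var_power: "Var i ^ k = single (single i k) 1" for i :: 'n and k
    by (induction k) (simp_all add: Var_def mult_single single_add[symmetric])
  have "g * w \<in> I" if "g \<in> forms ?M" for g
    using that
  proof (induction g rule: forms_induct)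
    case (single m c)
    have "\<exists>i. M i \<le> lookup m i"
    proof (rule ccontr)
      assume "\<nexists>i. M i \<le> lookup m i"
      then have "(\<Sum>i\<in>UNIV. lookup m i) < ?M" by (intro sum_strict_mono) (auto simp: not_le)
      with single show False by (simp add: mon_degree_superset[of UNIV])
    qed
    then obtain i where "M i \<le> lookup m i" by blast
    then have "m = m - single i (M i) + single i (M i)"
      by (intro poly_mapping_eqI) (auto simp: lookup_add lookup_minus lookup_single when_def)
    then have "single m c = single (m - single i (M i)) c * Var i ^ M i"
      by (metis Var_power mult.right_neutral mult_single)
    then show ?case using ideal_mult[OF ideal M[of i]] by (simp only: mult.assoc)
  next
    case (add p q)
    then show ?case using poly_ideal.subspace_add[OF ideal] by (simp only: distrib_right)
  next
    case zero
    show ?case using poly_ideal.subspace_0[OF ideal] by simp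
  qed
  then have "forms ?M \<subseteq> {g. g * w \<in> I}" by blast
  moreover have "poly_ideal.subspace {g. g * w \<in> I}"
    using poly_ideal.subspace_0[OF ideal] poly_ideal.subspace_add[OF ideal] ideal_mult[OF ideal]
    by (intro poly_ideal.subspaceI) (simp_all only: mem_Collect_eq distrib_right mult.assoc mult_zero_left)
  ultimately have "poly_ideal.span (forms ?M) \<subseteq> {g. g * w \<in> I}" by (rule poly_ideal.span_minimal)
  then have "w \<in> I" using sat unfolding saturated_def by blast
  with assms show False by blast
qed

definition nil_spaces :: "(complex ^ 'n) set set" where
  "nil_spaces = {nil_forms I w | w k. w \<in> forms k \<and> w \<notin> I}"

definition max_nil_spaces :: "(complex ^ 'n) set set" where
  "max_nil_spaces = {P \<in> nil_spaces. \<forall>P'\<in>nil_spaces. P \<subseteq> P' \<longrightarrow> P' = P}"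

text \<open>Dimensions are bounded, and a space of largest dimension among those containing
  \<open>P\<close> is maximal.\<close>

lemma max_nil_space_above:
  assumes "P \<in> nil_spaces"
  shows "\<exists>P'\<in>max_nil_spaces. P \<subseteq> P'"
proof -
  define A where "A = {P' \<in> nil_spaces. P \<subseteq> P'}"
  have "finite (vec.dim ` A)"
    by (rule finite_subset[of _ "{..vec.dim (UNIV :: (complex ^ 'n) set)}"])
      (auto intro: vec.dim_subset simp del: vec.dim_UNIV)
  moreover have "P \<in> A" using assms by (simp add: A_def)
  ultimately obtain P' where P': "P' \<in> A" "\<And>Q. Q \<in> A \<Longrightarrow> vec.dim Q \<le> vec.dim P'"
    using Max_in[of "vec.dim ` A"] Max_ge[of "vec.dim ` A"] by (metis (no_types, lifting) empty_iff imageE image_is_empty imageI)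
  have "Q = P'" if Q: "Q \<in> nil_spaces" "P' \<subseteq> Q" for Q
  proof -
    have "Q \<in> A" using Q P'(1) by (auto simp: A_def)
    then have "vec.dim Q \<le> vec.dim P'" by (rule P'(2))
    moreover have "vec.subspace Q" "vec.subspace P'"
      using Q(1) P'(1) subspace_nil_forms by (auto simp: A_def nil_spaces_def)
    ultimately show ?thesis using Q(2) vec.subspace_dim_equal by blast
  qed
  then show ?thesis using P'(1) by (auto simp: A_def max_nil_spaces_def)
qed

text \<open>Multiplying \<open>w\<close> can only enlarge its space, and maximality forbids that.
  This raises the degree of a generator without changing its space.\<close>

lemma nil_forms_power:
  assumes "nil_forms I w \<in> max_nil_spaces" "w \<in> forms k" "v \<notin> nil_forms I w"
  shows "lf v ^ m * w \<in> forms (m + k) \<and> lf v ^ m * w \<notin> I \<and> nil_forms I (lf v ^ m * w) = nil_forms I w"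
proof -
  have 1: "lf v ^ m * w \<in> forms (m + k)" by (intro forms_mult forms_power lf_in_forms assms)
  moreover have 2: "lf v ^ m * w \<notin> I" using nil_formsI assms(3) by blast
  ultimately have "nil_forms I (lf v ^ m * w) \<in> nil_spaces" by (auto simp: nil_spaces_def)
  then show ?thesis using assms(1) nil_forms_mono[of w] 1 2 unfolding max_nil_spaces_def by blast
qed

text \<open>Distinct maximal spaces are not nested, so some v lies in another space Q but not in P1.
  A high power of v sends every term whose space contains v into I and keeps the others with their
  spaces, leaving a relation over a smaller set with the same coefficients.\<close>

lemma max_nil_spaces_independent:
  assumes "finite G" "G \<subseteq> max_nil_spaces"
    and "\<And>P. P \<in> G \<Longrightarrow> w P \<in> forms K \<and> w P \<notin> I \<and> nil_forms I (w P) = P"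
    and "(\<Sum>P\<in>G. Const (c P) * w P) \<in> I" "P1 \<in> G"
  shows "c P1 = 0"
  using assms
proof (induction G arbitrary: w K P1 rule: finite_psubset_induct)
  case (psubset G)
  note w = psubset.prems(2)
  show ?case
  proof (cases "G = {P1}")
    case True
    then have mem: "Const (c P1) * w P1 \<in> I" using psubset.prems(3) by simp
    show ?thesis
    proof (rule ccontr)
      assume "c P1 \<noteq> 0"
      then have "Const (inverse (c P1)) * (Const (c P1) * w P1) = w P1"
        by (simp only: mult.assoc[symmetric] Const_mult[symmetric]) simp
      with ideal_mult[OF ideal mem] have "w P1 \<in> I" by metis
      with w psubset.prems(4) show False by blast
    qed
  next
    case False
    then obtain Q where Q: "Q \<in> G" "Q \<noteq> P1" using psubset.prems(4) by blast
    have "\<not> Q \<subseteq> P1" using Q psubset.prems(1,4) unfolding max_nil_spaces_def by blast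
    then obtain v where v: "v \<in> Q" "v \<notin> P1" by blast
    have "\<forall>\<^sub>F m in sequentially. \<forall>P\<in>{P\<in>G. v \<in> P}. lf v ^ m * w P \<in> I"
    proof (rule eventually_ball_finite)
      show "\<forall>P\<in>{P \<in> G. v \<in> P}. \<forall>\<^sub>F m in sequentially. lf v ^ m * w P \<in> I"
        using w by (auto simp: nil_forms_def)
    qed (use psubset.hyps in simp)
    then obtain m where m: "\<And>P. P \<in> G \<Longrightarrow> v \<in> P \<Longrightarrow> lf v ^ m * w P \<in> I"
      by (auto simp: eventually_sequentially)
    define G' where "G' = {P\<in>G. v \<notin> P}"
    have "G' \<subset> G" using Q v by (auto simp: G'_def)
    moreover have "G' \<subseteq> max_nil_spaces" using psubset.prems(1) by (auto simp: G'_def)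
    moreover have "lf v ^ m * w P \<in> forms (m + K) \<and> lf v ^ m * w P \<notin> I \<and> nil_forms I (lf v ^ m * w P) = P"
      if "P \<in> G'" for P
      using nil_forms_power[of "w P" K v m] w[of P] that psubset.prems(1) by (auto simp: G'_def)
    moreover have "(\<Sum>P\<in>G'. Const (c P) * (lf v ^ m * w P)) \<in> I"
    proof -
      have A: "(\<Sum>P\<in>G - G'. Const (c P) * (lf v ^ m * w P)) \<in> I"
      proof (rule poly_ideal.subspace_sum[OF ideal])
        fix P assume "P \<in> G - G'"
        then have "lf v ^ m * w P \<in> I" using m by (auto simp: G'_def)
        then show "Const (c P) * (lf v ^ m * w P) \<in> I" by (rule ideal_mult[OF ideal])
      qed
      have "lf v ^ m * (\<Sum>P\<in>G. Const (c P) * w P) \<in> I"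
        by (rule ideal_mult[OF ideal psubset.prems(3)])
      then have B: "(\<Sum>P\<in>G. Const (c P) * (lf v ^ m * w P)) \<in> I"
        by (simp only: sum_distrib_left mult.left_commute)
      have "(\<Sum>P\<in>G. Const (c P) * (lf v ^ m * w P)) - (\<Sum>P\<in>G - G'. Const (c P) * (lf v ^ m * w P))
          = (\<Sum>P\<in>G'. Const (c P) * (lf v ^ m * w P))"
        using \<open>G' \<subset> G\<close> psubset.hyps by (subst sum.subset_diff[of G' G]) auto
      then show ?thesis using poly_ideal.subspace_diff[OF ideal B A] by (simp only:)
    qed
    moreover have "P1 \<in> G'" using v psubset.prems(4) by (simp add: G'_def)
    ultimately show ?thesis by (rule psubset.IH)
  qed
qed

lemma card_max_nil_spaces:
  assumes "finite G" "G \<subseteq> max_nil_spaces"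
  shows "card G \<le> r"
proof -
  have "\<exists>w k. w \<in> forms k \<and> w \<notin> I \<and> nil_forms I w = P" if "P \<in> G" for P
  proof -
    have "P \<in> nil_spaces" using that assms(2) unfolding max_nil_spaces_def by blast
    then show ?thesis unfolding nil_spaces_def by blast
  qed
  then obtain w k where wk: "w P \<in> forms (k P)" "w P \<notin> I" "nil_forms I (w P) = P" if "P \<in> G" for P
    by metis
  have "\<exists>v. v \<notin> P" if "P \<in> G" for P
    using nil_forms_proper[OF wk(2)[OF that]] wk(3)[OF that] by blast
  then obtain v where v: "v P \<notin> P" if "P \<in> G" for P by metis
  \<comment> \<open>Any common upper bound of the degrees would serve; the sum is one that also
    makes sense for empty \<open>G\<close>.\<close>
  define K where "K = (\<Sum>P\<in>G. k P)"
  define u where "u P = lf (v P) ^ (K - k P) * w P" for P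
  have u: "u P \<in> forms K \<and> u P \<notin> I \<and> nil_forms I (u P) = P" if "P \<in> G" for P
  proof -
    have "k P \<le> K" unfolding K_def using that assms(1) by (intro member_le_sum) auto
    then show ?thesis
      using nil_forms_power[of "w P" "k P" "v P" "K - k P"] wk[OF that] v[OF that] that assms(2)
      by (auto simp: u_def)
  qed
  obtain T where T: "finite T" "forms K = poly_space.span (T :: 'n mpoly set)"
    by (rule forms_finite_span)
  have "poly_space.dim (I \<inter> forms K) + card G \<le> poly_space.dim (forms K :: 'n mpoly set)"
  proof (rule dim_mod_subspace(1)[where w = u and T = T])
    show "poly_space.subspace (I \<inter> forms K)"
      by (intro poly_space.subspace_inter subspace_ideal ideal subspace_forms)
    show "\<forall>P\<in>G. c P = 0" if "(\<Sum>P\<in>G. Const (c P) * u P) \<in> I \<inter> forms K" for c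
      using max_nil_spaces_independent[OF assms, of u K c] u that by blast
  qed (use assms T u subspace_forms in auto)
  with bound[of K] show ?thesis by simp
qed

text \<open>Measure replaces the algebraic fact that finitely many proper subspaces cannot cover a
  complex vector space: a proper complex subspace has smaller real dimension and is a null
  set.\<close>

lemma negligible_proper_subspace:
  fixes P :: "(complex ^ 'n) set"
  assumes "vec.subspace P" "P \<noteq> UNIV"
  shows "negligible P"
proof (rule negligible_lowdim)
  have "subspace P"
  proof (rule subspaceI)
    fix c :: real and x assume "x \<in> P"
    have "c *\<^sub>R x = complex_of_real c *s x"
      unfolding vec_eq_iff vector_scaleR_component vector_smult_component
      by (simp add: scaleR_conv_of_real[of c "_ :: complex"])
    then show "c *\<^sub>R x \<in> P" using vec.subspace_scale[OF assms(1) \<open>x \<in> P\<close>] by simp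
  qed (use assms(1) in \<open>auto intro: vec.subspace_0 vec.subspace_add\<close>)
  then have "dim P \<noteq> DIM(complex ^ 'n)" using assms(2) dim_eq_full[of P] span_eq_iff[of P] by blast
  then show "dim P < DIM(complex ^ 'n)" using dim_subset_UNIV[of P] by simp
qed

lemma exists_linear_nonzerodivisor:
  "\<exists>q. \<forall>k. \<forall>\<psi>\<in>forms k. lf q * \<psi> \<in> I \<longrightarrow> \<psi> \<in> I"
proof (rule ccontr)
  assume contra: "\<not> ?thesis"
  have "finite max_nil_spaces"
  proof (rule ccontr)
    assume "infinite max_nil_spaces"
    then obtain G where "finite G" "card G = Suc r" "G \<subseteq> max_nil_spaces"
      using infinite_arbitrarily_large by blast
    then show False using card_max_nil_spaces[of G] by simp
  qed
  moreover have "negligible P" if "P \<in> max_nil_spaces" for P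
    using that subspace_nil_forms nil_forms_proper
    by (intro negligible_proper_subspace) (auto simp: max_nil_spaces_def nil_spaces_def)
  ultimately have "negligible (\<Union>max_nil_spaces)" by (intro negligible_Union) auto
  moreover have "\<Union>max_nil_spaces = UNIV"
  proof -
    have "q \<in> \<Union>max_nil_spaces" for q
    proof -
      obtain k \<psi> where \<psi>: "\<psi> \<in> forms k" "lf q * \<psi> \<in> I" "\<psi> \<notin> I" using contra by blast
      then have "q \<in> nil_forms I \<psi>" by (intro nil_formsI[of _ 1]) simp
      moreover have "nil_forms I \<psi> \<in> nil_spaces" using \<psi> by (auto simp: nil_spaces_def)
      ultimately show ?thesis using max_nil_space_above by blast
    qed
    then show ?thesis by blast
  qed
  ultimately show False using non_negligible_UNIV by simp
qed

end

lemma dim_forms_1: "poly_space.dim (forms (Suc 0) :: 'n::finite mpoly set) = CARD('n)"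
proof -
  \<comment> \<open>Here \<open>lf 0 ^ 0\<close> is 1, so the count for p^k S_1 also measures S_1
    itself.\<close>
  have "\<exists>v. \<psi> - lf 0 ^ 0 * lf v \<in> {0}" if "\<psi> \<in> forms (Suc 0)" for \<psi> :: "'n mpoly"
    using forms_1_eq_lf[of \<psi>] that by auto
  then show ?thesis
    using dim_power_lf(2)[of "{0}" 0 "0 :: complex ^ 'n"]
    by (auto simp: dim_zero_space)
qed

text \<open>In degree 1 the Hilbert function equals dim S_1, so J_1 = 0, and a nonzerodivisor q
  makes q^k S_1 meet J only in 0. As it is at most n+1 in every degree, q^k S_1 and J fill the whole
  degree.\<close>

lemma saturated_Hilb_split:
  fixes J :: "'n::finite mpoly set"
  assumes J: "J \<in> Hilb CARD('n)" and "saturated J"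
  shows "\<exists>q. split_family q (\<lambda>k. J \<inter> forms k)"
proof -
  have ideal: "poly_ideal.subspace J"
    using J by (auto simp: Hilb_def intro: homogeneous_ideal_subspace)
  have sub: "poly_space.subspace (J \<inter> forms k)" for k
    by (intro poly_space.subspace_inter subspace_ideal ideal subspace_forms)
  have "poly_space.dim (forms k :: 'n mpoly set) \<le> poly_space.dim (J \<inter> forms k) + CARD('n)" for k
    using dim_Hilb[OF J, of k] by linarith
  then obtain q where q: "\<psi> \<in> forms k \<Longrightarrow> lf q * \<psi> \<in> J \<Longrightarrow> \<psi> \<in> J" for k \<psi>
    using exists_linear_nonzerodivisor[OF ideal assms(2)] by blast
  have zero: "J \<inter> forms k = {0}" if "poly_space.dim (J \<inter> forms k) = 0" for k
    using subspace_dim_equal[of "{0}" "J \<inter> forms k" k] sub poly_space.subspace_0[OF sub] that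
    by (auto simp: dim_zero_space)
  have J0: "J \<inter> forms 0 = {0}"
  proof (rule zero)
    have "Suc 0 \<le> CARD('n)" by (simp add: Suc_le_eq)
    then show "poly_space.dim (J \<inter> forms 0) = 0" using dim_Hilb[OF J, of 0] by (simp add: dim_forms_0)
  qed
  have J1: "J \<inter> forms (Suc 0) = {0}"
    by (rule zero) (use dim_Hilb[OF J, of "Suc 0"] in \<open>simp add: dim_forms_1\<close>)
  have q': "\<psi> \<in> J" if "lf q ^ m * \<psi> \<in> J" "\<psi> \<in> forms k" for m k \<psi>
    using that
  proof (induction m)
    case (Suc m)
    have "lf q ^ m * \<psi> \<in> forms (m + k)" by (intro forms_mult forms_power lf_in_forms Suc.prems)
    moreover have "lf q * (lf q ^ m * \<psi>) \<in> J" using Suc.prems(1) by (simp only: power_Suc mult.assoc)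
    ultimately have "lf q ^ m * \<psi> \<in> J" by (rule q)
    then show ?case using Suc.IH Suc.prems(2) by blast
  qed simp
  have inj: "v = 0" if "lf q ^ k * lf v \<in> J \<inter> forms (Suc k)" for k v
  proof -
    have "lf v \<in> J \<inter> forms (Suc 0)" using q'[of k "lf v" "Suc 0"] that by simp
    with J1 show ?thesis by simp
  qed
  have spans: "\<exists>v. \<psi> - lf q ^ k * lf v \<in> J \<inter> forms (Suc k)" if "\<psi> \<in> forms (Suc k)" for k \<psi>
  proof -
    note * = dim_power_lf[where q = q, OF sub[of "Suc k"] Int_lower2 inj[of k]]
    have "poly_space.dim (J \<inter> forms (Suc k)) + CARD('n) = poly_space.dim (forms (Suc k) :: 'n mpoly set)"
      using *(1) dim_Hilb[OF J, of "Suc k"] by linarith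
    then show ?thesis using *(2) that by blast
  qed
  have "q \<noteq> 0"
  proof
    assume "q = 0"
    then have "lf q ^ 1 * lf (axis undefined 1 :: complex ^ 'n) \<in> J \<inter> forms (Suc 1)"
      using poly_space.subspace_0[OF sub] by simp
    from inj[OF this] show False by (simp add: axis_eq_0_iff)
  qed
  show ?thesis
    by (rule exI[of _ q], unfold split_family_def)
      (intro conjI allI ballI impI graded_family_ideal[OF ideal] \<open>q \<noteq> 0\<close> J0 spans inj)
qed

section \<open>Polynomial identities on secant varieties\<close>

definition power_sums :: "nat \<Rightarrow> nat \<Rightarrow> 'n::finite mpoly set" where
  "power_sums d r = {G \<in> forms d - {0}. \<exists>L. (\<forall>i<r. L i \<in> forms 1 - {0}) \<and>
     G \<in> poly_space.span ((\<lambda>i. L i ^ d) ` {..<r})}"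

lemma secant_variety_eq: "secant_variety d r = proj_closed d hull power_sums d r"
  by (simp add: secant_variety_def power_sums_def)

lemma power_sums_scale:
  assumes "G \<in> power_sums d r" "t \<noteq> 0"
  shows "Const t * G \<in> power_sums d r"
proof -
  have "Const t * G \<noteq> 0"
  proof
    assume "Const t * G = 0"
    then have "Const (inverse t) * (Const t * G) = Const (inverse t) * 0" by (simp only:)
    then have "Const (inverse t * t) * G = 0" by (simp only: Const_mult mult.assoc mult_zero_right)
    with assms show False by (simp add: power_sums_def)
  qed
  with assms(1) show ?thesis
    unfolding power_sums_def by (auto intro: forms_scale poly_space.span_scale)
qed

text \<open>\<open>proj_closed\<close> admits homogeneous equations only. The set of sums of powers
  is stable under nonzero scaling, so every homogeneous component of \<open>P\<close> vanishes on it
  too.\<close>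

lemma secant_variety_vanish:
  fixes F :: "'n::finite mpoly"
  assumes F: "F \<in> secant_variety d r"
    and P: "\<And>G :: 'n mpoly. G \<in> power_sums d r \<Longrightarrow> eval P (lookup G) = 0"
  shows "eval P (lookup F) = 0"
proof -
  define Z :: "'n mpoly set"
    where "Z = {G \<in> forms d - {0}. \<forall>p\<in>range (\<lambda>k. hcomp k P). eval p (lookup G) = 0}"
  have "proj_closed d Z"
    unfolding proj_closed_def Z_def
    by (intro exI[of _ "range (\<lambda>k. hcomp k P)"]) (use hcomp_in_forms in blast)
  moreover have "power_sums d r \<subseteq> Z"
  proof
    fix G :: "'n mpoly" assume G: "G \<in> power_sums d r"
    have "lookup (Const t * G) = (\<lambda>m. t * lookup G m)" for t by (rule ext) simp
    then have "eval P (\<lambda>m. t * lookup G m) = 0" if "t \<noteq> 0" for t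
      using P[OF power_sums_scale[OF G that]] by (simp only:)
    then have "eval (hcomp k P) (lookup G) = 0" for k by (rule eval_hcomp_eq_0)
    then show "G \<in> Z" using G by (auto simp: Z_def power_sums_def)
  qed
  ultimately have "F \<in> Z" using F unfolding secant_variety_eq hull_def by blast
  then have "eval (hcomp k P) (lookup F) = 0" for k by (auto simp: Z_def)
  then show ?thesis using eval_hcomp_expand[of P 1 "lookup F"] by simp
qed

lemma secant_variety_forms:
  fixes F :: "'n::finite mpoly"
  assumes "F \<in> secant_variety d r"
  shows "F \<in> forms d"
proof -
  have "proj_closed d (forms d - {0} :: 'n mpoly set)"
    unfolding proj_closed_def by (intro exI[of _ "{}"]) auto
  moreover have "power_sums d r \<subseteq> (forms d - {0} :: 'n mpoly set)" by (auto simp: power_sums_def)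
  ultimately show ?thesis using assms unfolding secant_variety_eq hull_def by blast
qed

text \<open>
  Regular functions on the principal open set \<open>D \<noteq> 0\<close> of the space of all polynomials \<open>G\<close>.
\<close>

definition regular :: "'n::finite monomial mpoly \<Rightarrow> ('n mpoly \<Rightarrow> complex) \<Rightarrow> bool" where
  "regular D f \<longleftrightarrow> (\<exists>P k. \<forall>G. eval D (lookup G) \<noteq> 0 \<longrightarrow>
     f G * eval D (lookup G) ^ k = eval P (lookup G))"

lemma regularI: "(\<And>G. eval D (lookup G) \<noteq> 0 \<Longrightarrow> f G * eval D (lookup G) ^ k = eval P (lookup G)) \<Longrightarrow> regular D f"
  unfolding regular_def by blast

lemma regular_const: "regular D (\<lambda>G. c)"
  by (rule regularI[where k = 0 and P = "Const c"]) simp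

lemma regular_lookup: "regular D (\<lambda>G. lookup G m)"
  by (rule regularI[where k = 0 and P = "Var m"]) simp

lemma regular_add:
  assumes "regular D f" "regular D g"
  shows "regular D (\<lambda>G. f G + g G)"
proof -
  obtain P k Q l where
    "\<And>G. eval D (lookup G) \<noteq> 0 \<Longrightarrow> f G * eval D (lookup G) ^ k = eval P (lookup G)"
    "\<And>G. eval D (lookup G) \<noteq> 0 \<Longrightarrow> g G * eval D (lookup G) ^ l = eval Q (lookup G)"
    using assms unfolding regular_def by metis
  note * = this[symmetric]
  show ?thesis
    by (rule regularI[where k = "k + l" and P = "P * D ^ l + Q * D ^ k"])
      (simp add: * power_add algebra_simps)
qed

lemma regular_mult:
  assumes "regular D f" "regular D g"
  shows "regular D (\<lambda>G. f G * g G)"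
proof -
  obtain P k Q l where
    "\<And>G. eval D (lookup G) \<noteq> 0 \<Longrightarrow> f G * eval D (lookup G) ^ k = eval P (lookup G)"
    "\<And>G. eval D (lookup G) \<noteq> 0 \<Longrightarrow> g G * eval D (lookup G) ^ l = eval Q (lookup G)"
    using assms unfolding regular_def by metis
  note * = this[symmetric]
  show ?thesis
    by (rule regularI[where k = "k + l" and P = "P * Q"]) (simp add: * power_add algebra_simps)
qed

lemma regular_divide:
  assumes "regular D f"
  shows "regular D (\<lambda>G. f G / eval D (lookup G))"
proof -
  obtain P k where
    *: "\<And>G. eval D (lookup G) \<noteq> 0 \<Longrightarrow> f G * eval D (lookup G) ^ k = eval P (lookup G)"
    using assms unfolding regular_def by metis
  show ?thesis
    by (rule regularI[where k = "Suc k" and P = P]) (simp flip: *)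
qed

lemma regular_sum: "(\<And>a. a \<in> A \<Longrightarrow> regular D (f a)) \<Longrightarrow> regular D (\<lambda>G. \<Sum>a\<in>A. f a G)"
  by (induction A rule: infinite_finite_induct) (auto intro: regular_const regular_add)

lemma regular_prod: "(\<And>a. a \<in> A \<Longrightarrow> regular D (f a)) \<Longrightarrow> regular D (\<lambda>G. \<Prod>a\<in>A. f a G)"
  by (induction A rule: infinite_finite_induct) (auto intro: regular_const regular_mult)

lemma regular_power: "regular D f \<Longrightarrow> regular D (\<lambda>G. f G ^ k)"
  by (induction k) (auto intro: regular_const regular_mult)

lemma regular_diff: "regular D f \<Longrightarrow> regular D g \<Longrightarrow> regular D (\<lambda>G. f G - g G)"
  using regular_add[of D f "\<lambda>G. (-1) * g G"] regular_mult[OF regular_const, of D g "-1"] by simp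

lemma regular_eval:
  assumes "\<And>i. regular D (f i)"
  shows "regular D (\<lambda>G. eval p (\<lambda>i. f i G))"
proof (induction p rule: mpoly_induct)
  case (single m c)
  show ?case
    unfolding eval_single mon_eval_def
    by (intro regular_mult regular_const regular_prod regular_power assms)
next
  case (add p q)
  then show ?case unfolding eval_add by (rule regular_add)
qed

lemma regular_det:
  assumes "\<And>i j. regular D (\<lambda>G. A G $ i $ j)"
  shows "regular D (\<lambda>G. det (A G))"
  unfolding det_def by (intro regular_sum regular_mult regular_const regular_prod assms)

lemma regular_apolar: "regular D (apolar \<psi>)"
proof (induction \<psi> rule: mpoly_induct)
  case (single m c)
  show ?case
    unfolding apolar_single[abs_def] by (intro regular_mult regular_const regular_lookup)
next
  case (add p q)
  then show ?case unfolding apolar_add_left[abs_def] by (rule regular_add)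
qed

text \<open>With D = 1 the closure rules for regular functions become closure rules for polynomials;
  this produces the polynomial for the determinant that later serves as D.\<close>

lemma regular_imp_polynomial:
  assumes "regular 1 f"
  shows "\<exists>P. \<forall>G. f G = eval P (lookup G)"
  using assms by (auto simp: regular_def)

lemma regular_vanish:
  fixes F :: "'n::finite mpoly"
  assumes "F \<in> secant_variety d r" "regular D f" "eval D (lookup F) \<noteq> 0"
    and zero: "\<And>G. G \<in> power_sums d r \<Longrightarrow> eval D (lookup G) \<noteq> 0 \<Longrightarrow> f G = 0"
  shows "f F = 0"
proof -
  obtain P k where
    *: "\<And>G. eval D (lookup G) \<noteq> 0 \<Longrightarrow> f G * eval D (lookup G) ^ k = eval P (lookup G)"
    using assms(2) unfolding regular_def by metis
  \<comment> \<open>The extra factor \<open>D\<close> makes the product vanish also at the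
    degenerate sums, about which \<open>zero\<close> says nothing.\<close>
  have "eval (P * D) (lookup G) = 0" if "G \<in> power_sums d r" for G
    using zero[OF that] *[of G] by auto
  then have "eval (P * D) (lookup F) = 0" by (rule secant_variety_vanish[OF assms(1)])
  with assms(3) *[of F] show ?thesis by auto
qed

section \<open>Reduction modulo a linear form\<close>

text \<open>
  If \<open>S\<^sub>k = p\<^sup>k\<^sup>-\<^sup>1 S\<^sub>1 \<oplus> J\<^sub>k\<close> with \<open>J\<close> contained in the annihilator, then multiplication by
  \<open>y\<^sub>k / p\<close> on \<open>S\<^sub>1\<close> modulo \<open>J\<close> is given by the inverse of the matrix \<open>gram\<close> times the matrix
  \<open>gram_Var\<close>. Cramer's rule is used so that \<open>reduce\<close> is visibly a regular function of \<open>F\<close>.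
\<close>

definition gram_Var :: "'n::finite mpoly \<Rightarrow> nat \<Rightarrow> complex ^ 'n \<Rightarrow> 'n \<Rightarrow> complex ^ 'n ^ 'n" where
  "gram_Var F d q k = (\<chi> i j. apolar (lf q ^ (d - 3) * (Var k * (Var i * Var j))) F)"

definition mult_step :: "'n::finite mpoly \<Rightarrow> nat \<Rightarrow> complex ^ 'n \<Rightarrow> 'n \<Rightarrow> complex ^ 'n \<Rightarrow> complex ^ 'n" where
  "mult_step F d q k v = (\<chi> l. det (\<chi> i j. if j = l then (gram_Var F d q k *v v) $ i
     else gram F d q $ i $ j) / det (gram F d q))"

text \<open>Fixes one order in which the variables of a monomial act. That the order is immaterial
  is not built in; it is a consequence of \<open>reduce_Var_mult\<close>.\<close>

definition mon_list :: "'n monomial \<Rightarrow> 'n list" where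
  "mon_list m = (SOME l. m = sum_list (map (\<lambda>i. single i 1) l))"

text \<open>The start value \<open>q\<close> reads 1 as p^(-1) p, so that in every degree k the form
  should be congruent to p^(k-1) times its reduction.\<close>

primrec reduce_list :: "'n::finite mpoly \<Rightarrow> nat \<Rightarrow> complex ^ 'n \<Rightarrow> 'n list \<Rightarrow> complex ^ 'n" where
  "reduce_list F d q [] = q"
| "reduce_list F d q (i # l) = mult_step F d q i (reduce_list F d q l)"

definition reduce :: "'n::finite mpoly \<Rightarrow> nat \<Rightarrow> complex ^ 'n \<Rightarrow> 'n mpoly \<Rightarrow> complex ^ 'n" where
  "reduce F d q \<psi> = (\<Sum>m\<in>keys \<psi>. lookup \<psi> m *s reduce_list F d q (mon_list m))"

lemma mon_list: "sum_list (map (\<lambda>i. single i 1) (mon_list m)) = m"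
proof -
  have "\<exists>l. m = sum_list (map (\<lambda>i. single i 1) l)" if "mon_degree m = k" for k
    using that
  proof (induction k arbitrary: m)
    case 0
    then have "m = sum_list (map (\<lambda>i. single i 1) [])" by (simp add: mon_degree_eq_0_iff)
    then show ?case by blast
  next
    case (Suc k)
    obtain i m' where m: "m = single i 1 + m'" "mon_degree m' = k"
      by (rule mon_degree_1_cases[OF Suc.prems])
    from Suc.IH[OF m(2)] obtain l where "m' = sum_list (map (\<lambda>i. single i 1) l)" by blast
    with m have "m = sum_list (map (\<lambda>i. single i 1) (i # l))" by simp
    then show ?case by blast
  qed
  then show ?thesis unfolding mon_list_def by (rule someI2_ex[OF _ sym]) simp_all
qed

lemma mon_list_0 [simp]: "mon_list 0 = []"
proof -
  have "length l = mon_degree (sum_list (map (\<lambda>i. single i 1) l))" for l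
    by (induction l) (simp_all add: mon_degree_add)
  from this[of "mon_list 0"] show ?thesis by (simp only: mon_list) simp
qed

lemma gram_Var_mult_vec:
  "(gram_Var F d q k *v w) $ i = apolar (lf q ^ (d - 3) * (Var k * (Var i * lf w))) F"
proof -
  have *: "lf q ^ (d - 3) * (Var k * (Var i * lf w))
      = (\<Sum>j\<in>UNIV. Const (w $ j) * (lf q ^ (d - 3) * (Var k * (Var i * Var j))))"
    by (simp only: lf_def[of w] sum_distrib_left mult_ac)
  have "(gram_Var F d q k *v w) $ i
      = (\<Sum>j\<in>UNIV. w $ j * apolar (lf q ^ (d - 3) * (Var k * (Var i * Var j))) F)"
    unfolding gram_Var_def matrix_vector_mult_def vec_lambda_beta by (simp only: mult.commute)
  then show ?thesis by (simp only: * apolar_sum_left apolar_scale_left)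
qed

lemma matrix_vector_mult_sum: "A *v (\<Sum>i\<in>I. f i) = (\<Sum>i\<in>I. A *v f i)"
  by (induction I rule: infinite_finite_induct) (simp_all add: matrix_vector_right_distrib)

lemma reduce_superset:
  assumes "finite A" "keys \<psi> \<subseteq> A"
  shows "reduce F d q \<psi> = (\<Sum>m\<in>A. lookup \<psi> m *s reduce_list F d q (mon_list m))"
  unfolding reduce_def using assms by (intro sum.mono_neutral_left) (auto simp: in_keys_iff)

lemma reduce_add: "reduce F d q (\<psi> + \<phi>) = reduce F d q \<psi> + reduce F d q \<phi>"
  using reduce_superset[of "keys \<psi> \<union> keys \<phi>" _ F d q] keys_add[of \<psi> \<phi>]
  by (simp add: lookup_add vector_sadd_rdistrib sum.distrib)

lemma reduce_single: "reduce F d q (single m c) = c *s reduce_list F d q (mon_list m)"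
  using reduce_superset[of "{m}" "single m c" F d q] by (simp split: if_splits)

lemma reduce_0 [simp]: "reduce F d q 0 = 0"
  by (simp add: reduce_def)

lemma reduce_scale: "reduce F d q (Const c * \<psi>) = c *s reduce F d q \<psi>"
  by (induction \<psi> rule: mpoly_induct)
    (simp_all add: Const_mult_single reduce_single distrib_left reduce_add vector_smult_assoc
      vector_add_ldistrib)

lemma reduce_diff: "reduce F d q (\<psi> - \<phi>) = reduce F d q \<psi> - reduce F d q \<phi>"
  using reduce_add[of F d q "\<psi> - \<phi>" \<phi>] by simp

lemma reduce_sum: "reduce F d q (sum f A) = (\<Sum>a\<in>A. reduce F d q (f a))"
  by (induction A rule: infinite_finite_induct) (simp_all add: reduce_add)

context
  fixes F :: "'n::finite mpoly" and d :: nat and q :: "complex ^ 'n"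
  assumes nondeg: "det (gram F d q) \<noteq> 0" and d3: "d \<ge> 3"
begin

lemma gram_inj: "gram F d q *v v = gram F d q *v w \<Longrightarrow> v = w"
  using nondeg invertible_det_nz invertible_left_inverse matrix_left_invertible_injective
  by (metis injD)

text \<open>Row i says that y_k v and p u, with u = \<open>mult_step F d q k v\<close>, have the
  same pairing with \<open>F\<close> after multiplication by p^(d-3) y_i.\<close>

lemma gram_mult_step: "gram F d q *v mult_step F d q k v = gram_Var F d q k *v v"
  using cramer[OF nondeg, of "mult_step F d q k v" "gram_Var F d q k *v v"]
  by (simp add: mult_step_def)

lemma mult_step_0 [simp]: "mult_step F d q k 0 = 0"
  by (rule gram_inj) (simp add: gram_mult_step)

lemma power_lf_Suc: "lf q ^ (d - 2) = lf q ^ (d - 3) * lf q"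
proof -
  have "d - 2 = Suc (d - 3)" using d3 by simp
  then show ?thesis by (simp only: power_Suc mult.commute)
qed

text \<open>Division of y_k p by p: the two right-hand sides are the same product.\<close>

lemma mult_step_q: "mult_step F d q k q = axis k 1"
proof (rule gram_inj, unfold gram_mult_step vec_eq_iff gram_Var_mult_vec gram_mult_vec, rule allI)
  fix i
  show "apolar (lf q ^ (d - 3) * (Var k * (Var i * lf q))) F
      = apolar (lf q ^ (d - 2) * (Var i * lf (axis k 1))) F"
    by (simp only: lf_axis power_lf_Suc mult_ac)
qed

text \<open>Since p is the sum of the q_k y_k, the corresponding sum of the operators y_k/p is p/p,
  the identity.\<close>

lemma sum_mult_step: "(\<Sum>k\<in>UNIV. q $ k *s mult_step F d q k v) = v"
proof (rule gram_inj, unfold vec_eq_iff, rule allI)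
  fix i
  have "gram F d q *v (\<Sum>k\<in>UNIV. q $ k *s mult_step F d q k v)
      = (\<Sum>k\<in>UNIV. q $ k *s (gram_Var F d q k *v v))"
    by (simp only: matrix_vector_mult_sum vector_scalar_commute gram_mult_step)
  then have "(gram F d q *v (\<Sum>k\<in>UNIV. q $ k *s mult_step F d q k v)) $ i
      = (\<Sum>k\<in>UNIV. q $ k * apolar (lf q ^ (d - 3) * (Var k * (Var i * lf v))) F)"
    by (simp only: sum_component vector_smult_component gram_Var_mult_vec)
  also have "\<dots> = apolar (lf q ^ (d - 3) * (lf q * (Var i * lf v))) F"
  proof -
    have "lf q ^ (d - 3) * (lf q * (Var i * lf v))
        = (\<Sum>k\<in>UNIV. Const (q $ k) * (lf q ^ (d - 3) * (Var k * (Var i * lf v))))"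
      by (subst (2) lf_def) (simp only: sum_distrib_left sum_distrib_right mult_ac)
    then show ?thesis by (simp only: apolar_sum_left apolar_scale_left)
  qed
  also have "\<dots> = (gram F d q *v v) $ i"
    by (simp only: gram_mult_vec power_lf_Suc mult.assoc)
  finally show "(gram F d q *v (\<Sum>k\<in>UNIV. q $ k *s mult_step F d q k v)) $ i
      = (gram F d q *v v) $ i" .
qed

lemma q_nonzero: "q \<noteq> 0"
proof
  assume "q = 0"
  then have "axis undefined 1 = (0 :: complex ^ 'n)"
    using sum_mult_step[of "axis undefined 1"] by simp
  then show False by (simp add: axis_eq_0_iff)
qed

end

lemma regular_gram: "regular D (\<lambda>G. gram G d q $ i $ j)"
  unfolding gram_def vec_lambda_beta by (rule regular_apolar)

lemma det_gram_polynomial: "\<exists>D. \<forall>G. eval D (lookup G) = det (gram G d q)"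
  using regular_imp_polynomial[OF regular_det[OF regular_gram]] by metis

context
  fixes D :: "'n::finite monomial mpoly" and d :: nat and q :: "complex ^ 'n"
  assumes D: "\<And>G. eval D (lookup G) = det (gram G d q)"
begin

lemma regular_mult_step:
  assumes "\<And>i. regular D (\<lambda>G. v G $ i)"
  shows "regular D (\<lambda>G. mult_step G d q k (v G) $ l)"
proof -
  have "regular D (\<lambda>G. (gram_Var G d q k *v v G) $ i)" for i
    unfolding matrix_vector_mult_def gram_Var_def vec_lambda_beta
    by (intro regular_sum regular_mult regular_apolar assms)
  then have "regular D (\<lambda>G. (\<chi> i j. if j = l then (gram_Var G d q k *v v G) $ i
     else gram G d q $ i $ j) $ i $ j)" for i j
    unfolding vec_lambda_beta by (cases "j = l") (simp_all add: regular_gram)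
  then have "regular D (\<lambda>G. det (\<chi> i j. if j = l then (gram_Var G d q k *v v G) $ i
     else gram G d q $ i $ j) / eval D (lookup G))"
    by (intro regular_divide regular_det)
  then show ?thesis unfolding mult_step_def vec_lambda_beta D .
qed

lemma regular_reduce: "regular D (\<lambda>G. reduce G d q \<psi> $ i)"
proof -
  have "regular D (\<lambda>G. reduce_list G d q l $ i)" for l i
  proof (induction l arbitrary: i)
    case Nil
    show ?case by (simp add: regular_const)
  next
    case (Cons k l)
    then show ?case unfolding reduce_list.simps by (rule regular_mult_step)
  qed
  then show ?thesis
    unfolding reduce_def sum_component vector_smult_component
    by (intro regular_sum regular_mult regular_const)
qed

end

section \<open>Forms that are sums of powers of independent linear forms\<close>

text \<open>Indexing the n+1 powers by the type of the variables turns the points \<open>a i\<close>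
  into the rows of a square matrix.\<close>

lemma power_sums_CARD:
  fixes G :: "'n::finite mpoly"
  assumes "G \<in> power_sums d CARD('n)"
  shows "\<exists>c a. G = (\<Sum>i\<in>(UNIV :: 'n set). Const (c i) * lf (a i) ^ d)"
proof -
  obtain L where L: "\<And>i. i < CARD('n) \<Longrightarrow> L i \<in> forms 1"
    "G \<in> poly_space.span ((\<lambda>i. L i ^ d) ` {..<CARD('n)})"
    using assms by (auto simp: power_sums_def)
  obtain h where h: "bij_betw h (UNIV :: 'n set) {..<CARD('n)}"
    using finite_same_card_bij[of "UNIV :: 'n set" "{..<CARD('n)}"] by auto
  have "\<exists>v. L (h i) = lf v" for i
    using forms_1_eq_lf[OF L(1)] bij_betwE[OF h] by blast
  then obtain a where a: "L (h i) = lf (a i)" for i by metis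
  define S where "S = (\<lambda>c :: 'n \<Rightarrow> complex. \<Sum>i\<in>UNIV. Const (c i) * lf (a i) ^ d)"
  have "poly_space.span ((\<lambda>i. L i ^ d) ` {..<CARD('n)}) \<subseteq> range S"
  proof (rule poly_space.span_minimal)
    show "(\<lambda>i. L i ^ d) ` {..<CARD('n)} \<subseteq> range S"
    proof
      fix x assume "x \<in> (\<lambda>i. L i ^ d) ` {..<CARD('n)}"
      then obtain k where k: "k \<in> {..<CARD('n)}" "x = L k ^ d" by blast
      from k(1) have "k \<in> range h" unfolding bij_betw_imp_surj_on[OF h] .
      then obtain j where "k = h j" by blast
      with k have "x = lf (a j) ^ d" by (simp only: a)
      also have "\<dots> = (\<Sum>i\<in>UNIV. if i = j then lf (a i) ^ d else 0)" by simp
      also have "\<dots> = S (\<lambda>i. if i = j then 1 else 0)"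
        unfolding S_def by (rule sum.cong) simp_all
      finally show "x \<in> range S" by simp
    qed
    show "poly_space.subspace (range S)"
    proof (rule poly_space.subspaceI)
      have "S (\<lambda>_. 0) = 0" by (simp add: S_def)
      then show "0 \<in> range S" by (metis rangeI)
      show "x + y \<in> range S" if xy: "x \<in> range S" "y \<in> range S" for x y
      proof -
        obtain b c where "x = S b" "y = S c" using xy by blast
        moreover have "S b + S c = S (\<lambda>i. b i + c i)" for b c
          by (simp only: S_def Const_add distrib_right sum.distrib)
        ultimately show ?thesis by simp
      qed
      show "Const t * x \<in> range S" if x: "x \<in> range S" for t x
      proof -
        obtain c where "x = S c" using x by blast
        moreover have "Const t * S c = S (\<lambda>i. t * c i)" for c
          by (simp only: S_def Const_mult sum_distrib_left mult.assoc)
        ultimately show ?thesis by simp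
      qed
    qed
  qed
  then obtain c where "G = S c" using L(2) by blast
  then show ?thesis unfolding S_def by blast
qed

context
  fixes d :: nat and q :: "complex ^ 'n::finite" and c :: "'n \<Rightarrow> complex" and a :: "'n \<Rightarrow> complex ^ 'n"
    and G :: "'n mpoly"
  assumes G: "G = (\<Sum>i\<in>UNIV. Const (c i) * lf (a i) ^ d)"
    and nondeg: "det (gram G d q) \<noteq> 0" and d3: "d \<ge> 3"
begin

abbreviation at_pt :: "'n mpoly \<Rightarrow> 'n \<Rightarrow> complex" where
  "at_pt f i \<equiv> eval f (($) (a i))"

lemma apolar_power_sum:
  "\<psi> \<in> forms d \<Longrightarrow> apolar \<psi> G = (\<Sum>i\<in>UNIV. c i * (fact d * at_pt \<psi> i))"
  by (simp only: G apolar_sum_right apolar_scale_right apolar_lf_power)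

lemma gram_forms: "lf q ^ (d - 2) * (Var i * lf v) \<in> forms d"
  "lf q ^ (d - 3) * (Var k * (Var i * lf v)) \<in> forms d"
proof -
  have d: "(d - 2) + (1 + 1) = d" "(d - 3) + (1 + (1 + 1)) = d" using d3 by auto
  show "lf q ^ (d - 2) * (Var i * lf v) \<in> forms d"
    by (rule forms_mult[where j = "d - 2" and k = "1 + 1", unfolded d])
      (intro forms_mult forms_power Var_in_forms lf_in_forms)+
  show "lf q ^ (d - 3) * (Var k * (Var i * lf v)) \<in> forms d"
    by (rule forms_mult[where j = "d - 3" and k = "1 + (1 + 1)", unfolded d])
      (intro forms_mult forms_power Var_in_forms lf_in_forms)+
qed

text \<open>Thus \<open>gram\<close> factors as A^T E A, where A has the rows \<open>a i\<close> and
  E is diagonal with entries d! c_i p(a_i)^(d-2). Nondegeneracy passes to A and to E.\<close>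

lemma gram_power_sum:
  "(gram G d q *v v) $ l = (\<Sum>i\<in>UNIV. c i * (fact d * (at_pt (lf q) i ^ (d - 2) * (a i $ l * at_pt (lf v) i))))"
  by (simp only: gram_mult_vec apolar_power_sum[OF gram_forms(1)] eval_mult eval_power eval_Var)

lemma lf_vanish_imp:
  assumes "\<And>i. at_pt (lf v) i = 0"
  shows "v = 0"
proof (rule gram_inj[OF nondeg d3])
  show "gram G d q *v v = gram G d q *v 0"
    unfolding vec_eq_iff gram_power_sum by (simp add: assms)
qed

lemma lf_eqI: "(\<And>i. at_pt (lf v) i = at_pt (lf w) i) \<Longrightarrow> v = w"
  using lf_vanish_imp[of "v - w"] by (simp add: lf_diff)

text \<open>The matrix of points is injective by \<open>lf_vanish_imp\<close>, hence invertible, and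
  the columns of its inverse are the dual basis.\<close>

lemma dual_basis: "\<exists>e. \<forall>i j. at_pt (lf (e i)) j = (if i = j then 1 else 0)"
proof -
  let ?A = "(\<chi> i. a i) :: complex ^ 'n ^ 'n"
  have A: "(?A *v v) $ i = at_pt (lf v) i" for v i
    by (simp add: matrix_vector_mult_def eval_lf mult.commute)
  have "\<And>v. ?A *v v = 0 \<Longrightarrow> v = 0"
    using lf_vanish_imp A by (metis zero_index)
  then have "\<exists>B. B ** ?A = mat 1" using matrix_left_invertible_ker by blast
  then obtain B where "?A ** B = mat 1" using matrix_left_right_inverse by blast
  then have "?A *v (B *v x) = x" for x by (simp add: matrix_vector_mul_assoc)
  then have "at_pt (lf (B *v axis i 1)) j = axis i 1 $ j" for i j using A by metis
  then show ?thesis by (intro exI[of _ "\<lambda>i. B *v axis i 1"]) (auto simp: axis_def)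
qed

text \<open>Applied to the dual vector \<open>e i\<close>, only the i-th summand of the Gram matrix
  survives; if it vanished, \<open>e i\<close> would be in the kernel.\<close>

lemma coeff_nonzero: "c i \<noteq> 0" and q_at_pt_nonzero: "at_pt (lf q) i \<noteq> 0"
proof -
  obtain e where e: "\<And>i j. at_pt (lf (e i)) j = (if i = j then 1 else 0)" using dual_basis by blast
  have "c i * at_pt (lf q) i \<noteq> 0"
  proof
    assume *: "c i * at_pt (lf q) i = 0"
    have z: "c j * (fact d * (at_pt (lf q) j ^ (d - 2) * (a j $ l * at_pt (lf (e i)) j))) = 0" for l j
    proof (cases "i = j")
      case True
      \<comment> \<open>The exponent d - 2 is positive, so p(a_i) = 0 makes the power vanish as
        well.\<close>
      with * d3 show ?thesis by auto
    qed (simp add: e)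
    have "gram G d q *v e i = 0"
      unfolding vec_eq_iff gram_power_sum zero_index by (intro allI sum.neutral ballI z)
    then have "gram G d q *v e i = gram G d q *v 0" by simp
    then have "e i = 0" by (rule gram_inj[OF nondeg d3])
    with e[of i i] show False by simp
  qed
  then show "c i \<noteq> 0" "at_pt (lf q) i \<noteq> 0" by auto
qed

text \<open>At each point the operator is multiplication by y_k/p. Pairing its defining equation
  with \<open>e i\<close> isolates the i-th summand, whose factor c_i d! p(a_i)^(d-3) can be
  cancelled.\<close>

lemma mult_step_at_pt: "at_pt (lf q) i * at_pt (lf (mult_step G d q k v)) i = a i $ k * at_pt (lf v) i"
proof -
  obtain e where e: "\<And>i j. at_pt (lf (e i)) j = (if i = j then 1 else 0)" using dual_basis by blast
  let ?u = "mult_step G d q k v"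
  let ?q = "at_pt (lf q)"
  have "(gram G d q *v ?u) $ l = (gram_Var G d q k *v v) $ l" for l
    by (simp only: gram_mult_step[OF nondeg d3])
  then have "(\<Sum>l\<in>UNIV. e i $ l * (gram G d q *v ?u) $ l) = (\<Sum>l\<in>UNIV. e i $ l * (gram_Var G d q k *v v) $ l)"
    by simp
  moreover have "(\<Sum>l\<in>UNIV. e i $ l * (gram G d q *v ?u) $ l)
      = (\<Sum>j\<in>UNIV. c j * (fact d * (?q j ^ (d - 2) * (at_pt (lf (e i)) j * at_pt (lf ?u) j))))"
  proof -
    have "(\<Sum>l\<in>UNIV. e i $ l * (gram G d q *v ?u) $ l)
      = (\<Sum>l\<in>UNIV. \<Sum>j\<in>UNIV. e i $ l * (c j * (fact d * (?q j ^ (d - 2) * (a j $ l * at_pt (lf ?u) j)))))"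
      by (simp only: gram_power_sum sum_distrib_left)
    also have "\<dots> = (\<Sum>j\<in>UNIV. \<Sum>l\<in>UNIV. e i $ l * (c j * (fact d * (?q j ^ (d - 2) * (a j $ l * at_pt (lf ?u) j)))))"
      by (rule sum.swap)
    finally show ?thesis
      by (simp only: eval_lf[of "e i"] sum_distrib_left sum_distrib_right mult_ac)
  qed
  moreover have "(\<Sum>l\<in>UNIV. e i $ l * (gram_Var G d q k *v v) $ l)
      = (\<Sum>j\<in>UNIV. c j * (fact d * (?q j ^ (d - 3) * (a j $ k * (at_pt (lf (e i)) j * at_pt (lf v) j)))))"
  proof -
    have "(\<Sum>l\<in>UNIV. e i $ l * (gram_Var G d q k *v v) $ l)
      = (\<Sum>l\<in>UNIV. \<Sum>j\<in>UNIV. e i $ l * (c j * (fact d * (?q j ^ (d - 3) * (a j $ k * (a j $ l * at_pt (lf v) j))))))"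
      by (simp only: gram_Var_mult_vec apolar_power_sum[OF gram_forms(2)] eval_mult eval_power
          eval_Var sum_distrib_left)
    also have "\<dots> = (\<Sum>j\<in>UNIV. \<Sum>l\<in>UNIV. e i $ l * (c j * (fact d * (?q j ^ (d - 3) * (a j $ k * (a j $ l * at_pt (lf v) j))))))"
      by (rule sum.swap)
    finally show ?thesis
      by (simp only: eval_lf[of "e i"] sum_distrib_left sum_distrib_right mult_ac)
  qed
  ultimately have "c i * (fact d * (?q i ^ (d - 2) * at_pt (lf ?u) i))
      = c i * (fact d * (?q i ^ (d - 3) * (a i $ k * at_pt (lf v) i)))"
    by (simp add: e if_distrib[of "\<lambda>x. _ * x"] if_distrib[of "\<lambda>x. x * _"] cong: if_cong)
  moreover have "?q i ^ (d - 2) = ?q i ^ (d - 3) * ?q i"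
  proof -
    have "d - 2 = Suc (d - 3)" using d3 by simp
    then show ?thesis by (simp only: power_Suc mult.commute)
  qed
  ultimately show ?thesis
    using coeff_nonzero[of i] q_at_pt_nonzero[of i] by simp
qed

text \<open>One more factor p on each side avoids the exponent k-1, so that degree 0 can start the
  inductions.\<close>

lemma reduce_at_pt_aux:
  assumes "\<psi> \<in> forms k"
  shows "at_pt (lf q) i ^ k * at_pt (lf (reduce G d q \<psi>)) i = at_pt (lf q) i * at_pt \<psi> i"
proof -
  have "at_pt (lf q) i ^ length l * at_pt (lf (reduce_list G d q l)) i
      = at_pt (lf q) i * mon_eval (sum_list (map (\<lambda>i. single i 1) l)) (($) (a i))" for l
  proof (induction l)
    case (Cons k l)
    have "at_pt (lf q) i ^ length (k # l) * at_pt (lf (reduce_list G d q (k # l))) i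
        = at_pt (lf q) i ^ length l * (at_pt (lf q) i * at_pt (lf (mult_step G d q k (reduce_list G d q l))) i)"
      by (simp only: list.size power_Suc reduce_list.simps mult_ac add_Suc_right add_0_right)
    also have "\<dots> = a i $ k * (at_pt (lf q) i ^ length l * at_pt (lf (reduce_list G d q l)) i)"
      by (simp only: mult_step_at_pt mult_ac)
    also have "\<dots> = at_pt (lf q) i * mon_eval (sum_list (map (\<lambda>i. single i 1) (k # l))) (($) (a i))"
      unfolding Cons by (simp add: mon_eval_add mon_eval_def[of "single k _"])
    finally show ?case .
  qed simp
  from this[of "mon_list _"] have *: "at_pt (lf q) i ^ length (mon_list m) * at_pt (lf (reduce_list G d q (mon_list m))) i
      = at_pt (lf q) i * mon_eval m (($) (a i))" for m
    unfolding mon_list .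
  have len: "length (mon_list m) = mon_degree m" for m :: "'n monomial"
  proof -
    have "length l = mon_degree (sum_list (map (\<lambda>i. single i 1) l))" for l :: "'n list"
      by (induction l) (simp_all add: mon_degree_add)
    from this[of "mon_list m"] show ?thesis by (simp only: mon_list)
  qed
  show ?thesis using assms
  proof (induction \<psi> rule: forms_induct)
    case (single m e)
    have "at_pt (lf (reduce G d q (single m e))) i = e * at_pt (lf (reduce_list G d q (mon_list m))) i"
      by (simp add: reduce_single lf_scale)
    then show ?case using *[of m] single by (simp add: len)
  qed (simp_all add: reduce_add lf_add distrib_left)
qed

lemma reduce_at_pt:
  "\<psi> \<in> forms (Suc k) \<Longrightarrow> at_pt (lf q ^ k * lf (reduce G d q \<psi>)) i = at_pt \<psi> i"
  using reduce_at_pt_aux[of \<psi> "Suc k" i] q_at_pt_nonzero[of i] by simp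

text \<open>A linear form is determined by its values at the n+1 points, and both sides have the
  value p^(-k) y_j \<psi> there.\<close>

lemma reduce_Var_mult_power_sum:
  assumes "\<psi> \<in> forms k"
  shows "reduce G d q (Var j * \<psi>) = mult_step G d q j (reduce G d q \<psi>)"
proof (rule lf_eqI)
  fix i
  let ?q = "at_pt (lf q) i"
  have "?q ^ Suc k * at_pt (lf (reduce G d q (Var j * \<psi>))) i = ?q * (a i $ j * at_pt \<psi> i)"
    by (simp only: reduce_at_pt_aux[OF Var_mult_forms[OF assms]] eval_mult eval_Var)
  also have "\<dots> = a i $ j * (?q ^ k * at_pt (lf (reduce G d q \<psi>)) i)"
    by (simp only: reduce_at_pt_aux[OF assms] mult_ac)
  also have "\<dots> = ?q ^ k * (?q * at_pt (lf (mult_step G d q j (reduce G d q \<psi>))) i)"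
    by (simp only: mult_step_at_pt mult_ac)
  also have "\<dots> = ?q ^ Suc k * at_pt (lf (mult_step G d q j (reduce G d q \<psi>))) i"
    by (simp only: power_Suc mult_ac)
  finally show "at_pt (lf (reduce G d q (Var j * \<psi>))) i = at_pt (lf (mult_step G d q j (reduce G d q \<psi>))) i"
    using q_at_pt_nonzero[of i] by (metis mult_left_cancel power_not_zero)
qed

text \<open>The pairing with a sum of powers sees only the values at the points, which the reduction
  preserves.\<close>

lemma apolar_reduce_power_sum:
  assumes "\<psi> \<in> forms d"
  shows "apolar \<psi> G = apolar (lf q ^ (d - 1) * lf (reduce G d q \<psi>)) G"
proof -
  have d: "d = Suc (d - 1)" using d3 by simp
  have "lf q ^ (d - 1) * lf (reduce G d q \<psi>) \<in> forms d"
    using power_lf_in_forms d by metis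
  moreover have "at_pt (lf q ^ (d - 1) * lf (reduce G d q \<psi>)) i = at_pt \<psi> i" for i
    using reduce_at_pt assms d by metis
  ultimately show ?thesis using assms by (simp only: apolar_power_sum)
qed

definition vanishing_forms :: "nat \<Rightarrow> 'n mpoly set" where
  "vanishing_forms k = {f \<in> forms k. \<forall>i. at_pt f i = 0}"

lemma split_vanishing_forms: "split_family q vanishing_forms"
  unfolding split_family_def
proof (intro conjI allI ballI impI)
  show "graded_family vanishing_forms"
    unfolding graded_family_def vanishing_forms_def
    by (auto intro!: poly_space.subspaceI forms_add forms_scale Var_mult_forms)
  show "q \<noteq> 0" by (rule q_nonzero[OF nondeg d3])
  have "f = 0" if "f \<in> forms 0" "at_pt f undefined = 0" for f
    using that forms_0_eq_Const[of f] eval_0_eq_lookup[of f] by (metis Const_0)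
  then show "vanishing_forms 0 = {0}" by (auto simp: vanishing_forms_def)
next
  fix k \<psi> assume \<psi>: "\<psi> \<in> (forms (Suc k) :: 'n mpoly set)"
  have "\<psi> - lf q ^ k * lf (reduce G d q \<psi>) \<in> forms (Suc k)"
    by (intro forms_diff power_lf_in_forms \<psi>)
  moreover have "at_pt (\<psi> - lf q ^ k * lf (reduce G d q \<psi>)) i = 0" for i
    unfolding eval_diff reduce_at_pt[OF \<psi>] by simp
  ultimately have "\<psi> - lf q ^ k * lf (reduce G d q \<psi>) \<in> vanishing_forms (Suc k)"
    unfolding vanishing_forms_def by blast
  then show "\<exists>v. \<psi> - lf q ^ k * lf v \<in> vanishing_forms (Suc k)" by blast
next
  fix k v assume "lf q ^ k * lf v \<in> vanishing_forms (Suc k)"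
  then have "at_pt (lf q) i ^ k * at_pt (lf v) i = 0" for i by (simp add: vanishing_forms_def)
  then show "v = 0" using q_at_pt_nonzero by (intro lf_vanish_imp) simp
qed

lemma vanishing_ideal: "graded_ideal vanishing_forms = points_ideal (range a)"
proof -
  have "graded_family vanishing_forms" using split_vanishing_forms by (simp add: split_family_def)
  then have "graded_ideal vanishing_forms = poly_ideal.span (\<Union>k. vanishing_forms k)"
    by (rule graded_ideal_eq_span)
  also have "(\<Union>k. vanishing_forms k) = {f. (\<exists>k. f \<in> forms k) \<and> (\<forall>a\<in>range a. eval f (($) a) = 0)}"
    by (auto simp: vanishing_forms_def)
  finally show ?thesis by (simp only: points_ideal_def)
qed

lemma distinct_points_range: "distinct_points CARD('n) (range a)"
proof -
  obtain e where e: "\<And>i j. at_pt (lf (e i)) j = (if i = j then 1 else 0)" using dual_basis by blast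
  have inj: "inj a" by (rule injI) (metis e zero_neq_one)
  have zero: "0 \<notin> range a"
  proof
    assume "0 \<in> range a"
    then obtain i where "a i = 0" by auto
    then have "at_pt (lf (e i)) i = 0" by (simp add: eval_lf)
    with e show False by simp
  qed
  have sep: "i = j" if "a j = s *s a i" for i j s
  proof (rule ccontr)
    assume "i \<noteq> j"
    have "at_pt (lf (e j)) j = s * at_pt (lf (e j)) i"
      by (simp add: eval_lf that sum_distrib_left mult_ac)
    with \<open>i \<noteq> j\<close> e show False by simp
  qed
  have multiple: "y = x" if xy: "x \<in> range a" "y \<in> range a" "y = s *s x" for x y s
  proof -
    obtain i j where "x = a i" "y = a j" using xy by blast
    with xy(3) sep show ?thesis by metis
  qed
  show ?thesis
    unfolding distinct_points_def
    by (intro conjI ballI allI impI finite_imageI finite_class.finite_UNIV card_image[OF inj] zero)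
      (rule multiple)
qed

end

section \<open>The limit ideal\<close>

lemma scalars_zero_of_independent:
  fixes w :: "nat \<Rightarrow> 'i mpoly"
  assumes "inj_on w I" "poly_space.independent (w ` I)" "finite I"
    and "(\<Sum>j\<in>I. Const (c j) * w j) = 0" "j \<in> I"
  shows "c j = 0"
proof -
  let ?u = "\<lambda>x. c (inv_into I w x)"
  have "(\<Sum>x\<in>w ` I. Const (?u x) * x) = (\<Sum>j\<in>I. Const (?u (w j)) * w j)"
    using sum.reindex[OF assms(1)] by simp
  also have "\<dots> = (\<Sum>j\<in>I. Const (c j) * w j)"
    by (rule sum.cong) (simp_all only: inv_into_f_f[OF assms(1)])
  finally have "(\<Sum>x\<in>w ` I. Const (?u x) * x) = 0" using assms(4) by (simp only:)
  then have "?u (w j) = 0"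
    using poly_space.independentD[OF assms(2), of "w ` I" ?u "w j"] assms(3,5) by blast
  then show ?thesis by (simp only: inv_into_f_f[OF assms(1,5)])
qed

text \<open>Spanning comes first, from the dimension count. The image then has at least
  \<open>s\<close> elements, which gives injectivity, and only then can independence be passed from
  the indexed family to its image.\<close>

lemma family_basis:
  fixes w :: "nat \<Rightarrow> 'n::finite mpoly"
  assumes W: "poly_space.subspace W" "W \<subseteq> forms k" "\<And>j. j < s \<Longrightarrow> w j \<in> W" "s = poly_space.dim W"
    and ind: "\<And>c. (\<Sum>j<s. Const (c j) * w j) = 0 \<Longrightarrow> \<forall>j<s. c j = 0"
  shows "inj_on w {..<s}" "poly_space.independent (w ` {..<s})" "poly_space.span (w ` {..<s}) = W"
proof -
  obtain T where T: "finite T" "forms k = poly_space.span (T :: 'n mpoly set)"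
    by (rule forms_finite_span)
  have "{0} \<subseteq> W" using poly_space.subspace_0[OF W(1)] by simp
  note * = dim_mod_subspace(2)[OF finite_lessThan poly_space.subspace_single_0 W(1) this T(1), of s w]
  have "\<forall>x\<in>W. \<exists>c. x - (\<Sum>j<s. Const (c j) * w j) \<in> {0}"
  proof (subst *[symmetric])
    show "W \<subseteq> poly_space.span T" using W(2) T(2) by simp
    show "w j \<in> W" if "j \<in> {..<s}" for j using that W(3) by simp
    show "\<forall>j\<in>{..<s}. c j = 0" if "(\<Sum>j<s. Const (c j) * w j) \<in> {0}" for c
      using ind[of c] that by simp
    show "poly_space.dim ({0} :: 'n mpoly set) + card {..<s} = poly_space.dim W"
      by (simp add: dim_zero_space W(4))
  qed
  then have "W \<subseteq> poly_space.span (w ` {..<s})"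
  proof (intro subsetI)
    fix x assume "\<forall>x\<in>W. \<exists>c. x - (\<Sum>j<s. Const (c j) * w j) \<in> {0}" "x \<in> W"
    then obtain c where "x - (\<Sum>j<s. Const (c j) * w j) \<in> {0}" by blast
    then have "x = (\<Sum>j<s. Const (c j) * w j)" by simp
    moreover have "(\<Sum>j<s. Const (c j) * w j) \<in> poly_space.span (w ` {..<s})"
      by (intro poly_space.span_sum poly_space.span_scale poly_space.span_base imageI)
    ultimately show "x \<in> poly_space.span (w ` {..<s})" by (simp only:)
  qed
  moreover have "poly_space.span (w ` {..<s}) \<subseteq> W"
    by (rule poly_space.span_minimal[OF _ W(1)]) (use W(3) in auto)
  ultimately show span: "poly_space.span (w ` {..<s}) = W" by blast
  then have "s \<le> card (w ` {..<s})"
    using poly_space.dim_le_card[of W "w ` {..<s}"] W(4) by simp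
  then have "card (w ` {..<s}) = card {..<s}"
    using card_image_le[of "{..<s}" w] by simp
  then show inj: "inj_on w {..<s}" by (intro eq_card_imp_inj_on) simp_all
  show "poly_space.independent (w ` {..<s})"
  proof (rule poly_space.independent_if_scalars_zero)
    fix f x assume 0: "(\<Sum>x\<in>w ` {..<s}. Const (f x) * x) = 0" and "x \<in> w ` {..<s}"
    then obtain j where j: "j < s" "x = w j" by auto
    have "(\<Sum>j<s. Const (f (w j)) * w j) = 0" using 0 unfolding sum.reindex[OF inj] o_def .
    with ind[of "\<lambda>j. f (w j)"] j show "f x = 0" by simp
  qed simp
qed

lemma Hilb_closed_Hilb: "Hilb_closed r (Hilb r)"
  unfolding Hilb_closed_def by (intro exI[of _ "{}"]) simp

lemma Slip_subset_Hilb: "Slip r \<subseteq> Hilb r"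
  unfolding Slip_def by (rule hull_minimal[where S = "Hilb_closed r", OF _ Hilb_closed_Hilb]) blast

lemma subspace_Ann: "poly_ideal.subspace (Ann F)"
  by (rule poly_ideal.subspaceI) (simp_all add: Ann_def act_add_left act_mult)

lemma regular_lookup_reduced:
  assumes D: "\<And>G. eval D (lookup G) = det (gram G d q)"
  shows "regular D (\<lambda>G. lookup (f - lf q ^ k * lf (reduce G d q \<psi>)) m)"
proof -
  have "lookup (f - lf q ^ k * lf v) m = lookup f m - (\<Sum>l\<in>UNIV. v $ l * lookup (lf q ^ k * Var l) m)" for v
  proof -
    have "lf q ^ k * lf v = (\<Sum>l\<in>UNIV. Const (v $ l) * (lf q ^ k * Var l))"
      by (simp only: lf_def[of v] sum_distrib_left mult.left_commute)
    then show ?thesis by (simp only: lookup_minus lookup_sum lookup_Const_mult)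
  qed
  then show ?thesis
    by (simp only:) (intro regular_diff regular_sum regular_mult regular_const regular_reduce[OF D])
qed

context
  fixes F :: "'n::finite mpoly" and d :: nat and q :: "complex ^ 'n"
  assumes sec: "F \<in> secant_variety d CARD('n)" and nondeg: "det (gram F d q) \<noteq> 0" and d3: "d \<ge> 3"
begin

text \<open>The passage to the limit for all later identities. Leaving \<open>D\<close> general lets
  the regularity rules be used with any polynomial that computes the determinant.\<close>

lemma closure_principle:
  assumes "\<And>D. (\<And>G. eval D (lookup G) = det (gram G d q)) \<Longrightarrow> regular D f"
    and "\<And>G c a. G = (\<Sum>i\<in>(UNIV :: 'n set). Const (c i) * lf (a i) ^ d) \<Longrightarrow> det (gram G d q) \<noteq> 0
      \<Longrightarrow> f G = 0"
  shows "f F = 0"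
proof -
  obtain D where D: "\<And>G. eval D (lookup G) = det (gram G d q)" using det_gram_polynomial by blast
  show ?thesis
  proof (rule regular_vanish[OF sec assms(1)[OF D]])
    show "eval D (lookup F) \<noteq> 0" using nondeg by (simp only: D not_False_eq_True)
    fix G :: "'n mpoly" assume G: "G \<in> power_sums d CARD('n)" "eval D (lookup G) \<noteq> 0"
    obtain c a where "G = (\<Sum>i\<in>(UNIV :: 'n set). Const (c i) * lf (a i) ^ d)"
      using power_sums_CARD[OF G(1)] by blast
    then show "f G = 0" using G(2) unfolding D by (rule assms(2))
  qed
qed

text \<open>The definition of \<open>reduce\<close> fixes an order of the variables, so this says
  that the operators y_k/p commute as far as needed. It is what makes the kernel of the reduction an
  ideal.\<close>

lemma reduce_Var_mult:
  assumes "\<psi> \<in> forms k"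
  shows "reduce F d q (Var j * \<psi>) = mult_step F d q j (reduce F d q \<psi>)"
  unfolding vec_eq_iff
proof
  fix i
  have "reduce F d q (Var j * \<psi>) $ i - mult_step F d q j (reduce F d q \<psi>) $ i = 0"
  proof (rule closure_principle[where f = "\<lambda>G. reduce G d q (Var j * \<psi>) $ i - mult_step G d q j (reduce G d q \<psi>) $ i"])
    fix D assume "\<And>G. eval D (lookup G) = det (gram G d q)"
    from regular_reduce[OF this] regular_mult_step[OF this regular_reduce[OF this]]
    show "regular D (\<lambda>G. reduce G d q (Var j * \<psi>) $ i - mult_step G d q j (reduce G d q \<psi>) $ i)"
      by (intro regular_diff)
  next
    fix G c a assume "G = (\<Sum>i\<in>(UNIV :: 'n set). Const (c i) * lf (a i) ^ d)" "det (gram G d q) \<noteq> 0"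
    from reduce_Var_mult_power_sum[OF this d3 assms]
    show "reduce G d q (Var j * \<psi>) $ i - mult_step G d q j (reduce G d q \<psi>) $ i = 0" by simp
  qed
  then show "reduce F d q (Var j * \<psi>) $ i = mult_step F d q j (reduce F d q \<psi>) $ i" by simp
qed

lemma apolar_reduce:
  assumes "\<psi> \<in> forms d"
  shows "apolar \<psi> F = apolar (lf q ^ (d - 1) * lf (reduce F d q \<psi>)) F"
proof -
  have expand: "apolar (lf q ^ (d - 1) * lf v) G = (\<Sum>l\<in>UNIV. v $ l * apolar (lf q ^ (d - 1) * Var l) G)" for v G
  proof -
    have "lf q ^ (d - 1) * lf v = (\<Sum>l\<in>UNIV. Const (v $ l) * (lf q ^ (d - 1) * Var l))"
      by (simp only: lf_def[of v] sum_distrib_left mult.left_commute)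
    then show ?thesis by (simp only: apolar_sum_left apolar_scale_left)
  qed
  have "apolar \<psi> F - apolar (lf q ^ (d - 1) * lf (reduce F d q \<psi>)) F = 0"
  proof (rule closure_principle[where f = "\<lambda>G. apolar \<psi> G - apolar (lf q ^ (d - 1) * lf (reduce G d q \<psi>)) G"])
    fix D assume "\<And>G. eval D (lookup G) = det (gram G d q)"
    from regular_reduce[OF this]
    show "regular D (\<lambda>G. apolar \<psi> G - apolar (lf q ^ (d - 1) * lf (reduce G d q \<psi>)) G)"
      unfolding expand by (intro regular_diff regular_apolar regular_sum regular_mult)
  next
    fix G c a assume "G = (\<Sum>i\<in>(UNIV :: 'n set). Const (c i) * lf (a i) ^ d)" "det (gram G d q) \<noteq> 0"
    from apolar_reduce_power_sum[OF this d3 assms]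
    show "apolar \<psi> G - apolar (lf q ^ (d - 1) * lf (reduce G d q \<psi>)) G = 0" by simp
  qed
  then show ?thesis by simp
qed

lemma reduce_Const: "reduce F d q (Const c) = c *s q"
  by (simp add: Const_def reduce_single)

lemma reduce_Var: "reduce F d q (Var i) = axis i 1"
  using reduce_Var_mult[OF one_in_forms, of i] mult_step_q[OF nondeg d3] reduce_Const[of 1] by simp

lemma reduce_lf: "reduce F d q (lf v) = v"
  unfolding lf_def reduce_sum reduce_scale reduce_Var by (rule basis_expansion)

lemma reduce_lf_mult:
  assumes "\<psi> \<in> forms k"
  shows "reduce F d q (lf q * \<psi>) = reduce F d q \<psi>"
proof -
  have "lf q * \<psi> = (\<Sum>i\<in>UNIV. Const (q $ i) * (Var i * \<psi>))"
    by (simp only: lf_def[of q] sum_distrib_right mult.assoc)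
  then have "reduce F d q (lf q * \<psi>) = (\<Sum>i\<in>UNIV. q $ i *s mult_step F d q i (reduce F d q \<psi>))"
    by (simp only: reduce_sum reduce_scale reduce_Var_mult[OF assms])
  then show ?thesis by (simp only: sum_mult_step[OF nondeg d3])
qed

lemma reduce_power_lf: "reduce F d q (lf q ^ k * lf v) = v"
proof (induction k)
  case (Suc k)
  have "reduce F d q (lf q * (lf q ^ k * lf v)) = v"
    using reduce_lf_mult[OF power_lf_in_forms] Suc by simp
  then show ?case by (simp only: power_Suc mult.assoc)
qed (simp add: reduce_lf)

definition reduced_family :: "nat \<Rightarrow> 'n mpoly set" where
  "reduced_family k = {f \<in> forms k. reduce F d q f = 0}"

lemma split_reduced_family: "split_family q reduced_family"
  unfolding split_family_def
proof (intro conjI allI ballI impI)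
  note d = nondeg d3
  show "graded_family reduced_family"
    unfolding graded_family_def
  proof (intro conjI allI ballI)
    show "poly_space.subspace (reduced_family k)" for k
      unfolding reduced_family_def
      by (rule poly_space.subspaceI) (auto simp: reduce_add reduce_scale intro: forms_add forms_scale)
    show "reduced_family k \<subseteq> forms k" for k by (auto simp: reduced_family_def)
    show "Var i * p \<in> reduced_family (Suc k)" if "p \<in> reduced_family k" for i p k
      using that reduce_Var_mult[of p k i] mult_step_0[OF d]
      by (simp add: reduced_family_def Var_mult_forms)
  qed
  show q: "q \<noteq> 0" by (rule q_nonzero[OF d])
  have "f = 0" if f: "f \<in> forms 0" "reduce F d q f = 0" for f
  proof -
    have "lookup f 0 *s q = 0" using forms_0_eq_Const[OF f(1)] f(2) reduce_Const by metis
    with q have "lookup f 0 = 0" by (simp add: vector_mul_eq_0)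
    with forms_0_eq_Const[OF f(1)] show ?thesis by simp
  qed
  then show "reduced_family 0 = {0}" by (auto simp: reduced_family_def)
next
  fix k \<psi> assume \<psi>: "\<psi> \<in> (forms (Suc k) :: 'n mpoly set)"
  have "\<psi> - lf q ^ k * lf (reduce F d q \<psi>) \<in> reduced_family (Suc k)"
    unfolding reduced_family_def mem_Collect_eq reduce_diff reduce_power_lf diff_self
    by (intro conjI refl forms_diff power_lf_in_forms \<psi>)
  then show "\<exists>v. \<psi> - lf q ^ k * lf v \<in> reduced_family (Suc k)" by blast
next
  fix k v assume "lf q ^ k * lf v \<in> reduced_family (Suc k)"
  then show "v = 0" by (simp add: reduced_family_def reduce_power_lf)
qed

lemma reduced_family_graded: "graded_family reduced_family"
  using split_reduced_family unfolding split_family_def by blast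

text \<open>Up to degree d, testing against complementary forms \<phi> suffices: \<phi> \<psi> is
  again in the family, and in degree d its zero reduction makes the pairing with \<open>F\<close>
  zero. In larger degrees every form kills \<open>F\<close>.\<close>

lemma reduced_family_Ann: "reduced_family k \<subseteq> Ann F"
proof
  fix \<psi> assume \<psi>: "\<psi> \<in> reduced_family k"
  then have k: "\<psi> \<in> forms k" by (simp add: reduced_family_def)
  have F: "F \<in> forms d" by (rule secant_variety_forms[OF sec])
  have "act \<psi> F = 0"
  proof (cases "k \<le> d")
    case True
    then have d: "d = k + (d - k)" by simp
    show ?thesis
    proof (rule apolar_nondegenerate)
      show "act \<psi> F \<in> forms (d - k)" using act_in_forms[OF k] F d by metis
      fix \<phi> :: "'n mpoly" assume "\<phi> \<in> forms (d - k)"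
      then have "\<phi> * \<psi> \<in> reduced_family (d - k + k)"
        by (rule graded_family_mult[OF reduced_family_graded \<psi>])
      then have "\<phi> * \<psi> \<in> forms d" "reduce F d q (\<phi> * \<psi>) = 0"
        using True by (simp_all add: reduced_family_def)
      then have "apolar (\<phi> * \<psi>) F = 0" using apolar_reduce[of "\<phi> * \<psi>"] by simp
      then show "apolar \<phi> (act \<psi> F) = 0" by (simp only: apolar_def act_mult)
    qed
  next
    case False
    then show ?thesis using act_eq_0[OF k F] by simp
  qed
  then show "\<psi> \<in> Ann F" by (simp add: Ann_def)
qed

lemma reduced_ideal_Ann: "graded_ideal reduced_family \<subseteq> Ann F"
  unfolding graded_ideal_eq_span[OF reduced_family_graded]
  by (rule poly_ideal.span_minimal[OF _ subspace_Ann]) (use reduced_family_Ann in blast)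

text \<open>An annihilating quadric is p v modulo the family, so p v annihilates \<open>F\<close>
  too. Multiplying by p^(d-3) y_i gives row i of \<open>gram F d q *v v\<close>; hence v =
  0.\<close>

lemma Ann_quadrics: "Ann F \<inter> forms 2 = reduced_family 2"
proof
  show "reduced_family 2 \<subseteq> Ann F \<inter> forms 2"
    using reduced_family_Ann graded_familyD(2)[OF reduced_family_graded] by blast
  show "Ann F \<inter> forms 2 \<subseteq> reduced_family 2"
  proof
    fix \<psi> assume \<psi>: "\<psi> \<in> Ann F \<inter> forms 2"
    then have "\<psi> \<in> forms (Suc 1)" by (simp add: numeral_2_eq_2)
    then obtain v where v: "\<psi> - lf q ^ 1 * lf v \<in> reduced_family (Suc 1)"
      using split_spans[OF split_reduced_family] by blast
    have "\<psi> - (\<psi> - lf q ^ 1 * lf v) \<in> Ann F"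
      using \<psi> v reduced_family_Ann poly_ideal.subspace_diff[OF subspace_Ann] by blast
    then have "lf q * lf v \<in> Ann F" by simp
    then have mem: "lf q ^ (d - 3) * Var i * (lf q * lf v) \<in> Ann F" for i
      by (rule ideal_mult[OF subspace_Ann])
    have "gram F d q *v v = gram F d q *v 0"
      unfolding vec_eq_iff
    proof
      fix i
      have "lf q ^ (d - 2) * (Var i * lf v) = lf q ^ (d - 3) * Var i * (lf q * lf v)"
        by (simp only: power_lf_Suc[OF nondeg d3] mult_ac)
      then have "(gram F d q *v v) $ i = 0"
        using mem[of i] by (simp add: gram_mult_vec apolar_def Ann_def)
      then show "(gram F d q *v v) $ i = (gram F d q *v 0) $ i" by simp
    qed
    then have "v = 0" by (rule gram_inj[OF nondeg d3])
    with v show "\<psi> \<in> reduced_family 2" by (simp add: numeral_2_eq_2)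
  qed
qed

text \<open>
  Subtracting the reductions moves a frame of the limit ideal into the ideal of points of \<open>G\<close>.
  It stays linearly independent because it is unchanged modulo \<open>p\<^sup>k\<^sup>-\<^sup>1 S\<^sub>1\<close>, a complement of the
  limit ideal.
\<close>

lemma frame_power_sum:
  assumes G: "G = (\<Sum>i\<in>(UNIV :: 'n set). Const (c i) * lf (a i) ^ d)" "det (gram G d q) \<noteq> 0"
    and b: "frame b (graded_ideal reduced_family)"
  shows "frame (\<lambda>k j. b k j - lf q ^ (k - 1) * lf (reduce G d q (b k j))) (points_ideal (range a))"
    (is "frame ?b _")
  unfolding frame_def Let_def
proof (intro allI)
  fix k
  note V = split_vanishing_forms[OF G d3]
  let ?V = "vanishing_forms a"
  have V_graded: "graded_family ?V" using V by (simp add: split_family_def)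
  have int: "points_ideal (range a) \<inter> forms k = ?V k"
    unfolding vanishing_ideal[OF G d3, symmetric] by (rule graded_ideal_Int_forms[OF V_graded])
  define s where "s = poly_space.dim (reduced_family k)"
  have s: "poly_space.dim (?V k) = s"
    using dim_Hilb[OF split_Hilb[OF V], of k] dim_Hilb[OF split_Hilb[OF split_reduced_family], of k]
    unfolding graded_ideal_Int_forms[OF V_graded] graded_ideal_Int_forms[OF reduced_family_graded] s_def
    by linarith
  have bk: "inj_on (b k) {..<s}" "poly_space.independent (b k ` {..<s})"
    "poly_space.span (b k ` {..<s}) = reduced_family k" "\<forall>j\<ge>s. b k j = 0"
    using b unfolding frame_def Let_def graded_ideal_Int_forms[OF reduced_family_graded] s_def by blast+
  have bmem: "b k j \<in> reduced_family k" if "j < s" for j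
    using bk(3) poly_space.span_base[of "b k j" "b k ` {..<s}"] that by auto
  have "inj_on (?b k) {..<s} \<and> poly_space.independent (?b k ` {..<s}) \<and>
      poly_space.span (?b k ` {..<s}) = ?V k"
  proof (cases k)
    \<comment> \<open>In degree 0 both pieces are zero and the frame is empty, which makes the
      truncated exponent \<open>k - 1\<close> harmless.\<close>
    case 0
    have "reduced_family k = {0}" "?V k = {0}"
      using split_0[OF split_reduced_family] split_0[OF V] 0 by auto
    then show ?thesis
      using s by (simp add: dim_zero_space poly_space.independent_empty)
  next
    case (Suc l)
    have mem: "?b k j \<in> ?V k" if "j < s" for j
    proof -
      have f: "b k j \<in> forms (Suc l)" using bmem[OF that] Suc by (simp add: reduced_family_def)
      have "?b k j \<in> forms (Suc l)" unfolding Suc diff_Suc_1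
        using f Suc by (intro forms_diff power_lf_in_forms) simp
      moreover have "eval (?b k j) (($) (a i)) = 0" for i
        using reduce_at_pt[OF G d3 f, of i] Suc by simp
      ultimately show ?thesis using Suc by (simp add: vanishing_forms_def[OF G d3])
    qed
    have ind: "\<forall>j<s. e j = 0" if e: "(\<Sum>j<s. Const (e j) * ?b k j) = 0" for e
    proof -
      let ?v = "\<Sum>j<s. e j *s reduce G d q (b k j)"
      have "(\<Sum>j<s. Const (e j) * ?b k j)
          = (\<Sum>j<s. Const (e j) * b k j) - lf q ^ l * lf ?v"
        unfolding Suc diff_Suc_1 lf_sum lf_scale sum_distrib_left right_diff_distrib sum_subtractf
        by (simp only: mult.left_commute)
      with e have eq: "(\<Sum>j<s. Const (e j) * b k j) = lf q ^ l * lf ?v" by simp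
      have "(\<Sum>j<s. Const (e j) * b k j) \<in> reduced_family k"
        using bmem graded_familyD(1)[OF reduced_family_graded, of k]
        by (intro poly_space.subspace_sum poly_space.subspace_scale) auto
      then have "lf q ^ l * lf ?v \<in> reduced_family (Suc l)" unfolding eq unfolding Suc .
      then have v0: "?v = 0" by (rule split_inj[OF split_reduced_family])
      have "(\<Sum>j<s. Const (e j) * b k j) = 0" unfolding eq v0 by simp
      then show ?thesis
        using scalars_zero_of_independent[OF bk(1,2) finite_lessThan] by auto
    qed
    show ?thesis
      using family_basis[where w = "?b k", OF graded_familyD(1,2)[OF V_graded] mem s[symmetric] ind] by blast
  qed
  moreover have "\<forall>j\<ge>s. ?b k j = 0" using bk(4) by simp
  ultimately show "inj_on (?b k) {..<poly_space.dim (points_ideal (range a) \<inter> forms k)} \<and>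
     poly_space.independent (?b k ` {..<poly_space.dim (points_ideal (range a) \<inter> forms k)}) \<and>
     poly_space.span (?b k ` {..<poly_space.dim (points_ideal (range a) \<inter> forms k)})
       = points_ideal (range a) \<inter> forms k \<and>
     (\<forall>j\<ge>poly_space.dim (points_ideal (range a) \<inter> forms k). ?b k j = 0)"
    unfolding int s by blast
qed

text \<open>A closed set containing the ideals of points is given by equations \<open>E\<close> on
  frames. The deformed frames \<open>B G\<close> satisfy them for every nondegenerate sum
  \<open>G\<close>, their entries are regular in \<open>G\<close>, and \<open>B F\<close> is the
  given frame; the closure principle applies to each equation.\<close>

lemma reduced_ideal_Slip: "graded_ideal reduced_family \<in> Slip CARD('n)"
  unfolding Slip_def hull_def
proof (rule InterI, clarify)
  fix Z :: "'n mpoly set set"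
  assume "Hilb_closed CARD('n) Z"
    and sub: "{I \<in> Hilb CARD('n). saturated I \<and> (\<exists>A. distinct_points CARD('n) A \<and> I = points_ideal A)} \<subseteq> Z"
  then obtain E :: "(nat \<times> nat \<times> 'n monomial) mpoly set" where
    Z: "Z = {I \<in> Hilb CARD('n). \<forall>b. frame b I \<longrightarrow>
            (\<forall>p\<in>E. eval p (\<lambda>(k, j, m). lookup (b k j) m) = 0)}"
    unfolding Hilb_closed_def by blast
  have "eval p (\<lambda>(k, j, m). lookup (b k j) m) = 0"
    if b: "frame b (graded_ideal reduced_family)" and p: "p \<in> E" for b p
  proof -
    define B where "B G k j = b k j - lf q ^ (k - 1) * lf (reduce G d q (b k j))" for G k j
    have "b k j \<in> reduced_family k" for k j
    proof (cases "j < poly_space.dim (reduced_family k)")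
      case True
      then show ?thesis
        using b poly_space.span_base[of "b k j" "b k ` {..<poly_space.dim (reduced_family k)}"]
        unfolding frame_def Let_def graded_ideal_Int_forms[OF reduced_family_graded] by auto
    next
      case False
      then have "b k j = 0"
        using b unfolding frame_def Let_def graded_ideal_Int_forms[OF reduced_family_graded] by auto
      then show ?thesis using poly_space.subspace_0[OF graded_familyD(1)[OF reduced_family_graded]] by simp
    qed
    \<comment> \<open>Reduction with respect to \<open>F\<close> itself is zero on the limit ideal,
      so the deformation is trivial at \<open>F\<close>.\<close>
    then have BF: "B F k j = b k j" for k j by (simp add: B_def reduced_family_def)
    have "eval p (\<lambda>x. (\<lambda>(k, j, m) G. lookup (B G k j) m) x F) = 0"
    proof (rule closure_principle[where f = "\<lambda>G. eval p (\<lambda>x. (\<lambda>(k, j, m) G. lookup (B G k j) m) x G)"])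
      fix D assume D: "\<And>G. eval D (lookup G) = det (gram G d q)"
      show "regular D (\<lambda>G. eval p (\<lambda>x. (\<lambda>(k, j, m) G. lookup (B G k j) m) x G))"
      proof (rule regular_eval)
        fix x :: "nat \<times> nat \<times> 'n monomial"
        obtain k j m where x: "x = (k, j, m)" by (cases x)
        show "regular D ((\<lambda>(k, j, m) G. lookup (B G k j) m) x)"
          unfolding x case_prod_conv B_def by (rule regular_lookup_reduced[OF D])
      qed
    next
      fix G c a assume G: "G = (\<Sum>i\<in>(UNIV :: 'n set). Const (c i) * lf (a i) ^ d)" "det (gram G d q) \<noteq> 0"
      note V = split_vanishing_forms[OF G d3]
      have "points_ideal (range a) \<in> Hilb CARD('n)" "saturated (points_ideal (range a))"
        using split_Hilb[OF V] split_saturated[OF V] unfolding vanishing_ideal[OF G d3] by blast+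
      then have "points_ideal (range a) \<in> Z" using sub distinct_points_range[OF G d3] by blast
      moreover have "frame (B G) (points_ideal (range a))"
        unfolding B_def[abs_def] by (rule frame_power_sum[OF G b])
      ultimately have "eval p (\<lambda>(k, j, m). lookup (B G k j) m) = 0" using p unfolding Z by blast
      then show "eval p (\<lambda>x. (\<lambda>(k, j, m) G. lookup (B G k j) m) x G) = 0"
        by (simp add: case_prod_unfold)
    qed
    then show ?thesis by (simp add: case_prod_unfold BF)
  qed
  then show "graded_ideal reduced_family \<in> Z"
    unfolding Z using split_Hilb[OF split_reduced_family] by blast
qed

lemma VSP_reduced: "VSP F CARD('n) = {graded_ideal reduced_family}"
proof
  show "{graded_ideal reduced_family} \<subseteq> VSP F CARD('n)"
    using reduced_ideal_Slip reduced_ideal_Ann by (simp add: VSP_def)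
  show "VSP F CARD('n) \<subseteq> {graded_ideal reduced_family}"
  proof
    fix J assume "J \<in> VSP F CARD('n)"
    then have J: "J \<in> Hilb CARD('n)" "J \<subseteq> Ann F" using Slip_subset_Hilb by (auto simp: VSP_def)
    then have "J \<inter> forms 2 \<subseteq> reduced_family 2" using Ann_quadrics by blast
    from split_unique[OF split_reduced_family J(1) this]
    show "J \<in> {graded_ideal reduced_family}" by simp
  qed
qed

lemma VSP_eq_quadrics:
  "saturated (poly_ideal.span (Ann F \<inter> forms 2))"
  "VSP F CARD('n) = {poly_ideal.span (Ann F \<inter> forms 2)}"
  using VSP_reduced split_saturated[OF split_reduced_family]
  unfolding Ann_quadrics split_generated_by_quadrics[OF split_reduced_family] by blast+

end

section \<open>One variable\<close>

text \<open>
  For \<open>n = 0\<close> the degree \<open>d = 2\<close> is allowed. Then the operators of degree \<open>d - 3\<close> behind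
  \<open>gram_Var\<close> make no sense, but the zero ideal is the only point of the Hilbert scheme.
\<close>

lemma span_zero_ideal: "poly_ideal.span {0 :: 'i mpoly} = {0}"
  by (simp only: poly_ideal.span_eq_iff poly_ideal.subspace_single_0)

context
  assumes one: "CARD('n::finite) = 1"
begin

text \<open>There is a single monomial in each degree, so the value at 1 is the only
  coefficient.\<close>

lemma one_variable_eq_0:
  fixes f :: "'n mpoly"
  assumes "f \<in> forms k" "eval f (\<lambda>_. 1) = 0"
  shows "f = 0"
proof -
  obtain u :: 'n where u: "UNIV = {u}" using card_1_singletonE[OF one] by blast
  have deg: "mon_degree m = lookup m u" for m :: "'n monomial"
    using mon_degree_superset[of "{u}" m] subset_UNIV[of "keys m"] unfolding u by simp
  have same: "m = m'" if "mon_degree m = k" "mon_degree m' = k" for m m' :: "'n monomial"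
  proof (rule poly_mapping_eqI)
    fix i
    have "i = u" using u by blast
    then show "lookup m i = lookup m' i" using that by (simp add: deg)
  qed
  show ?thesis
  proof (rule ccontr)
    assume "f \<noteq> 0"
    then obtain m where m: "lookup f m \<noteq> 0" by (metis poly_mapping_eqI lookup_zero)
    have "f = single m (lookup f m)"
    proof (rule poly_mapping_eqI)
      fix m'
      show "lookup f m' = lookup (single m (lookup f m)) m'"
        using assms(1) m same[of m m'] by (cases "lookup f m' = 0") (auto simp: forms_iff lookup_single when_def)
    qed
    then have "eval f (\<lambda>_. 1) = lookup f m * mon_eval m (\<lambda>_. 1)" by (metis eval_single)
    with m assms(2) show False by (simp add: mon_eval_def)
  qed
qed

lemma one_variable_dim_forms: "poly_space.dim (forms k :: 'n mpoly set) \<le> 1"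
proof -
  obtain u :: 'n where "UNIV = {u}" using card_1_singletonE[OF one] by blast
  have mem: "Var u ^ k \<in> (forms k :: 'n mpoly set)" by (rule forms_power[OF Var_in_forms])
  have "forms k \<subseteq> poly_space.span {Var u ^ k :: 'n mpoly}"
  proof
    fix f :: "'n mpoly" assume f: "f \<in> forms k"
    have "f - Const (eval f (\<lambda>_. 1)) * Var u ^ k = 0"
      by (rule one_variable_eq_0[of _ k]) (use forms_diff[OF f forms_scale[OF mem]] in simp_all)
    then have "f = Const (eval f (\<lambda>_. 1)) * Var u ^ k" by simp
    then show "f \<in> poly_space.span {Var u ^ k}"
      by (metis poly_space.span_base poly_space.span_scale singletonI)
  qed
  from poly_space.dim_le_card[OF this] show ?thesis by simp
qed

text \<open>Each S_k has dimension at most 1, so the prescribed quotient dimension leaves nothing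
  for the ideal.\<close>

lemma one_variable_Hilb: "Hilb 1 = {{0 :: 'n mpoly}}"
proof -
  have eq: "J = {0}" if J: "J \<in> Hilb 1" for J :: "'n mpoly set"
  proof -
    have hom: "homogeneous_ideal J" using J by (simp add: Hilb_def)
    have sub: "poly_space.subspace (J \<inter> forms k)" for k
      by (intro poly_space.subspace_inter subspace_ideal homogeneous_ideal_subspace hom subspace_forms)
    have "{0} = J \<inter> forms k" for k
    proof (rule subspace_dim_equal)
      show "poly_space.dim {0 :: 'n mpoly} = poly_space.dim (J \<inter> forms k)"
        using dim_Hilb[OF J, of k] one_variable_dim_forms[of k] by (simp add: dim_zero_space)
    qed (use sub poly_space.subspace_0[OF sub] in auto)
    then have "poly_ideal.span (\<Union>k. J \<inter> forms k) = poly_ideal.span {0}" by simp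
    then show ?thesis using hom unfolding homogeneous_ideal_def span_zero_ideal by simp
  qed
  have "homogeneous_ideal {0 :: 'n mpoly}"
  proof -
    have "(\<Union>k. {0 :: 'n mpoly} \<inter> forms k) = {0}" by auto
    then show ?thesis by (simp add: homogeneous_ideal_def span_zero_ideal)
  qed
  moreover have "hilbert_fun {0 :: 'n mpoly} k = min 1 (poly_space.dim (forms k :: 'n mpoly set))" for k
  proof -
    have "{0 :: 'n mpoly} \<inter> forms k = {0}" by auto
    then show ?thesis using one_variable_dim_forms[of k] by (simp add: hilbert_fun_def dim_zero_space)
  qed
  ultimately have "{0 :: 'n mpoly} \<in> Hilb 1" by (simp add: Hilb_def)
  with eq show ?thesis by blast
qed

lemma one_variable_saturated: "saturated {0 :: 'n mpoly}"
  unfolding saturated_def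
proof safe
  fix f :: "'n mpoly" and k
  assume f: "\<forall>g\<in>poly_ideal.span (forms k). g * f \<in> {0}"
  obtain u :: 'n where "UNIV = {u}" using card_1_singletonE[OF one] by blast
  have mem: "Var u ^ k \<in> (forms k :: 'n mpoly set)" by (rule forms_power[OF Var_in_forms])
  then have 0: "Var u ^ k * f = 0" using f poly_ideal.span_base by blast
  have "hcomp j f = 0" for j
  proof (rule one_variable_eq_0[OF hcomp_in_forms])
    have "Var u ^ k * hcomp j f = 0" using hcomp_mult_forms[OF mem, of j f] 0 by simp
    then have "eval (Var u ^ k * hcomp j f) (\<lambda>_. 1) = 0" by (simp only: eval_0)
    then show "eval (hcomp j f) (\<lambda>_. 1) = 0" by simp
  qed
  then show "f = 0" using sum_hcomp[of f "top_degree f"] by simp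
qed

lemma one_variable_Slip: "Slip 1 = {{0 :: 'n mpoly}}"
proof -
  let ?a = "(\<chi> i. 1) :: complex ^ 'n"
  have a: "($) ?a = (\<lambda>_. 1)" by (rule ext) simp
  have "{f. (\<exists>k. f \<in> forms k) \<and> (\<forall>a\<in>{?a}. eval f (($) a) = 0)} = {0}"
    unfolding ball_simps a using one_variable_eq_0 by auto
  then have pts: "points_ideal {?a} = {0}" by (simp add: points_ideal_def span_zero_ideal)
  have dist: "distinct_points 1 {?a}" by (simp add: distinct_points_def vec_eq_iff)
  have "{0 :: 'n mpoly} \<in> {I \<in> Hilb 1. saturated I \<and> (\<exists>A. distinct_points 1 A \<and> I = points_ideal A)}"
    by (intro CollectI conjI exI[of _ "{?a}"] one_variable_saturated dist pts[symmetric])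
      (simp only: one_variable_Hilb singleton_iff)
  then have "{0 :: 'n mpoly} \<in> Slip 1" unfolding Slip_def by (rule hull_inc)
  with Slip_subset_Hilb[of 1] one_variable_Hilb show ?thesis by blast
qed

lemma one_variable_VSP: "VSP F 1 = {{0 :: 'n mpoly}}"
  unfolding VSP_def one_variable_Slip using poly_ideal.subspace_0[OF subspace_Ann[of F]] by auto

text \<open>A quadric is its coefficient times the square of the variable. Multiplying by the
  (d-2)-nd power and pairing with \<open>F\<close> returns that coefficient up to a nonzero
  factor.\<close>

lemma one_variable_Ann:
  fixes F :: "'n mpoly"
  assumes F: "F \<in> forms d" "concise F" "d \<ge> 2"
  shows "Ann F \<inter> forms 2 = {0}"
proof -
  obtain u :: 'n where u: "UNIV = {u}" using card_1_singletonE[OF one] by blast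
  have Fd: "eval F (\<lambda>_. 1) \<noteq> 0"
  proof
    assume "eval F (\<lambda>_. 1) = 0"
    then have "F = 0" by (rule one_variable_eq_0[OF F(1)])
    then have "Var u \<in> Ann F \<inter> forms 1" using Var_in_forms[of u] by (simp add: Ann_def)
    then have "Var u = (0 :: 'n mpoly)" using F(2) unfolding concise_def by blast
    then have "eval (Var u :: 'n mpoly) (\<lambda>_. 1) = 0" by (simp only: eval_0)
    then show False by simp
  qed
  have "\<psi> = 0" if \<psi>: "\<psi> \<in> Ann F" "\<psi> \<in> forms 2" for \<psi>
  proof -
    have d: "d = (d - 2) + 2" using F(3) by simp
    let ?e = "\<lambda>g :: 'n mpoly. eval g (\<lambda>_. 1)"
    have form: "g = Const (?e g) * lf (axis u 1) ^ k" if "g \<in> forms k" for g k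
    proof -
      have "g - Const (?e g) * lf (axis u 1) ^ k \<in> forms k"
        by (intro forms_diff that forms_scale forms_power lf_in_forms)
      then have "g - Const (?e g) * lf (axis u 1) ^ k = 0"
        by (rule one_variable_eq_0) (simp add: lf_axis)
      then show ?thesis by simp
    qed
    have "apolar (lf (axis u 1) ^ (d - 2) * \<psi>) F = 0"
      using \<psi>(1) by (simp add: apolar_def Ann_def act_mult)
    moreover have "lf (axis u 1) ^ (d - 2) * \<psi> = Const (?e \<psi>) * lf (axis u 1) ^ d"
    proof -
      have "lf (axis u 1) ^ (d - 2) * \<psi> \<in> forms d"
        using forms_mult[OF forms_power[OF lf_in_forms] \<psi>(2)] d by metis
      from form[OF this] show ?thesis by (simp add: lf_axis)
    qed
    ultimately have "?e \<psi> * (fact d * eval F (($) (axis u 1))) = 0"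
      by (simp add: apolar_scale_left apolar_power_lf[OF F(1)])
    moreover have "($) (axis u 1 :: complex ^ 'n) = (\<lambda>_. 1)"
    proof
      fix i
      have "i = u" using u by blast
      then show "axis u 1 $ i = (1 :: complex)" by simp
    qed
    ultimately have "?e \<psi> = 0" using Fd by simp
    then show ?thesis by (rule one_variable_eq_0[OF \<psi>(2)])
  qed
  then show ?thesis using poly_ideal.subspace_0[OF subspace_Ann[of F]] by auto
qed

end

section \<open>The theorem\<close>

text \<open>The \<open>LEAST\<close> in \<open>border_rank\<close> says something about
  \<open>F\<close> only if some r qualifies; powers of linear forms span the forms of degree d, so a
  finite sum exists.\<close>

lemma exists_secant_variety:
  fixes F :: "'n::finite mpoly"
  assumes F: "F \<in> forms d" "F \<noteq> 0" "d > 0"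
  shows "\<exists>r. F \<in> secant_variety d r"
proof -
  have "F \<in> poly_space.span (range (\<lambda>a. lf a ^ d))" using forms_subset_span_powers F(1) by blast
  then obtain T r where T: "finite T" "T \<subseteq> range (\<lambda>a. lf a ^ d)" "F = (\<Sum>x\<in>T. Const (r x) * x)"
    unfolding poly_space.span_explicit by blast
  have "F \<in> poly_space.span T"
    unfolding T(3) by (intro poly_space.span_sum poly_space.span_scale poly_space.span_base)
  \<comment> \<open>The zero vector is dropped because \<open>power_sums\<close> demands nonzero
    linear forms.\<close>
  then have span: "F \<in> poly_space.span (T - {0})" by simp
  obtain xs where xs: "set xs = T - {0}" using finite_list[OF finite_Diff[OF T(1)]] by metis
  have "\<exists>a. xs ! i = lf a ^ d" if "i < length xs" for i
    using nth_mem[OF that] T(2) xs by blast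
  then obtain a where a: "xs ! i = lf (a i) ^ d" if "i < length xs" for i by metis
  have "F \<in> power_sums d (length xs)"
    unfolding power_sums_def
  proof (intro CollectI conjI exI[of _ "\<lambda>i. lf (a i)"] allI impI)
    show "F \<in> forms d - {0}" using F by simp
    show "lf (a i) \<in> forms 1 - {0}" if "i < length xs" for i
    proof -
      have "xs ! i \<noteq> 0" using nth_mem[OF that] xs by blast
      then have "lf (a i) \<noteq> 0" using a[OF that] F(3) by (metis zero_power)
      then show ?thesis using lf_in_forms by blast
    qed
    have "(\<lambda>i. lf (a i) ^ d) ` {..<length xs} = (\<lambda>i. xs ! i) ` {..<length xs}"
      by (rule image_cong) (simp_all add: a)
    also have "\<dots> = T - {0}" using xs by (auto simp: set_conv_nth)
    finally show "F \<in> poly_space.span ((\<lambda>i. lf (a i) ^ d) ` {..<length xs})" using span by simp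
  qed
  then show ?thesis unfolding secant_variety_eq by (blast intro: hull_inc)
qed

lemma concise_nonzero:
  fixes F :: "'n::finite mpoly"
  assumes "concise F"
  shows "F \<noteq> 0"
proof
  assume "F = 0"
  then have "lf (axis undefined 1 :: complex ^ 'n) \<in> Ann F \<inter> forms 1" by (simp add: Ann_def)
  then have "lf (axis undefined 1 :: complex ^ 'n) = 0" using assms unfolding concise_def by blast
  then show False by (simp add: axis_eq_0_iff)
qed

theorem corollary7p9:
  fixes F :: "'n::finite mpoly" and n d :: nat
  assumes "CARD('n) = n + 1"
    and "d = 3 \<or> d \<ge> n + 2"
    and "F \<in> forms d"
    and "concise F"
    and "border_rank d F = n + 1"
  shows "(Hess F \<noteq> 0 \<longleftrightarrow> (\<exists>J. saturated J \<and> VSP F (n + 1) = {J})) \<and>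
         (Hess F \<noteq> 0 \<longrightarrow>
            saturated (poly_ideal.span (Ann F \<inter> forms 2)) \<and>
            VSP F (n + 1) = {poly_ideal.span (Ann F \<inter> forms 2)})"
proof -
  have d2: "d \<ge> 2" using assms(2) by auto
  have sec: "F \<in> secant_variety d CARD('n)"
    using LeastI_ex[OF exists_secant_variety[OF assms(3) concise_nonzero[OF assms(4)]]] d2 assms(1,5)
    by (simp add: border_rank_def)
  have forward: "saturated (poly_ideal.span (Ann F \<inter> forms 2)) \<and>
      VSP F CARD('n) = {poly_ideal.span (Ann F \<inter> forms 2)}" if H: "Hess F \<noteq> 0"
  proof (cases "d \<ge> 3")
    case True
    obtain q where "det (gram F d q) \<noteq> 0" using H Hess_nonzero_iff[OF assms(3) d2] by blast
    from VSP_eq_quadrics[OF sec this True] show ?thesis by blast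
  next
    case False
    \<comment> \<open>Here d = 2, so the alternative d at least n+2 holds and forces n = 0.\<close>
    with assms(1,2) have one: "CARD('n) = 1" by linarith
    have "poly_ideal.span (Ann F \<inter> forms 2) = {0}"
      unfolding one_variable_Ann[OF one assms(3,4) d2] by (rule span_zero_ideal)
    then show ?thesis
      using one_variable_VSP[OF one, of F] one_variable_saturated[OF one] one by simp
  qed
  have backward: "Hess F \<noteq> 0" if sat: "saturated J" and VSP: "VSP F CARD('n) = {J}" for J
  proof -
    have "J \<in> VSP F CARD('n)" using VSP by simp
    then have J: "J \<in> Hilb CARD('n)" "J \<subseteq> Ann F" using Slip_subset_Hilb by (auto simp: VSP_def)
    obtain q where "split_family q (\<lambda>k. J \<inter> forms k)" using saturated_Hilb_split[OF J(1) sat] by blast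
    from concise_gram[OF assms(3,4) d2 this] J(2) have "det (gram F d q) \<noteq> 0" by blast
    then show ?thesis using Hess_nonzero_iff[OF assms(3) d2] by blast
  qed
  have iff: "Hess F \<noteq> 0 \<longleftrightarrow> (\<exists>J. saturated J \<and> VSP F CARD('n) = {J})"
  proof
    assume "Hess F \<noteq> 0"
    from exI[of "\<lambda>J. saturated J \<and> VSP F CARD('n) = {J}", OF forward[OF this]]
    show "\<exists>J. saturated J \<and> VSP F CARD('n) = {J}" .
  next
    assume "\<exists>J. saturated J \<and> VSP F CARD('n) = {J}"
    then obtain J where "saturated J \<and> VSP F CARD('n) = {J}" ..
    then show "Hess F \<noteq> 0" by (intro backward) simp_all
  qed
  show ?thesis
    unfolding assms(1)[symmetric] by (rule conjI[OF iff], rule impI, rule forward)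
qed

end
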